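(* Let $\mathcal A=\{0.001k:\ k\in\mathbb N,\ 1\le k\le1000\}$, $\mathcal A^{-1}=\{1/x:\ x\in\mathcal A\}$, and let $\mathcal L_3^o$ be the space of three-dimensional Bravais lattices of density one. There exists $\alpha_1>0$ such that for every $\alpha>\alpha_1$ the value $y=1$ is not a minimizer of $y\mapsto\theta_{L_{y,1}}(\alpha)$ over $y\geq 1$ and BCC is not a local minimizer of $\Lambda\mapsto\theta_\Lambda(\alpha)$ over $\mathcal L_3^o$, such that for every $0<\alpha<1/\alpha_1$ FCC is not a local minimizer of $\Lambda\mapsto\theta_\Lambda(\alpha)$ over $\mathcal L_3^o$, and such that the following hold: - For $\alpha\in\mathcal A$, BCC is a local minimum of $\Lambda\mapsto\theta_\Lambda(\alpha)$ over $\mathcal L_3^o$. For $\alpha>\alpha_1$ there are two (linearly independent) directions in the tangent space $T_{BCC}\mathcal L_3^o$ along which BCC is a local maximum of $\Lambda\mapsto\theta_\Lambda(\alpha)$ and three (linearly independent) directions along which it is a local minimum. - For $\alpha\in\mathcal A^{-1}$, FCC is a local minimum of $\Lambda\mapsto\theta_\Lambda(\alpha)$ over $\mathcal L_3^o$. For $0<\alpha<1/\alpha_1$ there are two (linearly independent) directions in the tangent space $T_{FCC}\mathcal L_3^o$ along which FCC is a local maximum of $\Lambda\mapsto\theta_\Lambda(\alpha)$ and three (linearly independent) directions along which it is a local minimum.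
   Context: A Bravais lattice in $\mathbb R^3$ is the $\mathbb Z$-span of a basis of $\mathbb R^3$; $\theta_\Lambda(\alpha)=\sum_{p\in\Lambda}e^{-\pi\alpha|p|^2}$. $\mathcal L_3^o$ is the $5$-dimensional space of lattices $M\mathbb Z^3$, $M\in SL(3,\mathbb R)$, considered up to rotation, with its usual smooth structure near a lattice (volume-preserving deformations modulo rotations). A lattice $\Lambda_*$ is a local maximum (resp. minimum) along a direction $v\in T_{\Lambda_*}\mathcal L_3^o$ if there is a smooth curve in $\mathcal L_3^o$ through $\Lambda_*$ with velocity $v$ there, along which $\Lambda\mapsto\theta_\Lambda(\alpha)$ has a local maximum (resp. minimum) at $\Lambda_*$. BCC denotes the density-one rescaling of $\mathbb Z^3\cup(\mathbb Z^3+(1/2,1/2,1/2))$, and FCC the density-one rescaling of $\bigcup\{\mathbb Z^3+\tau:\tau\in\{(0,0,0),(1/2,1/2,0),(1/2,0,1/2),(0,1/2,1/2)\}\}$. For $y\ge1$, $$L_{y,1}=\bigcup_{k\in\mathbb Z}\Big(\mathbb Z(\sqrt y,0,0)+\mathbb Z\big(0,\tfrac1{\sqrt y},0\big)+\mathbf s(k)+k\,(0,0,1/2)\Big),$$ with $\mathbf s(k)=\big(\tfrac{\sqrt y}2,\tfrac1{2\sqrt y},0\big)$ for $k$ odd and $\mathbf s(k)=0$ for $k$ even. *)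

theory Defs
  imports "HOL-Analysis.Analysis"
begin

definition theta :: "(real^3) set \<Rightarrow> real \<Rightarrow> real" where
  "theta \<Lambda> \<alpha> = (\<Sum>\<^sub>\<infinity>p\<in>\<Lambda>. exp (- pi * \<alpha> * (norm p)\<^sup>2))"

definition Z3 :: "(real^3) set" where
  "Z3 = {p. \<forall>i. p $ i \<in> \<int>}"

definition SL3 :: "(real^3^3) set" where
  "SL3 = {M. det M = 1}"

definition lattice_of :: "real^3^3 \<Rightarrow> (real^3) set" where
  "lattice_of M = (*v) M ` Z3"

text \<open>A point of the space of density-one lattices is a lattice up to rotation, represented by
  the set of all its rotated copies.\<close>

definition rot_class :: "(real^3) set \<Rightarrow> (real^3) set set" where
  "rot_class \<Lambda> = {(*v) R ` \<Lambda> | R. rotation_matrix R}"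

definition L3o :: "(real^3) set set set" where
  "L3o = (\<lambda>M. rot_class (lattice_of M)) ` SL3"

text \<open>The quotient topology: the finest one making \<open>M \<mapsto> rot_class (lattice_of M)\<close> continuous
  on \<open>SL3\<close>.\<close>

definition L3o_topology :: "(real^3) set set topology" where
  "L3o_topology = topology (\<lambda>U. U \<subseteq> L3o \<and>
     openin (top_of_set SL3) {M \<in> SL3. rot_class (lattice_of M) \<in> U})"

lemma openin_L3o_topology:
  "openin L3o_topology U \<longleftrightarrow> U \<subseteq> L3o \<and>
     openin (top_of_set SL3) {M \<in> SL3. rot_class (lattice_of M) \<in> U}"
proof -
  let ?P = "\<lambda>U. {M \<in> SL3. rot_class (lattice_of M) \<in> U}"
  have "istopology (\<lambda>U. U \<subseteq> L3o \<and> openin (top_of_set SL3) (?P U))"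
    unfolding istopology_def
  proof (rule conjI; intro allI impI)
    fix S T
    assume S: "S \<subseteq> L3o \<and> openin (top_of_set SL3) (?P S)"
      and T: "T \<subseteq> L3o \<and> openin (top_of_set SL3) (?P T)"
    have "?P (S \<inter> T) = ?P S \<inter> ?P T" by blast
    then have "openin (top_of_set SL3) (?P (S \<inter> T))"
      using S T by (simp only: openin_Int)
    with S show "S \<inter> T \<subseteq> L3o \<and> openin (top_of_set SL3) (?P (S \<inter> T))" by blast
  next
    fix \<K>
    assume K: "\<forall>K\<in>\<K>. K \<subseteq> L3o \<and> openin (top_of_set SL3) (?P K)"
    have eq: "?P (\<Union>\<K>) = \<Union>(?P ` \<K>)" by blast
    have "openin (top_of_set SL3) (\<Union>(?P ` \<K>))"
      using K by (intro openin_Union) blast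
    then have "openin (top_of_set SL3) (?P (\<Union>\<K>))" by (simp only: eq)
    with K show "\<Union>\<K> \<subseteq> L3o \<and> openin (top_of_set SL3) (?P (\<Union>\<K>))" by blast
  qed
  then show ?thesis
    unfolding L3o_topology_def by simp
qed

definition local_minimizer :: "real \<Rightarrow> (real^3) set \<Rightarrow> bool" where
  "local_minimizer \<alpha> \<Lambda>\<^sub>0 \<longleftrightarrow>
     (\<exists>U. openin L3o_topology U \<and> rot_class \<Lambda>\<^sub>0 \<in> U \<and>
          (\<forall>\<Lambda>. rot_class \<Lambda> \<in> U \<longrightarrow> theta \<Lambda>\<^sub>0 \<alpha> \<le> theta \<Lambda> \<alpha>))"

text \<open>
  Near \<open>\<Lambda>\<^sub>0\<close> a smooth curve of density-one lattices through \<open>\<Lambda>\<^sub>0\<close> is, up to rotation,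
  \<open>t \<mapsto> F t \<Lambda>\<^sub>0\<close> for a smooth family \<open>F\<close> of matrices of determinant one with \<open>F 0 = I\<close>.
  Hence the tangent space at \<open>\<Lambda>\<^sub>0\<close> is the quotient of the traceless matrices (infinitesimal
  volume-preserving deformations) by the antisymmetric ones (infinitesimal rotations), and the
  velocity of the curve is the class of \<open>F' 0\<close>. Tangent vectors are given below by
  representatives in \<open>sl3\<close>; equality and linear independence are taken modulo \<open>so3\<close>.
\<close>

definition sl3 :: "(real^3^3) set" where
  "sl3 = {A. trace A = 0}"

definition so3 :: "(real^3^3) set" where
  "so3 = {A. transpose A = - A}"

definition independent_directions :: "nat \<Rightarrow> (nat \<Rightarrow> real^3^3) \<Rightarrow> bool" where
  "independent_directions n v \<longleftrightarrow> (\<forall>i<n. v i \<in> sl3) \<and>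
     (\<forall>c :: nat \<Rightarrow> real. (\<Sum>i<n. c i *\<^sub>R v i) \<in> so3 \<longrightarrow> (\<forall>i<n. c i = 0))"

definition smooth_on_open :: "real set \<Rightarrow> (real \<Rightarrow> real^3^3) \<Rightarrow> bool" where
  "smooth_on_open I F \<longleftrightarrow> open I \<and>
     (\<exists>D :: nat \<Rightarrow> real \<Rightarrow> real^3^3. (\<forall>t\<in>I. D 0 t = F t) \<and>
        (\<forall>n. \<forall>t\<in>I. (D n has_vector_derivative D (Suc n) t) (at t)))"

definition deformation_with_velocity :: "(real \<Rightarrow> real^3^3) \<Rightarrow> real^3^3 \<Rightarrow> bool" where
  "deformation_with_velocity F v \<longleftrightarrow>
     (\<exists>I. 0 \<in> I \<and> smooth_on_open I F \<and> (\<forall>t\<in>I. F t \<in> SL3)) \<and> F 0 = mat 1 \<and>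
     vector_derivative F (at 0) - v \<in> so3"

definition local_max_along :: "real \<Rightarrow> (real^3) set \<Rightarrow> real^3^3 \<Rightarrow> bool" where
  "local_max_along \<alpha> \<Lambda>\<^sub>0 v \<longleftrightarrow>
     (\<exists>F. deformation_with_velocity F v \<and>
          (\<forall>\<^sub>F t in nhds 0. theta ((*v) (F t) ` \<Lambda>\<^sub>0) \<alpha> \<le> theta \<Lambda>\<^sub>0 \<alpha>))"

definition local_min_along :: "real \<Rightarrow> (real^3) set \<Rightarrow> real^3^3 \<Rightarrow> bool" where
  "local_min_along \<alpha> \<Lambda>\<^sub>0 v \<longleftrightarrow>
     (\<exists>F. deformation_with_velocity F v \<and>
          (\<forall>\<^sub>F t in nhds 0. theta \<Lambda>\<^sub>0 \<alpha> \<le> theta ((*v) (F t) ` \<Lambda>\<^sub>0) \<alpha>))"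

text \<open>The unions below have 2 and 4 points per unit volume, so lengths are multiplied by the
  cube roots of 2 and 4 to reach density one.\<close>

definition BCC :: "(real^3) set" where
  "BCC = (*\<^sub>R) (root 3 2) ` (Z3 \<union> (+) (vector [1/2, 1/2, 1/2]) ` Z3)"

definition FCC :: "(real^3) set" where
  "FCC = (*\<^sub>R) (root 3 4) `
     (\<Union>\<tau> \<in> {vector [0, 0, 0], vector [1/2, 1/2, 0], vector [1/2, 0, 1/2], vector [0, 1/2, 1/2]}.
        (+) \<tau> ` Z3)"

definition layer_shift :: "real \<Rightarrow> int \<Rightarrow> real^3" where
  "layer_shift y k = (if odd k then vector [sqrt y / 2, 1 / (2 * sqrt y), 0] else 0)"

definition L_y1 :: "real \<Rightarrow> (real^3) set" where
  "L_y1 y = (\<Union>k::int.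
     {of_int m *\<^sub>R vector [sqrt y, 0, 0] + of_int n *\<^sub>R vector [0, 1 / sqrt y, 0]
        + layer_shift y k + of_int k *\<^sub>R vector [0, 0, 1/2] | m n :: int. True})"

definition alphas :: "real set" where
  "alphas = {0.001 * real k | k :: nat. 1 \<le> k \<and> k \<le> 1000}"

definition inv_alphas :: "real set" where
  "inv_alphas = {1 / x | x. x \<in> alphas}"

end

theory Submission
  imports Defs "HOL-Probability.Characteristic_Functions"
begin

text \<open>
  A volume-preserving deformation \<open>S\<close> changes theta only through the strain \<open>X = S\<^sup>T S - 1\<close>, because
  \<open>\<bar>S p\<bar>\<^sup>2 = \<bar>p\<bar>\<^sup>2 + p \<bullet> X p\<close>. On a set with the symmetries of the cube one may average over sign
  changes and cyclic permutations of the coordinates. This turns the quadratic Taylor polynomial of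
  \<open>exp (- \<kappa> p \<bullet> X p)\<close>, with \<open>\<kappa> = \<pi> \<alpha>\<close>, into a combination of the trace of \<open>X\<close>, the sum \<open>s\<close> of the squared
  diagonal entries and the sum \<open>o\<close> of the squared entries above the diagonal; the constraint
  \<open>det (1 + X) = 1\<close> then expresses the trace by \<open>s / 2 + o\<close> up to third order. The outcome is theorem
  \<open>second_variation\<close>: theta changes by \<open>(\<kappa> / 6) D s + (\<kappa> / 3) O o\<close> up to an error of order \<open>\<bar>X\<bar>\<^sup>3\<close>, where \<open>D\<close> (\<open>diag_coeff\<close>) and
  \<open>O\<close> (\<open>off_coeff\<close>) are the Gaussian sums of \<open>\<kappa> / 2\<close> times the sum of the \<open>(p\<^sub>i\<^sup>2 - p\<^sub>j\<^sup>2)\<^sup>2\<close>, minus \<open>\<bar>p\<bar>\<^sup>2\<close>, and of \<open>2 \<kappa>\<close> times the sum of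
  the \<open>p\<^sub>i\<^sup>2 p\<^sub>j\<^sup>2\<close>, minus \<open>\<bar>p\<bar>\<^sup>2\<close>.

  Two signs therefore decide everything. If \<open>D\<close> and \<open>O\<close> are positive, the set is a local minimum
  (\<open>stableI\<close>). If \<open>D < 0\<close>, theta decreases strictly along the flows \<open>diag (exp (d\<^sub>i t))\<close> with \<open>d\<^sub>1 + d\<^sub>2 + d\<^sub>3 = 0\<close>, which
  fill two dimensions (\<open>theta_less_diagonal\<close>). If \<open>O > 0\<close>, theta increases along the shears \<open>1 + t E\<^sub>i\<^sub>j\<close>, which fill
  the other three (\<open>theta_le_shear\<close>).

  For FCC and every \<open>\<alpha> \<ge> 1\<close> both signs are positive (\<open>fcc_diag_pos\<close>, \<open>fcc_off_pos\<close>): almost every term of the two sums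
  is nonnegative, and each of the few negative ones is outweighed by a term of smaller norm or by the
  second shell. For BCC and large \<open>\<alpha>\<close> the eight shortest vectors dominate (\<open>bcc_signs\<close>). They have three
  equal \<open>p\<^sub>i\<^sup>2\<close>, so that they contribute only \<open>- \<bar>p\<bar>\<^sup>2\<close> to \<open>D\<close>, whereas \<open>O\<close> is positive.

  BCC and FCC are dual lattices, and Poisson summation (\<open>theta_duality\<close>) relates theta of \<open>S\<close> BCC at \<open>\<alpha>\<close> to theta of
  \<open>(S\<^sup>T)\<^sup>-\<^sup>1\<close> FCC at \<open>1 / \<alpha>\<close>. So the minimality of BCC for \<open>\<alpha> \<le> 1\<close> follows from that of FCC for
  \<open>\<alpha> \<ge> 1\<close>, and the saddle behaviour of FCC for small \<open>\<alpha>\<close> from that of BCC for large \<open>\<alpha>\<close>.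
  Poisson summation is proved in one dimension by comparing Fourier coefficients, and applied
  successively to the three coordinates after completing squares in the quadratic form.

  Finally, \<open>y = 5 / 4\<close> beats \<open>y = 1\<close> for large \<open>\<alpha>\<close>, because the shortest nonzero vector of \<open>L_y1 (5 / 4)\<close> is longer:
  its squared length is \<open>61 / 80\<close>, against \<open>3 / 4\<close> for \<open>L_y1 1\<close>.
\<close>

section \<open>Uniqueness of Fourier coefficients\<close>

definition fourier_null :: "(real \<Rightarrow> complex) \<Rightarrow> bool" where
  "fourier_null g \<longleftrightarrow> continuous_on {0..1} g \<and>
     (\<forall>m::int. integral {0..1} (\<lambda>x. g x * cis (2 * pi * of_int m * x)) = 0)"

lemma fourier_null_integrable:
  assumes "fourier_null g"
  shows "(\<lambda>x. g x * cis (2 * pi * of_int m * x)) integrable_on {0..1}"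
  using assms unfolding fourier_null_def
  by (intro integrable_continuous_real continuous_intros) auto

lemma fourier_null_add:
  assumes "fourier_null g" "fourier_null h"
  shows "fourier_null (\<lambda>x. g x + h x)"
  unfolding fourier_null_def
proof (intro conjI allI)
  show "continuous_on {0..1} (\<lambda>x. g x + h x)"
    using assms by (auto simp: fourier_null_def intro!: continuous_intros)
  show "integral {0..1} (\<lambda>x. (g x + h x) * cis (2 * pi * of_int m * x)) = 0" for m :: int
    using assms fourier_null_integrable[OF assms(1), of m] fourier_null_integrable[OF assms(2), of m]
    by (simp add: distrib_right Henstock_Kurzweil_Integration.integral_add fourier_null_def)
qed

lemma fourier_null_cmult:
  assumes "fourier_null g"
  shows "fourier_null (\<lambda>x. c * g x)"
  using assms by (auto simp: fourier_null_def mult.assoc intro!: continuous_intros)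

lemma fourier_null_cis:
  assumes "fourier_null g"
  shows "fourier_null (\<lambda>x. g x * cis (2 * pi * of_int k * x))"
  unfolding fourier_null_def
proof (intro conjI allI)
  show "continuous_on {0..1} (\<lambda>x. g x * cis (2 * pi * of_int k * x))"
    using assms by (auto simp: fourier_null_def intro!: continuous_intros)
  show "integral {0..1} (\<lambda>x. g x * cis (2 * pi * of_int k * x) * cis (2 * pi * of_int m * x)) = 0"
    for m :: int
  proof -
    have "(\<lambda>x. g x * cis (2 * pi * of_int k * x) * cis (2 * pi * of_int m * x)) =
          (\<lambda>x. g x * cis (2 * pi * of_int (k + m) * x))"
      by (simp add: cis_mult mult.assoc algebra_simps)
    then show ?thesis
      using assms by (simp only: fourier_null_def)
  qed
qed

text \<open>
  On the circle a linear function is a combination of \<open>cis\<close> and its inverse, and multiplication by these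
  only shifts Fourier coefficients. Stating the closure for every \<open>g\<close> makes products harmless in
  the induction.
\<close>

lemma fourier_null_mult_polynomial:
  assumes "real_polynomial_function q" "fourier_null g"
  shows "fourier_null (\<lambda>x. g x * of_real (q (cis (2 * pi * x))))"
  using assms
proof (induction q arbitrary: g rule: real_polynomial_function.induct)
  case (linear f)
  interpret f: bounded_linear f by fact
  \<comment> \<open>The complex form of \<open>cos t * f 1 + sin t * f \<i>\<close>.\<close>
  define c where "c = (of_real (f 1) - \<i> * of_real (f \<i>)) / 2"
  have "f (cis t) = cos t * f 1 + sin t * f \<i>" for t
  proof -
    have "cis t = cos t *\<^sub>R 1 + sin t *\<^sub>R \<i>" by (simp add: complex_eq_iff)
    then show ?thesis by (simp add: f.add f.scaleR)
  qed
  then have eq: "of_real (f (cis t)) = c * cis t + cnj c * cis (- t)" for t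
    by (simp add: c_def complex_eq_iff field_simps)
  have "fourier_null (\<lambda>x. c * (g x * cis (2 * pi * of_int 1 * x)) + cnj c * (g x * cis (2 * pi * of_int (-1) * x)))"
    by (intro fourier_null_add fourier_null_cmult fourier_null_cis linear)
  then show ?case by (simp add: eq algebra_simps)
next
  case (const c)
  then show ?case using fourier_null_cmult[of g "of_real c"] by (simp add: mult.commute)
next
  case (add f h)
  from fourier_null_add[OF add.IH(1)[OF add.prems] add.IH(2)[OF add.prems]]
  show ?case by (simp add: algebra_simps)
next
  case (mult f h)
  from mult.IH(2)[OF mult.IH(1)[OF mult.prems]]
  show ?case by (simp add: algebra_simps)
qed

lemma periodic_int:
  fixes g :: "real \<Rightarrow> 'a"
  assumes "\<And>x. g (x + 1) = g x"
  shows "g (x + of_int n) = g x"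
proof -
  have nat: "g (x + real n) = g x" for x n
    using assms[of "x + real n" for n] by (induction n) (auto simp: algebra_simps)
  show ?thesis
  proof (cases "n \<ge> 0")
    case True
    then show ?thesis using nat[of x "nat n"] by simp
  next
    case False
    then show ?thesis using nat[of "x + of_int n" "nat (-n)"] by simp
  qed
qed

text \<open>
  A branch of the logarithm gives \<open>G\<close> away from \<open>-1\<close>, and the same branch at the antipodal point gives it
  away from \<open>1\<close>; the two relatively open sets cover the circle.
\<close>

lemma periodic_continuous_on_circle:
  fixes g :: "real \<Rightarrow> complex"
  assumes cont: "continuous_on UNIV g" and per: "\<And>x. g (x + 1) = g x"
  obtains G where "continuous_on (sphere 0 1) G" "\<And>x. G (cis (2 * pi * x)) = g x"
proof
  define G where "G z = g (Im (Ln z) / (2 * pi))" for z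
  show G: "G (cis (2 * pi * x)) = g x" for x
  proof -
    have "exp (Ln (cis (2 * pi * x))) = exp (\<i> * (2 * pi * x))"
      by (simp add: cis_conv_exp)
    then obtain n where "Ln (cis (2 * pi * x)) = \<i> * (2 * pi * x) + (of_int (2 * n) * pi) * \<i>"
      unfolding exp_eq by auto
    then have "Im (Ln (cis (2 * pi * x))) / (2 * pi) = x + of_int n"
      by (simp add: field_simps)
    then show ?thesis unfolding G_def using periodic_int[of g, OF per] by simp
  qed
  have contg: "continuous_on A (\<lambda>z. g (h z))" if "continuous_on A h" for A and h :: "complex \<Rightarrow> real"
    using continuous_on_compose2[OF cont that] by auto
  have z_cis: "\<exists>x. z = cis (2 * pi * x)" if "z \<in> sphere 0 1" for z
  proof -
    have "z = cis (Arg z)" using that by (metis cis_Arg norm_zero sgn_eq sgn_if dist_0_norm mem_sphere divide_self_if div_by_1 of_real_1 zero_neq_one)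
    then show ?thesis by (intro exI[of _ "Arg z / (2 * pi)"]) simp
  qed
  have G': "G z = g (Im (Ln (- z)) / (2 * pi) + 1 / 2)" if z: "z \<in> sphere 0 1" for z
  proof -
    obtain x where x: "- z = cis (2 * pi * x)" using z_cis[of "- z"] z by auto
    have "z = cis (2 * pi * (x + 1 / 2))"
      using x by (simp add: algebra_simps complex_eq_iff cis_mult[symmetric])
    then have "G z = g (x + 1 / 2)" using G by metis
    moreover have "G (- z) = g (Im (Ln (- z)) / (2 * pi))" by (simp add: G_def)
    ultimately show ?thesis
    proof -
      have "exp (Ln (cis (2 * pi * x))) = exp (\<i> * (2 * pi * x))"
        by (simp add: cis_conv_exp)
      then obtain n where "Ln (cis (2 * pi * x)) = \<i> * (2 * pi * x) + (of_int (2 * n) * pi) * \<i>"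
        unfolding exp_eq by auto
      then have "Im (Ln (- z)) / (2 * pi) = x + of_int n"
        unfolding x by (simp add: field_simps)
      then have "Im (Ln (- z)) / (2 * pi) + 1 / 2 = (x + 1 / 2) + of_int n" by simp
      then show ?thesis using periodic_int[of g "x + 1 / 2" n, OF per] \<open>G z = g (x + 1 / 2)\<close> by metis
    qed
  qed
  let ?S = "sphere (0::complex) 1"
  have 1: "continuous_on (?S - {-1}) G"
    unfolding G_def
    by (intro contg continuous_intros) (auto simp: complex_nonpos_Reals_iff complex_eq_iff cmod_def power2_eq_1_iff)
  have "continuous_on (?S - {1}) (\<lambda>z. g (Im (Ln (- z)) / (2 * pi) + 1 / 2))"
    by (intro contg continuous_intros) (auto simp: complex_nonpos_Reals_iff complex_eq_iff cmod_def power2_eq_1_iff)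
  then have 2: "continuous_on (?S - {1}) G"
    by (rule continuous_on_eq) (use G' in auto)
  have U: "(?S - {-1}) \<union> (?S - {1}) = ?S" by auto
  have "continuous_on ((?S - {-1}) \<union> (?S - {1})) G"
    by (rule continuous_on_Un_local_open[OF _ _ 1 2]) (simp_all only: U openin_delete openin_subtopology_self)
  then show "continuous_on ?S G" by (simp only: U)
qed

text \<open>
  By Stone-Weierstrass the conjugate of \<open>g\<close> is a uniform limit of polynomials in \<open>cis (2 \<pi> x)\<close>, to all of which
  \<open>g\<close> is orthogonal, so that the integral of \<open>\<bar>g\<bar>\<^sup>2\<close> vanishes.
\<close>

lemma fourier_null_imp_zero:
  assumes null: "fourier_null g" and cont: "continuous_on UNIV g" and per: "\<And>x. g (x + 1) = g x"
    and x: "x \<in> {0..1}"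
  shows "g x = 0"
proof -
  have cg [continuous_intros]: "continuous_on {0..1} g"
    using null by (simp add: fourier_null_def)
  obtain G where G: "continuous_on (sphere 0 1) G" "\<And>x. G (cis (2 * pi * x)) = g x"
    using periodic_continuous_on_circle[OF cont per] by blast
  obtain B where B: "B > 0" "\<And>x. x \<in> {0..1} \<Longrightarrow> norm (g x) \<le> B"
    using compact_imp_bounded[OF compact_continuous_image[OF cg compact_Icc]]
    by (auto simp: bounded_pos)
  have "norm (integral {0..1} (\<lambda>x. g x * cnj (g x))) \<le> B * e" if e: "e > 0" for e
  proof -
    have "continuous_on (sphere 0 1) (\<lambda>z. cnj (G z))"
      by (intro continuous_intros G)
    then obtain P where P: "polynomial_function P" "\<And>z. z \<in> sphere 0 1 \<Longrightarrow> norm (cnj (G z) - P z) < e"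
      using Stone_Weierstrass_polynomial_function[OF compact_sphere _ e] by metis
    have PR: "real_polynomial_function (\<lambda>z. Re (P z))" "real_polynomial_function (\<lambda>z. Im (P z))"
      using P(1) by (auto simp: polynomial_function_def o_def bounded_linear_Re bounded_linear_Im)
    define h where "h x = P (cis (2 * pi * x))" for x
    have "fourier_null (\<lambda>x. g x * of_real (Re (h x)) + \<i> * (g x * of_real (Im (h x))))"
      unfolding h_def using fourier_null_mult_polynomial[OF PR(1) null] fourier_null_mult_polynomial[OF PR(2) null]
      by (intro fourier_null_add fourier_null_cmult)
    moreover have "(\<lambda>x. g x * of_real (Re (h x)) + \<i> * (g x * of_real (Im (h x)))) = (\<lambda>x. g x * h x)"
      by (rule ext) (simp add: complex_eq_iff)
    ultimately have gh: "fourier_null (\<lambda>x. g x * h x)" by simp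
    then have ch: "continuous_on {0..1} (\<lambda>x. g x * h x)"
      by (simp add: fourier_null_def)
    have "integral {0..1} (\<lambda>x. g x * h x) = 0"
      using gh unfolding fourier_null_def by (auto dest: spec[of _ 0])
    then have "integral {0..1} (\<lambda>x. g x * cnj (g x)) =
               integral {0..1} (\<lambda>x. g x * cnj (g x)) - integral {0..1} (\<lambda>x. g x * h x)"
      by simp
    also have "\<dots> = integral {0..1} (\<lambda>x. g x * cnj (g x) - g x * h x)"
      by (intro Henstock_Kurzweil_Integration.integral_diff[symmetric] integrable_continuous_real
            continuous_intros ch)
    also have "norm \<dots> \<le> (B * e) * (1 - 0)"
    proof (rule integral_bound)
      fix x :: real assume x: "x \<in> {0..1}"
      have "norm (g x * cnj (g x) - g x * h x) = norm (g x) * norm (cnj (G (cis (2 * pi * x))) - h x)"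
        by (simp only: G norm_mult[symmetric] right_diff_distrib)
      also have "\<dots> \<le> B * e"
        unfolding h_def using P(2)[of "cis (2 * pi * x)"] B x by (intro mult_mono) auto
      finally show "norm (g x * cnj (g x) - g x * h x) \<le> B * e" .
    qed (auto intro!: continuous_intros ch)
    finally show ?thesis by simp
  qed
  then have "norm (integral {0..1} (\<lambda>x. g x * cnj (g x))) \<le> d" if "d > 0" for d
    using that B(1) by (metis divide_pos_pos nonzero_mult_div_cancel_left times_divide_eq_right less_irrefl)
  then have "integral {0..1} (\<lambda>x. g x * cnj (g x)) = 0"
    by (metis dense_ge norm_le_zero_iff)
  then have "of_real (integral {0..1} (\<lambda>x. (norm (g x))\<^sup>2)) = (0::complex)"
    using Henstock_Kurzweil_Integration.integral_linear[of "\<lambda>x. (norm (g x))\<^sup>2" "{0..1}" complex_of_real]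
    by (simp add: complex_norm_square[symmetric] o_def bounded_linear_of_real
        integrable_continuous_real continuous_intros del: of_real_power)
  then have "integral {0..1} (\<lambda>x. (norm (g x))\<^sup>2) = 0" by simp
  then have "\<forall>x\<in>{0..1}. (norm (g x))\<^sup>2 = 0"
    by (subst (asm) integral_eq_0_iff) (auto intro!: continuous_intros)
  then show ?thesis using x by simp
qed

section \<open>Poisson summation for Gaussians on the line\<close>

lemma continuous_on_infsum:
  fixes f :: "'i \<Rightarrow> real \<Rightarrow> complex"
  assumes "\<And>n. continuous_on S (f n)" "\<And>n x. x \<in> S \<Longrightarrow> norm (f n x) \<le> M n" "M summable_on UNIV"
  shows "continuous_on S (\<lambda>x. \<Sum>\<^sub>\<infinity>n. f n x)"
proof (rule uniform_limit_theorem)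
  show "uniform_limit S (\<lambda>X x. \<Sum>n\<in>X. f n x) (\<lambda>x. \<Sum>\<^sub>\<infinity>n. f n x) (finite_subsets_at_top UNIV)"
    by (rule Weierstrass_m_test_general) (use assms in auto)
  show "\<forall>\<^sub>F X in finite_subsets_at_top UNIV. continuous_on S (\<lambda>x. \<Sum>n\<in>X. f n x)"
    by (intro always_eventually allI continuous_on_sum assms)
qed auto

lemma has_sum_integral:
  fixes f :: "'i \<Rightarrow> real \<Rightarrow> complex"
  assumes "\<And>n. continuous_on {a..b} (f n)" "\<And>n x. x \<in> {a..b} \<Longrightarrow> norm (f n x) \<le> M n" "M summable_on UNIV"
  shows "((\<lambda>n. integral {a..b} (f n)) has_sum integral {a..b} (\<lambda>x. \<Sum>\<^sub>\<infinity>n. f n x)) UNIV"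
proof -
  have "uniform_limit {a..b} (\<lambda>X x. \<Sum>n\<in>X. f n x) (\<lambda>x. \<Sum>\<^sub>\<infinity>n. f n x) (finite_subsets_at_top UNIV)"
    by (rule Weierstrass_m_test_general) (use assms in auto)
  then obtain I J where IJ: "\<And>X. ((\<lambda>x. \<Sum>n\<in>X. f n x) has_integral I X) {a..b}"
    "((\<lambda>x. \<Sum>\<^sub>\<infinity>n. f n x) has_integral J) {a..b}" "(I \<longlongrightarrow> J) (finite_subsets_at_top UNIV)"
    by (rule uniform_limit_integral) (auto intro!: continuous_on_sum assms)
  have "I X = (\<Sum>n\<in>X. integral {a..b} (f n))" if "finite X" for X
    using IJ(1)[of X] that
    by (subst Henstock_Kurzweil_Integration.integral_sum[symmetric])
       (auto intro!: integrable_continuous_real assms simp: has_integral_iff)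
  then have "\<forall>\<^sub>F X in finite_subsets_at_top UNIV. I X = (\<Sum>n\<in>X. integral {a..b} (f n))"
    by (intro eventually_finite_subsets_at_top_weakI) auto
  then have "((\<lambda>X. \<Sum>n\<in>X. integral {a..b} (f n)) \<longlongrightarrow> J) (finite_subsets_at_top UNIV)"
    using IJ(3) tendsto_cong by fastforce
  then show ?thesis
    using IJ(2) by (simp add: has_sum_def has_integral_iff)
qed

lemma gauss_int_summable:
  fixes c :: real assumes "c > 0"
  shows "(\<lambda>n::int. exp (- c * (of_int n)\<^sup>2)) summable_on UNIV"
proof -
  have nat: "(\<lambda>n::nat. exp (- c * (real n)\<^sup>2)) summable_on UNIV"
  proof (subst summable_on_UNIV_nonneg_real_iff)
    show "summable (\<lambda>n. exp (- c * (real n)\<^sup>2))"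
    proof (rule summable_comparison_test')
      show "summable (\<lambda>n. exp (- c) ^ n)" using assms by (intro summable_geometric) auto
      show "norm (exp (- c * (real n)\<^sup>2)) \<le> exp (- c) ^ n" for n
      proof -
        have "real n \<le> (real n)\<^sup>2" by (cases n) (auto simp: power2_eq_square)
        then show ?thesis using assms by (simp add: exp_of_nat_mult[symmetric] mult.commute)
      qed
    qed
  qed auto
  have U: "(UNIV::int set) = range int \<union> (\<lambda>n. - int n) ` UNIV"
  proof -
    have "x \<in> range int \<union> (\<lambda>n. - int n) ` UNIV" for x
      by (cases x rule: int_cases2) auto
    then show ?thesis by blast
  qed
  have "(\<lambda>n::int. exp (- c * (of_int n)\<^sup>2)) summable_on range int"
    by (subst summable_on_reindex) (use nat in \<open>auto simp: o_def\<close>)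
  moreover have "(\<lambda>n::int. exp (- c * (of_int n)\<^sup>2)) summable_on (\<lambda>n. - int n) ` UNIV"
    by (subst summable_on_reindex) (use nat in \<open>auto simp: o_def inj_on_def\<close>)
  ultimately show ?thesis unfolding U
    by (metis (no_types, lifting) summable_on_union)
qed

text \<open>
  The characteristic function of the standard normal distribution after the substitution \<open>x = sqrt (2 \<pi> a) r\<close>.
\<close>

lemma gaussian_fourier_transform:
  fixes a z :: real assumes a: "a > 0"
  shows "integrable lborel (\<lambda>r. exp (- pi * a * r\<^sup>2) *\<^sub>R cis (2 * pi * z * r))"
    and "(\<integral>r. exp (- pi * a * r\<^sup>2) *\<^sub>R cis (2 * pi * z * r) \<partial>lborel) =
           of_real (exp (- pi * z\<^sup>2 / a) / sqrt a)"
proof -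
  define c where "c = sqrt (2 * pi * a)"
  define t where "t = 2 * pi * z / c"
  have c: "c > 0" "c\<^sup>2 = 2 * pi * a" using a by (auto simp: c_def)
  have t: "t * c = 2 * pi * z" "t\<^sup>2 / 2 = pi * z\<^sup>2 / a"
    using c a by (auto simp: t_def power_divide field_simps power2_eq_square)
  have "integrable lborel (\<lambda>x. std_normal_density x *\<^sub>R iexp (t * x))"
    by (rule Bochner_Integration.integrable_bound[OF integrable_std_normal_moment[of 0]])
       (auto simp: normal_density_nonneg)
  note int1 = lborel_integrable_real_affine[OF this, of c 0]
  have dens: "std_normal_density (c * r) *\<^sub>R iexp (t * (c * r)) =
      (1 / sqrt (2 * pi)) *\<^sub>R (exp (- pi * a * r\<^sup>2) *\<^sub>R cis (2 * pi * z * r))" for r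
  proof -
    have "t * (c * r) = 2 * pi * z * r" using t(1) by (metis mult.assoc)
    moreover have "(c * r)\<^sup>2 / 2 = pi * a * r\<^sup>2" using c by (simp add: power_mult_distrib)
    ultimately show ?thesis
      by (simp only: cis_conv_exp) (simp add: std_normal_density_def)
  qed
  show "integrable lborel (\<lambda>r. exp (- pi * a * r\<^sup>2) *\<^sub>R cis (2 * pi * z * r))"
    using integrable_scaleR_right[of "sqrt (2 * pi)", OF int1] c unfolding add_0 dens by simp
  have "of_real (exp (- (t\<^sup>2) / 2)) = char std_normal_distribution t"
    by (simp add: char_std_normal_distribution)
  also have "\<dots> = (\<integral>x. std_normal_density x *\<^sub>R iexp (t * x) \<partial>lborel)"
    unfolding char_def by (subst integral_density) (auto simp: normal_density_nonneg)
  also have "\<dots> = \<bar>c\<bar> *\<^sub>R (\<integral>r. std_normal_density (0 + c * r) *\<^sub>R iexp (t * (0 + c * r)) \<partial>lborel)"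
    by (rule lborel_integral_real_affine) (use c in auto)
  also have "\<dots> = sqrt a *\<^sub>R (\<integral>r. exp (- pi * a * r\<^sup>2) *\<^sub>R cis (2 * pi * z * r) \<partial>lborel)"
    unfolding add_0 dens Bochner_Integration.integral_scaleR_right using a by (simp add: c_def real_sqrt_mult)
  finally show "(\<integral>r. exp (- pi * a * r\<^sup>2) *\<^sub>R cis (2 * pi * z * r) \<partial>lborel) =
           of_real (exp (- pi * z\<^sup>2 / a) / sqrt a)"
    using a t(2) by (simp add: scaleR_conv_of_real field_simps)
qed

lemma gauss_shift_bound:
  fixes c n x :: real assumes "c > 0"
  shows "exp (- c * (n + x)\<^sup>2) \<le> exp (c * x\<^sup>2) * exp (- (c / 2) * n\<^sup>2)"
proof -
  have "n\<^sup>2 / 2 - x\<^sup>2 \<le> (n + x)\<^sup>2"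
    using zero_le_power2[of "n + 2 * x"] by (simp add: power2_eq_square algebra_simps)
  then have "c * (n\<^sup>2 / 2 - x\<^sup>2) \<le> c * (n + x)\<^sup>2"
    using assms by (intro mult_left_mono) auto
  then show ?thesis
    by (simp add: exp_add[symmetric] algebra_simps)
qed

lemma has_sum_int_imp_LIMSEQ:
  fixes f :: "int \<Rightarrow> complex"
  assumes "(f has_sum S) UNIV"
  shows "(\<lambda>N. \<Sum>n\<in>{- int N..<int N}. f n) \<longlonglongrightarrow> S"
proof -
  have "filterlim (\<lambda>N. {- int N..<int N}) (finite_subsets_at_top UNIV) sequentially"
    unfolding filterlim_finite_subsets_at_top
  proof (intro allI impI)
    fix X :: "int set" assume "finite X \<and> X \<subseteq> UNIV"
    then have "finite (abs ` X)" by simp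
    then obtain B where B: "\<And>x. x \<in> X \<Longrightarrow> \<bar>x\<bar> \<le> B"
      by (meson bdd_above.E bdd_above_finite imageI)
    show "\<forall>\<^sub>F N in sequentially. finite {- int N..<int N} \<and> X \<subseteq> {- int N..<int N} \<and> {- int N..<int N} \<subseteq> UNIV"
      using eventually_gt_at_top[of "nat B"]
    proof eventually_elim
      case (elim N)
      then have "X \<subseteq> {- int N..<int N}" using B by (force simp: abs_le_iff)
      then show ?case by simp
    qed
  qed
  then show ?thesis
    using assms unfolding has_sum_def by (rule filterlim_compose[rotated])
qed

lemma integral_cis:
  fixes m :: int
  shows "integral {0..1} (\<lambda>x. cis (2 * pi * of_int m * x)) = (if m = 0 then 1 else 0)"
proof (cases "m = 0")
  case False
  define w where "w = 2 * pi * of_int m"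
  have w: "w \<noteq> 0" using False by (simp add: w_def)
  have "((\<lambda>x. cis (w * x)) has_integral (cis (w * 1) / (\<i> * w) - cis (w * 0) / (\<i> * w))) {0..1}"
  proof (rule fundamental_theorem_of_calculus)
    show "((\<lambda>x. cis (w * x) / (\<i> * w)) has_vector_derivative cis (w * x)) (at x within {0..1})" for x
      unfolding cis_conv_exp of_real_mult mult.assoc[symmetric]
      by (rule has_vector_derivative_real_field) (auto intro!: derivative_eq_intros simp: w)
  qed auto
  moreover have "cis w = 1"
    unfolding w_def by (rule cis_multiple_2pi) simp
  ultimately show ?thesis using False by (simp add: w_def integral_unique)
qed auto

text \<open>
  Both sides are continuous and 1-periodic in \<open>x\<close>. The \<open>k\<close>-th Fourier coefficient of the left side unfolds to the
  Fourier transform of one Gaussian over the whole line, and that of the right side can be read off. The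
  modulation \<open>y\<close> is needed because completing squares in three variables couples the coordinates.
\<close>

theorem poisson_gaussian:
  fixes a x y :: real assumes a: "a > 0"
  shows "(\<Sum>\<^sub>\<infinity>n::int. exp (- pi * a * (of_int n + x)\<^sup>2) *\<^sub>R cis (2 * pi * y * (of_int n + x))) =
         (\<Sum>\<^sub>\<infinity>m::int. (exp (- pi * (of_int m - y)\<^sup>2 / a) / sqrt a) *\<^sub>R cis (2 * pi * of_int m * x))"
proof -
  define f where "f = (\<lambda>(n::int) x. exp (- pi * a * (of_int n + x)\<^sup>2) *\<^sub>R cis (2 * pi * y * (of_int n + x)))"
  define g where "g = (\<lambda>(m::int) x. (exp (- pi * (of_int m - y)\<^sup>2 / a) / sqrt a) *\<^sub>R cis (2 * pi * of_int m * x))"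
  define F where "F = (\<lambda>x. \<Sum>\<^sub>\<infinity>n. f n x)"
  define G where "G = (\<lambda>x. \<Sum>\<^sub>\<infinity>n. g n x)"
  \<comment> \<open>Majorants for the M-test; that for \<open>f\<close> is uniform only on bounded intervals.\<close>
  define Mf where "Mf = (\<lambda>R n. exp (pi * a * R\<^sup>2) * exp (- (pi * a / 2) * (of_int n)\<^sup>2))"
  define Mg where "Mg = (\<lambda>m. exp (pi / a * y\<^sup>2) * exp (- (pi / a / 2) * (of_int m)\<^sup>2) / sqrt a)"
  have fM: "norm (f n x) \<le> Mf R n" if "x \<in> {-R..R}" for n x R
  proof -
    have "norm (f n x) \<le> exp (pi * a * x\<^sup>2) * exp (- (pi * a / 2) * (of_int n)\<^sup>2)"
      using gauss_shift_bound[of "pi * a" "of_int n" x] a by (simp add: f_def)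
    also have "\<dots> \<le> Mf R n"
      using that a unfolding Mf_def by (intro mult_right_mono) (auto simp: abs_le_square_iff[symmetric])
    finally show ?thesis .
  qed
  have gM: "norm (g m x) \<le> Mg m" for m x
    using gauss_shift_bound[of "pi / a" "of_int m" "- y"] a
    by (simp add: g_def Mg_def divide_right_mono)
  have Mf: "Mf R summable_on UNIV" for R
    unfolding Mf_def using gauss_int_summable[of "pi * a / 2"] a by (intro summable_on_cmult_right) auto
  have Mg: "Mg summable_on UNIV"
  proof -
    have "(\<lambda>m. (exp (pi / a * y\<^sup>2) / sqrt a) * exp (- (pi / a / 2) * (of_int m)\<^sup>2)) summable_on (UNIV::int set)"
      using gauss_int_summable[of "pi / a / 2"] a by (intro summable_on_cmult_right) auto
    then show ?thesis by (simp add: Mg_def)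
  qed
  have cf [continuous_intros]: "continuous_on S (f n)" for S n
    unfolding f_def by (intro continuous_intros)
  have cg [continuous_intros]: "continuous_on S (g n)" for S n
    unfolding g_def by (intro continuous_intros)
  have contF: "continuous_on UNIV F"
  proof -
    have "continuous_on {-R..R} F" for R
      unfolding F_def by (rule continuous_on_infsum[OF cf fM Mf])
    then have "isCont F x" for x
      by (rule continuous_on_interior[of "{-(\<bar>x\<bar>+1)..\<bar>x\<bar>+1}"]) auto
    then show ?thesis by (simp add: continuous_at_imp_continuous_on)
  qed
  have contG: "continuous_on UNIV G"
    unfolding G_def by (rule continuous_on_infsum[OF cg gM Mg])
  have perF: "F (x + 1) = F x" for x
  proof -
    have "F (x + 1) = (\<Sum>\<^sub>\<infinity>n. f (n + 1) x)" by (simp add: F_def f_def algebra_simps)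
    also have "\<dots> = F x"
      unfolding F_def by (rule infsum_reindex_bij_betw) (rule bij_betw_byWitness[of _ "\<lambda>n. n - 1"], auto)
    finally show ?thesis .
  qed
  have perG: "G (x + 1) = G x" for x
  proof -
    have "g m (x + 1) = g m x" for m
    proof -
      have "cis (2 * pi * of_int m * (x + 1)) = cis (2 * pi * of_int m * x) * cis (2 * pi * of_int m)"
        by (simp add: cis_mult algebra_simps)
      also have "cis (2 * pi * of_int m) = 1" by (rule cis_multiple_2pi) simp
      finally show ?thesis by (simp add: g_def)
    qed
    then show ?thesis by (simp add: G_def)
  qed
  have coeffF: "integral {0..1} (\<lambda>x. F x * cis (2 * pi * of_int k * x)) =
      of_real (exp (- pi * (y + of_int k)\<^sup>2 / a) / sqrt a)" for k :: int
  proof -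
    define \<phi> where "\<phi> = (\<lambda>r. exp (- pi * a * r\<^sup>2) *\<^sub>R cis (2 * pi * (y + of_int k) * r))"
    have c\<phi> [continuous_intros]: "continuous_on S \<phi>" for S
      unfolding \<phi>_def by (intro continuous_intros)
    have i\<phi>: "\<phi> integrable_on {b..c}" for b c
      by (intro integrable_continuous_real continuous_intros)
    have int\<phi>: "integrable lborel \<phi>"
      and lim\<phi>: "(\<integral>r. \<phi> r \<partial>lborel) = of_real (exp (- pi * (y + of_int k)\<^sup>2 / a) / sqrt a)"
      unfolding \<phi>_def by (rule gaussian_fourier_transform[OF a])+
    have f\<phi>: "f n x * cis (2 * pi * of_int k * x) = \<phi> (of_int n + x)" for n x
    proof -
      have "cis (2 * pi * (y + of_int k) * (of_int n + x)) =
            cis (2 * pi * y * (of_int n + x)) * cis (2 * pi * of_int k * x) * cis (2 * pi * of_int (k * n))"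
        by (simp add: cis_mult algebra_simps)
      also have "cis (2 * pi * of_int (k * n)) = 1" by (rule cis_multiple_2pi) simp
      finally show ?thesis by (simp add: f_def \<phi>_def)
    qed
    have "((\<lambda>n. integral {0..1} (\<lambda>x. f n x * cis (2 * pi * of_int k * x))) has_sum
       integral {0..1} (\<lambda>x. \<Sum>\<^sub>\<infinity>n. f n x * cis (2 * pi * of_int k * x))) UNIV"
    proof (rule has_sum_integral[OF _ _ Mf[of 1]])
      show "norm (f n x * cis (2 * pi * of_int k * x)) \<le> Mf 1 n" if "x \<in> {0..1}" for n x
        using fM[of x 1 n] that by (simp add: norm_mult)
    qed (intro continuous_intros)
    moreover have "(\<Sum>\<^sub>\<infinity>n. f n x * cis (2 * pi * of_int k * x)) = F x * cis (2 * pi * of_int k * x)" for x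
      unfolding F_def by (rule infsum_cmult_left')
    moreover have "integral {0..1} (\<lambda>x. \<phi> (of_int n + x)) = integral {of_int n..of_int n + 1} \<phi>" for n :: int
      using integral_shift_Icc_real[of 0 1 \<phi> "of_int n"] by (simp add: o_def add.commute)
    ultimately have "((\<lambda>n::int. integral {of_int n..of_int n + 1} \<phi>) has_sum
       integral {0..1} (\<lambda>x. F x * cis (2 * pi * of_int k * x))) UNIV"
      by (simp add: f\<phi>)
    from has_sum_int_imp_LIMSEQ[OF this]
    have "(\<lambda>N. \<Sum>n\<in>{- int N..<int N}. integral {of_int n..of_int n + 1} \<phi>) \<longlonglongrightarrow>
        integral {0..1} (\<lambda>x. F x * cis (2 * pi * of_int k * x))" .
    moreover have "(\<Sum>n\<in>{- int N..<int N}. integral {of_int n..of_int n + 1} \<phi>) = integral {- real N..real N} \<phi>" for N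
    proof (induction N)
      case (Suc N)
      have "{- int (Suc N)..<int (Suc N)} = insert (- int N - 1) (insert (int N) {- int N..<int N})" by auto
      then have "(\<Sum>n\<in>{- int (Suc N)..<int (Suc N)}. integral {of_int n..of_int n + 1} \<phi>) =
         integral {- real N - 1..- real N} \<phi> + (integral {real N..real N + 1} \<phi> + integral {- real N..real N} \<phi>)"
        using Suc by simp
      also have "\<dots> = integral {- real N - 1..real N + 1} \<phi>"
        using Henstock_Kurzweil_Integration.integral_combine[of "- real N - 1" "- real N" "real N + 1" \<phi>, OF _ _ i\<phi>]
          Henstock_Kurzweil_Integration.integral_combine[of "- real N" "real N" "real N + 1" \<phi>, OF _ _ i\<phi>]
        by (simp add: add.commute[of "integral {real N..real N + 1} \<phi>"])
      moreover have "{- real (Suc N)..real (Suc N)} = {- real N - 1..real N + 1}" by auto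
      ultimately show ?case by (simp only:)
    qed auto
    moreover have "(\<lambda>N. integral {- real N..real N} \<phi>) \<longlonglongrightarrow> (\<integral>r. \<phi> r \<partial>lborel)"
    proof -
      have "set_integrable lborel {- real N..real N} \<phi>" for N
        by (intro borel_integrable_atLeastAtMost' continuous_intros)
      from set_borel_integral_eq_integral(2)[OF this]
      have "integral {- real N..real N} \<phi> = (\<integral>r. indicator {- real N..real N} r *\<^sub>R \<phi> r \<partial>lborel)" for N
        by (simp add: set_lebesgue_integral_def)
      moreover have "(\<lambda>N. \<integral>r. indicator {- real N..real N} r *\<^sub>R \<phi> r \<partial>lborel) \<longlonglongrightarrow> (\<integral>r. \<phi> r \<partial>lborel)"
      proof (rule integral_dominated_convergence[where w = "\<lambda>r. norm (\<phi> r)"])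
        show "AE r in lborel. (\<lambda>N. indicator {- real N..real N} r *\<^sub>R \<phi> r) \<longlonglongrightarrow> \<phi> r"
        proof (intro AE_I2 tendsto_eventually)
          fix r :: real
          obtain N0 :: nat where N0: "\<bar>r\<bar> \<le> real N0" using real_arch_simple by blast
          show "\<forall>\<^sub>F N in sequentially. indicator {- real N..real N} r *\<^sub>R \<phi> r = \<phi> r"
            using eventually_ge_at_top[of N0]
            by eventually_elim (use N0 in \<open>auto simp: indicator_def\<close>)
        qed
      qed (use int\<phi> in \<open>auto simp: indicator_def\<close>)
      ultimately show ?thesis by simp
    qed
    ultimately show ?thesis
      using LIMSEQ_unique lim\<phi> by (metis (no_types, lifting) LIMSEQ_unique ext)
  qed
  have coeffG: "integral {0..1} (\<lambda>x. G x * cis (2 * pi * of_int k * x)) =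
      of_real (exp (- pi * (y + of_int k)\<^sup>2 / a) / sqrt a)" for k :: int
  proof -
    have "((\<lambda>n. integral {0..1} (\<lambda>x. g n x * cis (2 * pi * of_int k * x))) has_sum
       integral {0..1} (\<lambda>x. \<Sum>\<^sub>\<infinity>n. g n x * cis (2 * pi * of_int k * x))) UNIV"
    proof (rule has_sum_integral[OF _ _ Mg])
      show "norm (g n x * cis (2 * pi * of_int k * x)) \<le> Mg n" if "x \<in> {0..1}" for n x
        using gM[of n x] that by (simp add: norm_mult)
    qed (intro continuous_intros)
    moreover have "(\<Sum>\<^sub>\<infinity>n. g n x * cis (2 * pi * of_int k * x)) = G x * cis (2 * pi * of_int k * x)" for x
      unfolding G_def by (rule infsum_cmult_left')
    moreover have "integral {0..1} (\<lambda>x. g n x * cis (2 * pi * of_int k * x)) =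
      (if n = - k then of_real (exp (- pi * (of_int n - y)\<^sup>2 / a) / sqrt a) else 0)" for n
    proof -
      have "(\<lambda>x. g n x * cis (2 * pi * of_int k * x)) =
         (\<lambda>x. (exp (- pi * (of_int n - y)\<^sup>2 / a) / sqrt a) *\<^sub>R cis (2 * pi * of_int (n + k) * x))"
        by (simp add: g_def cis_mult algebra_simps)
      then show ?thesis
        by (simp only: integral_cmul integral_cis) (auto simp: scaleR_conv_of_real)
    qed
    ultimately have "((\<lambda>n. if n = - k then of_real (exp (- pi * (of_int n - y)\<^sup>2 / a) / sqrt a) else 0) has_sum
       integral {0..1} (\<lambda>x. G x * cis (2 * pi * of_int k * x))) UNIV"
      by simp
    moreover have "((\<lambda>n. if n = - k then of_real (exp (- pi * (of_int n - y)\<^sup>2 / a) / sqrt a) else 0) has_sum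
       (complex_of_real (exp (- pi * (of_int (- k) - y)\<^sup>2 / a) / sqrt a))) UNIV"
      by (rule has_sum_finite_neutralI[of "{- k}"]) auto
    ultimately have "integral {0..1} (\<lambda>x. G x * cis (2 * pi * of_int k * x)) =
      of_real (exp (- pi * (of_int (- k) - y)\<^sup>2 / a) / sqrt a)"
      using has_sum_unique by blast
    moreover have "(of_int (- k) - y)\<^sup>2 = (y + of_int k)\<^sup>2" by (simp add: power2_eq_square algebra_simps)
    ultimately show ?thesis by simp
  qed
  have null: "fourier_null (\<lambda>x. F x - G x)"
    unfolding fourier_null_def
  proof (intro conjI allI)
    show "continuous_on {0..1} (\<lambda>x. F x - G x)"
      by (intro continuous_intros continuous_on_subset[OF contF] continuous_on_subset[OF contG]) auto
    fix k :: int
    have "integral {0..1} (\<lambda>x. F x * cis (2 * pi * of_int k * x) - G x * cis (2 * pi * of_int k * x)) = 0"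
      using coeffF[of k] coeffG[of k]
      by (subst Henstock_Kurzweil_Integration.integral_diff)
        (auto intro!: integrable_continuous_real continuous_intros
           continuous_on_subset[OF contF] continuous_on_subset[OF contG])
    then show "integral {0..1} (\<lambda>x. (F x - G x) * cis (2 * pi * of_int k * x)) = 0"
      by (simp add: left_diff_distrib)
  qed
  have per: "F (x + of_int n) - G (x + of_int n) = F x - G x" for x n
    by (rule periodic_int[of "\<lambda>x. F x - G x"]) (simp add: perF perG)
  have "F (frac x) - G (frac x) = 0"
    by (rule fourier_null_imp_zero[OF null])
       (auto intro!: continuous_intros contF contG simp: perF perG frac_lt_1 less_imp_le)
  then have "F x - G x = 0"
    using per[of "frac x" "\<lfloor>x\<rfloor>"] by (simp add: frac_def)
  then show ?thesis by (simp add: F_def G_def f_def g_def)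
qed

section \<open>Duality of theta functions in space\<close>

lemma summable_on_int_triple:
  fixes c :: real assumes c: "c > 0"
  shows "(\<lambda>(i::int, j::int, k::int). exp (- c * ((of_int i)\<^sup>2 + (of_int j)\<^sup>2 + (of_int k)\<^sup>2))) summable_on UNIV"
proof -
  define g :: "int \<Rightarrow> real" where "g n = exp (- c * (of_int n)\<^sup>2)" for n
  have g: "g summable_on UNIV"
    unfolding g_def by (rule gauss_int_summable[OF c])
  have gpos: "g n \<ge> 0" for n by (simp add: g_def)
  have gs: "(g has_sum infsum g UNIV) UNIV" using g by simp
  have pair: "(\<lambda>(j, k). g j * g k) summable_on UNIV \<times> UNIV"
    by (rule summable_on_SigmaI[where g = "\<lambda>j. g j * infsum g UNIV"])
       (auto intro!: has_sum_cmult_right gs summable_on_cmult_left g simp: gpos)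
  have "(\<lambda>(i, j, k). g i * (g j * g k)) summable_on UNIV \<times> (UNIV \<times> UNIV)"
  proof (rule summable_on_SigmaI[where g = "\<lambda>i. g i * infsum (\<lambda>(j, k). g j * g k) (UNIV \<times> UNIV)"])
    fix i :: int
    have "((\<lambda>p. g i * (case p of (j, k) \<Rightarrow> g j * g k)) has_sum g i * infsum (\<lambda>(j, k). g j * g k) (UNIV \<times> UNIV)) (UNIV \<times> UNIV)"
      by (intro has_sum_cmult_right has_sum_infsum pair)
    then show "((\<lambda>y. case (i, y) of (i, j, k) \<Rightarrow> g i * (g j * g k)) has_sum
         g i * infsum (\<lambda>(j, k). g j * g k) (UNIV \<times> UNIV)) (UNIV \<times> UNIV)"
      by (simp add: case_prod_unfold)
  qed (auto intro!: summable_on_cmult_left g simp: gpos)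
  then show ?thesis
    by (simp add: g_def exp_add[symmetric] algebra_simps case_prod_unfold)
qed

definition triple :: "int \<times> int \<times> int \<Rightarrow> real \<times> real \<times> real" where
  "triple = (\<lambda>(i, j, k). (of_int i, of_int j, of_int k))"

lemma gauss_linear_summable:
  fixes T :: "real \<times> real \<times> real \<Rightarrow> 'b::euclidean_space"
  assumes T: "linear T" "inj T" and c: "c > 0"
  shows "(\<lambda>n. exp (- c * (norm (T (triple n)))\<^sup>2)) summable_on UNIV"
proof -
  obtain B where B: "B > 0" "\<And>x. B * norm x \<le> norm (T x)"
    using linear_inj_bounded_below_pos[OF T] by blast
  have "(\<lambda>n. exp (- (c * B\<^sup>2) * (norm (triple n))\<^sup>2)) summable_on UNIV"
    using summable_on_int_triple[of "c * B\<^sup>2"] c B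
    by (simp add: triple_def case_prod_unfold norm_Pair algebra_simps)
  then show ?thesis
  proof (rule summable_on_comparison_test)
    fix n
    have "(B * norm (triple n))\<^sup>2 \<le> (norm (T (triple n)))\<^sup>2"
      using B by (intro power_mono) auto
    then show "exp (- c * (norm (T (triple n)))\<^sup>2) \<le> exp (- (c * B\<^sup>2) * (norm (triple n))\<^sup>2)"
      using c by (simp add: power_mult_distrib)
  qed auto
qed

lemma infsum_pair_cong_fst:
  fixes f g :: "'x \<times> 'y \<Rightarrow> complex"
  assumes "(\<lambda>n. norm (f n)) summable_on UNIV" "(\<lambda>n. norm (g n)) summable_on UNIV"
    and "\<And>y. (\<Sum>\<^sub>\<infinity>x. f (x, y)) = (\<Sum>\<^sub>\<infinity>x. g (x, y))"
  shows "infsum f UNIV = infsum g UNIV"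
proof -
  have "infsum h UNIV = (\<Sum>\<^sub>\<infinity>y. \<Sum>\<^sub>\<infinity>x. h (x, y))" if "(\<lambda>n. norm (h n)) summable_on UNIV" for h :: "'x \<times> 'y \<Rightarrow> complex"
  proof -
    have h: "(\<lambda>(x, y). h (x, y)) summable_on UNIV \<times> UNIV"
      using abs_summable_summable[OF that] by simp
    have "infsum h UNIV = infsum (\<lambda>(x, y). h (x, y)) (UNIV \<times> UNIV)" by simp
    also have "\<dots> = (\<Sum>\<^sub>\<infinity>x. \<Sum>\<^sub>\<infinity>y. h (x, y))"
      using infsum_Sigma'_banach[OF h] by simp
    also have "\<dots> = (\<Sum>\<^sub>\<infinity>y. \<Sum>\<^sub>\<infinity>x. h (x, y))"
      using infsum_swap_banach[of "\<lambda>x y. h (x, y)"] h by simp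
    finally show ?thesis .
  qed
  then show ?thesis using assms by simp
qed

text \<open>
  Poisson summation in one coordinate replaces one inner sum by another; absolute summability allows this inside
  a triple sum, for whichever of the three coordinates.
\<close>

lemma infsum_triple_cong:
  fixes f g :: "'x \<times> 'y \<times> 'z \<Rightarrow> complex"
  assumes f: "(\<lambda>n. norm (f n)) summable_on UNIV" and g: "(\<lambda>n. norm (g n)) summable_on UNIV"
  shows "(\<And>y z. (\<Sum>\<^sub>\<infinity>x. f (x, y, z)) = (\<Sum>\<^sub>\<infinity>x. g (x, y, z))) \<Longrightarrow> infsum f UNIV = infsum g UNIV"
    and "(\<And>x z. (\<Sum>\<^sub>\<infinity>y. f (x, y, z)) = (\<Sum>\<^sub>\<infinity>y. g (x, y, z))) \<Longrightarrow> infsum f UNIV = infsum g UNIV"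
    and "(\<And>x y. (\<Sum>\<^sub>\<infinity>z. f (x, y, z)) = (\<Sum>\<^sub>\<infinity>z. g (x, y, z))) \<Longrightarrow> infsum f UNIV = infsum g UNIV"
proof -
  show "infsum f UNIV = infsum g UNIV" if "\<And>y z. (\<Sum>\<^sub>\<infinity>x. f (x, y, z)) = (\<Sum>\<^sub>\<infinity>x. g (x, y, z))"
    by (rule infsum_pair_cong_fst[OF f g]) (use that in auto)
  define r2 :: "'y \<times> 'x \<times> 'z \<Rightarrow> 'x \<times> 'y \<times> 'z" where "r2 = (\<lambda>(y, x, z). (x, y, z))"
  have r2: "bij r2" unfolding r2_def by (rule bij_betw_byWitness[of _ "\<lambda>(x, y, z). (y, x, z)"]) auto
  define r3 :: "'z \<times> 'x \<times> 'y \<Rightarrow> 'x \<times> 'y \<times> 'z" where "r3 = (\<lambda>(z, x, y). (x, y, z))"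
  have r3: "bij r3" unfolding r3_def by (rule bij_betw_byWitness[of _ "\<lambda>(x, y, z). (z, x, y)"]) auto
  show "infsum f UNIV = infsum g UNIV" if "\<And>x z. (\<Sum>\<^sub>\<infinity>y. f (x, y, z)) = (\<Sum>\<^sub>\<infinity>y. g (x, y, z))"
  proof -
    have "infsum (\<lambda>n. f (r2 n)) UNIV = infsum (\<lambda>n. g (r2 n)) UNIV"
      by (rule infsum_pair_cong_fst)
         (use that f g summable_on_reindex_bij_betw[OF r2, of "\<lambda>n. norm (f n)"]
           summable_on_reindex_bij_betw[OF r2, of "\<lambda>n. norm (g n)"] in \<open>auto simp: r2_def split: prod.splits\<close>)
    then show ?thesis by (simp add: infsum_reindex_bij_betw[OF r2])
  qed
  show "infsum f UNIV = infsum g UNIV" if "\<And>x y. (\<Sum>\<^sub>\<infinity>z. f (x, y, z)) = (\<Sum>\<^sub>\<infinity>z. g (x, y, z))"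
  proof -
    have "infsum (\<lambda>n. f (r3 n)) UNIV = infsum (\<lambda>n. g (r3 n)) UNIV"
      by (rule infsum_pair_cong_fst)
         (use that f g summable_on_reindex_bij_betw[OF r3, of "\<lambda>n. norm (f n)"]
           summable_on_reindex_bij_betw[OF r3, of "\<lambda>n. norm (g n)"] in \<open>auto simp: r3_def split: prod.splits\<close>)
    then show ?thesis by (simp add: infsum_reindex_bij_betw[OF r3])
  qed
qed

text \<open>
  One-dimensional Poisson summation in the coordinates \<open>i\<close>, \<open>j\<close>, \<open>k\<close> in turn. Each step replaces a Gaussian in one
  coordinate by the dual one and leaves a phase that modulates the next coordinate; the last phase is
  absorbed as well.
\<close>

lemma poisson_triangular:
  fixes a b d u v s :: real
  assumes a: "a > 0" and b: "b > 0" and d: "d > 0"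
  shows "(\<Sum>\<^sub>\<infinity>(i::int, j::int, k::int). exp (- pi * (a * (i + u * j + v * k)\<^sup>2 + b * (j + s * k)\<^sup>2 + d * (of_int k)\<^sup>2))) =
    (\<Sum>\<^sub>\<infinity>(i::int, j::int, k::int). exp (- pi * ((of_int i)\<^sup>2 / a + (j - u * i)\<^sup>2 / b + (k - v * i - s * (j - u * i))\<^sup>2 / d)))
      / sqrt (a * b * d)" (is "infsum ?L UNIV = infsum ?R UNIV / _")
proof -
  \<comment> \<open>\<open>f1\<close>, \<open>f2\<close>, \<open>f3\<close> arise from \<open>f0\<close> by dualizing the first, the second and the third coordinate.\<close>
  define f0 :: "int \<times> int \<times> int \<Rightarrow> complex" where "f0 = (\<lambda>(i, j, k). of_real (exp (- pi * a * (i + (u * j + v * k))\<^sup>2)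
     * exp (- pi * b * (j + s * k)\<^sup>2) * exp (- pi * d * (of_int k)\<^sup>2)))"
  define f1 :: "int \<times> int \<times> int \<Rightarrow> complex" where "f1 = (\<lambda>(i, j, k). of_real (exp (- pi * (of_int i)\<^sup>2 / a) / sqrt a
     * exp (- pi * b * (j + s * k)\<^sup>2) * exp (- pi * d * (of_int k)\<^sup>2)) * cis (2 * pi * i * (u * j + v * k)))"
  define f2 :: "int \<times> int \<times> int \<Rightarrow> complex" where "f2 = (\<lambda>(i, j, k). of_real (exp (- pi * (of_int i)\<^sup>2 / a) / sqrt a
     * (exp (- pi * (j - u * i)\<^sup>2 / b) / sqrt b) * exp (- pi * d * (of_int k)\<^sup>2))
       * cis (2 * pi * (i * (v - u * s) + j * s) * k))"
  define f3 :: "int \<times> int \<times> int \<Rightarrow> complex" where "f3 = (\<lambda>(i, j, k). of_real (exp (- pi * (of_int i)\<^sup>2 / a) / sqrt a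
     * (exp (- pi * (j - u * i)\<^sup>2 / b) / sqrt b) * (exp (- pi * (k - (i * (v - u * s) + j * s))\<^sup>2 / d) / sqrt d)))"
  \<comment> \<open>The modulus of each \<open>f\<close> is a Gaussian in an injective linear image of \<open>(i, j, k)\<close>.\<close>
  define T0 where "T0 = (\<lambda>(x, y, z). (sqrt a * (x + u * y + v * z), sqrt b * (y + s * z), sqrt d * z))"
  define T1 where "T1 = (\<lambda>(x, y, z). (x / sqrt a, sqrt b * (y + s * z), sqrt d * z))"
  define T2 where "T2 = (\<lambda>(x, y, z). (x / sqrt a, (y - u * x) / sqrt b, sqrt d * z))"
  define T3 where "T3 = (\<lambda>(x, y, z). (x / sqrt a, (y - u * x) / sqrt b, (z - (x * (v - u * s) + y * s)) / sqrt d))"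
  have lin: "linear T0" "linear T1" "linear T2" "linear T3"
    unfolding T0_def T1_def T2_def T3_def
    by (intro linearI; force simp: algebra_simps add_divide_distrib diff_divide_distrib)+
  have inj: "inj T0" "inj T1" "inj T2" "inj T3"
    using lin a b d by (auto simp: linear_injective_0 T0_def T1_def T2_def T3_def zero_prod_def)
  have sum: "(\<lambda>n. exp (- pi * (norm (T (triple n)))\<^sup>2)) summable_on UNIV"
    if "linear T" "inj T" for T :: "real \<times> real \<times> real \<Rightarrow> real \<times> real \<times> real"
    using gauss_linear_summable[OF that, of pi] by simp
  have n0: "norm (f0 n) = exp (- pi * (norm (T0 (triple n)))\<^sup>2)" for n
    using a b d by (cases n) (simp add: f0_def T0_def triple_def norm_Pair norm_mult power_mult_distrib
        mult_exp_exp, simp add: algebra_simps)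
  have n1: "norm (f1 n) = exp (- pi * (norm (T1 (triple n)))\<^sup>2) * (1 / sqrt a)" for n
    using a b d by (cases n) (simp add: f1_def T1_def triple_def norm_Pair norm_mult norm_divide power_mult_distrib
        power_divide mult_exp_exp, simp add: distrib_left)
  have n2: "norm (f2 n) = exp (- pi * (norm (T2 (triple n)))\<^sup>2) * (1 / (sqrt a * sqrt b))" for n
    using a b d by (cases n) (simp add: f2_def T2_def triple_def norm_Pair norm_mult norm_divide power_mult_distrib
        power_divide mult_exp_exp, (simp add: algebra_simps)?)
  have n3: "norm (f3 n) = exp (- pi * (norm (T3 (triple n)))\<^sup>2) * (1 / (sqrt a * sqrt b * sqrt d))" for n
    using a b d by (cases n) (simp add: f3_def T3_def triple_def norm_Pair norm_mult norm_divide power_mult_distrib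
        power_divide mult_exp_exp, (simp add: algebra_simps)?)
  have s0: "(\<lambda>n. norm (f0 n)) summable_on UNIV"
    unfolding n0 by (intro sum lin inj)
  have s1: "(\<lambda>n. norm (f1 n)) summable_on UNIV"
    unfolding n1 by (intro summable_on_cmult_left sum lin inj)
  have s2: "(\<lambda>n. norm (f2 n)) summable_on UNIV"
    unfolding n2 by (intro summable_on_cmult_left sum lin inj)
  have s3: "(\<lambda>n. norm (f3 n)) summable_on UNIV"
    unfolding n3 by (intro summable_on_cmult_left sum lin inj)
  have "infsum f0 UNIV = infsum f1 UNIV"
  proof (rule infsum_triple_cong(1)[OF s0 s1])
    fix j k :: int
    define C where "C = complex_of_real (exp (- pi * b * (j + s * k)\<^sup>2) * exp (- pi * d * (of_int k)\<^sup>2))"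
    have "f0 (i, j, k) = C * (exp (- pi * a * (of_int i + (u * j + v * k))\<^sup>2) *\<^sub>R cis (2 * pi * 0 * (of_int i + (u * j + v * k))))" for i
      by (simp add: f0_def C_def scaleR_conv_of_real)
    moreover have "f1 (i, j, k) = C * ((exp (- pi * (of_int i - 0)\<^sup>2 / a) / sqrt a) *\<^sub>R cis (2 * pi * of_int i * (u * j + v * k)))" for i
      by (simp add: f1_def C_def scaleR_conv_of_real)
    ultimately show "(\<Sum>\<^sub>\<infinity>i. f0 (i, j, k)) = (\<Sum>\<^sub>\<infinity>i. f1 (i, j, k))"
      by (simp only: infsum_cmult_right' poisson_gaussian[OF a])
  qed
  also have "\<dots> = infsum f2 UNIV"
  proof (rule infsum_triple_cong(2)[OF s1 s2])
    fix i k :: int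
    define C where "C = complex_of_real (exp (- pi * (of_int i)\<^sup>2 / a) / sqrt a * exp (- pi * d * (of_int k)\<^sup>2))
      * cis (2 * pi * i * (v - u * s) * k)"
    have "f1 (i, j, k) = C * (exp (- pi * b * (of_int j + s * k)\<^sup>2) *\<^sub>R cis (2 * pi * (u * i) * (of_int j + s * k)))" for j
    proof -
      have "cis (2 * pi * i * (u * j + v * k)) = cis (2 * pi * i * (v - u * s) * k) * cis (2 * pi * (u * i) * (of_int j + s * k))"
        by (simp add: cis_mult algebra_simps)
      then show ?thesis
        by (simp add: f1_def C_def scaleR_conv_of_real)
    qed
    moreover have "f2 (i, j, k) = C * ((exp (- pi * (of_int j - u * i)\<^sup>2 / b) / sqrt b) *\<^sub>R cis (2 * pi * of_int j * (s * k)))" for j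
    proof -
      have "cis (2 * pi * (i * (v - u * s) + j * s) * k) = cis (2 * pi * i * (v - u * s) * k) * cis (2 * pi * of_int j * (s * k))"
        by (simp add: cis_mult algebra_simps)
      then show ?thesis
        by (simp add: f2_def C_def scaleR_conv_of_real)
    qed
    ultimately show "(\<Sum>\<^sub>\<infinity>j. f1 (i, j, k)) = (\<Sum>\<^sub>\<infinity>j. f2 (i, j, k))"
      by (simp only: infsum_cmult_right' poisson_gaussian[OF b])
  qed
  also have "\<dots> = infsum f3 UNIV"
  proof (rule infsum_triple_cong(3)[OF s2 s3])
    fix i j :: int
    define y where "y = i * (v - u * s) + j * s"
    define C where "C = complex_of_real (exp (- pi * (of_int i)\<^sup>2 / a) / sqrt a * (exp (- pi * (j - u * i)\<^sup>2 / b) / sqrt b))"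
    have "f2 (i, j, k) = C * (exp (- pi * d * (of_int k + 0)\<^sup>2) *\<^sub>R cis (2 * pi * y * (of_int k + 0)))" for k
      by (simp add: f2_def C_def scaleR_conv_of_real y_def)
    moreover have "f3 (i, j, k) = C * ((exp (- pi * (of_int k - y)\<^sup>2 / d) / sqrt d) *\<^sub>R cis (2 * pi * of_int k * 0))" for k
      by (simp add: f3_def C_def scaleR_conv_of_real y_def)
    ultimately show "(\<Sum>\<^sub>\<infinity>k. f2 (i, j, k)) = (\<Sum>\<^sub>\<infinity>k. f3 (i, j, k))"
      by (simp only: infsum_cmult_right' poisson_gaussian[OF d])
  qed
  finally have eq: "infsum f0 UNIV = infsum f3 UNIV" .
  have R0: "Re (f0 n) = ?L n" for n
    by (auto simp: f0_def exp_add[symmetric] algebra_simps split: prod.splits)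
  have R3: "Re (f3 n) = ?R n * (1 / sqrt (a * b * d))" for n
    by (auto simp: f3_def exp_add[symmetric] real_sqrt_mult algebra_simps split: prod.splits)
  have "infsum ?L UNIV = infsum (\<lambda>n. ?R n * (1 / sqrt (a * b * d))) UNIV"
    using infsum_Re[OF abs_summable_summable[OF s0]] infsum_Re[OF abs_summable_summable[OF s3]] eq
    unfolding R0 R3 by simp
  also have "\<dots> = infsum ?R UNIV * (1 / sqrt (a * b * d))" by (rule infsum_cmult_left')
  finally show ?thesis by simp
qed


definition vec3 :: "int \<times> int \<times> int \<Rightarrow> real^3" where
  "vec3 = (\<lambda>(i, j, k). vector [of_int i, of_int j, of_int k])"

lemma Z3_eq: "Z3 = range vec3"
proof -
  have "p \<in> range vec3" if p: "p \<in> Z3" for p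
  proof -
    obtain i j k :: int where "p $ 1 = of_int i" "p $ 2 = of_int j" "p $ 3 = of_int k"
      using p unfolding Z3_def Ints_def by blast
    then have "p = vec3 (i, j, k)" by (simp add: vec3_def vec_eq_iff forall_3)
    then show ?thesis by blast
  qed
  moreover have "vec3 n \<in> Z3" for n by (auto simp: vec3_def Z3_def forall_3 split: prod.splits)
  ultimately show ?thesis by blast
qed

lemma infsum_lattice_of:
  fixes f :: "real^3 \<Rightarrow> real"
  assumes "det M \<noteq> 0"
  shows "infsum f (lattice_of M) = (\<Sum>\<^sub>\<infinity>(i, j, k). f (M *v vector [of_int i, of_int j, of_int k]))"
proof -
  have "inj vec3" by (auto simp: inj_def vec3_def vec_eq_iff forall_3)
  moreover have "inj ((*v) M)"
    using assms by (simp add: inj_matrix_vector_mult invertible_det_nz)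
  ultimately have "inj (\<lambda>n. M *v vec3 n)" using inj_compose[of "(*v) M" vec3] by (simp add: o_def)
  then have "infsum f (range (\<lambda>n. M *v vec3 n)) = infsum (\<lambda>n. f (M *v vec3 n)) UNIV"
    by (subst infsum_reindex) (auto simp: o_def)
  moreover have "range (\<lambda>n. M *v vec3 n) = lattice_of M" by (auto simp: lattice_of_def Z3_eq)
  ultimately show ?thesis by (simp add: vec3_def case_prod_unfold)
qed

text \<open>
  Both sides depend only on the Gram matrix \<open>G = M\<^sup>T M\<close> and its inverse. Completing squares writes \<open>G\<close> as
  a triangular form with diagonal \<open>a\<close>, \<open>b\<close>, \<open>d\<close>, and substituting \<open>m = G w\<close> shows that the inverse form
  is the one on the right of the triangular case.
\<close>

theorem theta_duality:
  fixes M N :: "real^3^3"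
  assumes det: "det M = 1" and dual: "transpose M ** N = mat 1" and \<alpha>: "\<alpha> > 0"
  shows "theta (lattice_of M) \<alpha> = theta (lattice_of N) (1 / \<alpha>) / sqrt (\<alpha> ^ 3)"
proof -
  have MN: "M ** transpose N = mat 1"
    using arg_cong[OF dual, of transpose] by (simp add: matrix_transpose_mul matrix_left_right_inverse)
  have detN: "det N \<noteq> 0" using arg_cong[OF dual, of det] by (auto simp: det_mul)
  define e where "e x y z = (vector [x, y, z] :: real^3)" for x y z
  define G where "G = transpose M ** M"
  define g where "g i j = G $ i $ j" for i j
  have sym: "g j i = g i j" for i j
    unfolding g_def G_def by (simp add: matrix_matrix_mult_def transpose_def mult.commute)
  have "det G = 1" by (simp add: G_def det_mul det)
  then have detg: "g 1 1 * g 2 2 * g 3 3 + 2 * g 1 2 * g 1 3 * g 2 3 - g 1 1 * (g 2 3)\<^sup>2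
      - g 2 2 * (g 1 3)\<^sup>2 - g 3 3 * (g 1 2)\<^sup>2 = 1"
    using sym[of 2 1] sym[of 3 1] sym[of 3 2] by (simp add: det_3 g_def power2_eq_square algebra_simps)
  have normM: "(norm (M *v p))\<^sup>2 = p \<bullet> (G *v p)" for p
    unfolding G_def by (simp add: power2_norm_eq_inner matrix_vector_mul_assoc[symmetric] dot_lmul_matrix[symmetric]
       inner_commute transpose_matrix_vector)
  have form: "(norm (M *v e x y z))\<^sup>2 = g 1 1 * x\<^sup>2 + g 2 2 * y\<^sup>2 + g 3 3 * z\<^sup>2
     + 2 * g 1 2 * x * y + 2 * g 1 3 * x * z + 2 * g 2 3 * y * z" for x y z
    unfolding normM using sym[of 2 1] sym[of 3 1] sym[of 3 2]
    by (simp add: e_def inner_vec_def matrix_vector_mult_def sum_3 g_def power2_eq_square algebra_simps)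
  have pos: "(norm (M *v e x y z))\<^sup>2 > 0" if "x \<noteq> 0 \<or> y \<noteq> 0 \<or> z \<noteq> 0" for x y z
  proof -
    have "e x y z \<noteq> 0" using that by (auto simp: e_def vec_eq_iff forall_3)
    moreover have "inj ((*v) M)"
      using det by (simp add: inj_matrix_vector_mult invertible_det_nz)
    ultimately have "M *v e x y z \<noteq> 0" by (metis injD matrix_vector_mult_0_right)
    then show ?thesis by simp
  qed
  \<comment> \<open>Completion of squares: the form of \<open>G\<close> is \<open>a (x + u y + v z)\<^sup>2 + b (y + s z)\<^sup>2 + d z\<^sup>2\<close>.\<close>
  define a where "a = g 1 1"
  have a: "a > 0" using pos[of 1 0 0] form[of 1 0 0] by (simp add: a_def)
  define u v where "u = g 1 2 / a" and "v = g 1 3 / a"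
  have g12: "g 1 2 = a * u" and g13: "g 1 3 = a * v" using a by (auto simp: u_def v_def)
  define b where "b = g 2 2 - a * u\<^sup>2"
  have b: "b > 0" using pos[of "- u" 1 0] form[of "- u" 1 0] a
    by (simp add: b_def g12 a_def[symmetric] power2_eq_square algebra_simps)
  define s where "s = (g 2 3 - a * u * v) / b"
  have g22: "g 2 2 = b + a * u\<^sup>2" and g23: "g 2 3 = b * s + a * u * v" using b by (auto simp: s_def b_def)
  define d where "d = g 3 3 - a * v\<^sup>2 - b * s\<^sup>2"
  have g33: "g 3 3 = d + a * v\<^sup>2 + b * s\<^sup>2" by (simp add: d_def)
  have g11: "g 1 1 = a" by (simp add: a_def)
  note gs = g11 g12 g13 g22 g23 g33
  have d: "d > 0" using pos[of "u * s - v" "- s" 1] form[of "u * s - v" "- s" 1]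
    by (simp add: gs power2_eq_square algebra_simps)
  have abd: "a * b * d = 1"
    using detg unfolding gs by (simp add: power2_eq_square algebra_simps)
  have formM: "(norm (M *v e x y z))\<^sup>2 = a * (x + u * y + v * z)\<^sup>2 + b * (y + s * z)\<^sup>2 + d * z\<^sup>2" for x y z
    unfolding form gs by (simp add: power2_eq_square algebra_simps)
  have formN: "(norm (N *v e i j k))\<^sup>2 = i\<^sup>2 / a + (j - u * i)\<^sup>2 / b + (k - v * i - s * (j - u * i))\<^sup>2 / d" for i j k
  proof -
    define m where "m = e i j k"
    \<comment> \<open>\<open>w\<close> is the preimage of \<open>m\<close> under \<open>G\<close>.\<close>
    define w where "w = transpose N *v (N *v m)"
    obtain x y z where w: "w = e x y z"
    proof
      show "w = e (w $ 1) (w $ 2) (w $ 3)" by (simp add: e_def vec_eq_iff forall_3)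
    qed
    have Mw: "M *v w = N *v m"
      by (simp add: w_def matrix_vector_mul_assoc MN matrix_mul_assoc)
    have "G *v w = m"
      unfolding G_def matrix_vector_mul_assoc[symmetric] Mw by (simp add: matrix_vector_mul_assoc dual)
    then have "i = (G *v w) $ 1" "j = (G *v w) $ 2" "k = (G *v w) $ 3"
      by (auto simp: m_def e_def)
    then have i: "i = a * (x + u * y + v * z)" and j: "j = a * u * x + (b + a * u\<^sup>2) * y + (b * s + a * u * v) * z"
      and k: "k = a * v * x + (b * s + a * u * v) * y + (d + a * v\<^sup>2 + b * s\<^sup>2) * z"
      using sym[of 2 1] sym[of 3 1] sym[of 3 2] gs
      by (auto simp: w e_def matrix_vector_mult_def sum_3 g_def algebra_simps)
    have j': "j - u * i = b * (y + s * z)"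
      by (simp add: i j power2_eq_square algebra_simps)
    have k': "k - v * i - s * (j - u * i) = d * z"
      unfolding j' by (simp add: i k power2_eq_square algebra_simps)
    have "(norm (N *v m))\<^sup>2 = a * (x + u * y + v * z)\<^sup>2 + b * (y + s * z)\<^sup>2 + d * z\<^sup>2"
      unfolding Mw[symmetric] w formM ..
    also have "\<dots> = i\<^sup>2 / a + (j - u * i)\<^sup>2 / b + (k - v * i - s * (j - u * i))\<^sup>2 / d"
      unfolding k' unfolding j' unfolding i using a b d by (simp add: power2_eq_square)
    finally show ?thesis by (simp add: m_def)
  qed
  have "theta (lattice_of M) \<alpha> = (\<Sum>\<^sub>\<infinity>(i::int, j::int, k::int).
      exp (- pi * (\<alpha> * a * (i + u * j + v * k)\<^sup>2 + \<alpha> * b * (j + s * k)\<^sup>2 + \<alpha> * d * (of_int k)\<^sup>2)))"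
    unfolding theta_def using det
    by (subst infsum_lattice_of) (simp_all add: e_def[symmetric] formM algebra_simps)
  also have "\<dots> = (\<Sum>\<^sub>\<infinity>(i::int, j::int, k::int). exp (- pi * ((of_int i)\<^sup>2 / (\<alpha> * a) + (j - u * i)\<^sup>2 / (\<alpha> * b)
      + (k - v * i - s * (j - u * i))\<^sup>2 / (\<alpha> * d)))) / sqrt (\<alpha> * a * (\<alpha> * b) * (\<alpha> * d))"
    by (rule poisson_triangular) (use a b d \<alpha> in auto)
  also have "(\<Sum>\<^sub>\<infinity>(i::int, j::int, k::int). exp (- pi * ((of_int i)\<^sup>2 / (\<alpha> * a) + (j - u * i)\<^sup>2 / (\<alpha> * b)
      + (k - v * i - s * (j - u * i))\<^sup>2 / (\<alpha> * d)))) = theta (lattice_of N) (1 / \<alpha>)"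
    unfolding theta_def using detN \<alpha>
    by (subst infsum_lattice_of) (simp_all add: e_def[symmetric] formN add_divide_distrib distrib_left mult.commute)
  also have "\<alpha> * a * (\<alpha> * b) * (\<alpha> * d) = \<alpha> ^ 3"
    using abd by (simp add: power3_eq_cube algebra_simps)
  finally show ?thesis .
qed

section \<open>Gaussian sums over sets with cubic symmetry\<close>

definition gauss_summable :: "(real^3) set \<Rightarrow> bool" where
  "gauss_summable \<Lambda> \<longleftrightarrow> (\<forall>\<beta>>0. (\<lambda>p. exp (- \<beta> * (norm p)\<^sup>2)) summable_on \<Lambda>)"

definition flip :: "3 \<Rightarrow> real^3 \<Rightarrow> real^3" where
  "flip i p = (\<chi> j. if j = i then - p $ j else p $ j)"

definition cyc :: "real^3 \<Rightarrow> real^3" where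
  "cyc p = vector [p $ 2, p $ 3, p $ 1]"

definition cubic :: "(real^3) set \<Rightarrow> bool" where
  "cubic \<Lambda> \<longleftrightarrow> (\<forall>i. \<forall>p\<in>\<Lambda>. flip i p \<in> \<Lambda>) \<and> (\<forall>p\<in>\<Lambda>. cyc p \<in> \<Lambda>)"

text \<open>
  \<open>gsum (\<pi> \<alpha>) \<Lambda> 1\<close> is the value of theta.
\<close>

definition gsum :: "real \<Rightarrow> (real^3) set \<Rightarrow> (real^3 \<Rightarrow> real) \<Rightarrow> real" where
  "gsum \<kappa> \<Lambda> f = (\<Sum>\<^sub>\<infinity>p\<in>\<Lambda>. exp (- \<kappa> * (norm p)\<^sup>2) * f p)"

text \<open>
  The growth condition under which the sums \<open>gsum \<kappa>\<close> converge on every Gauss-summable set. The bound is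
  a slower exponential instead of a polynomial, so that the class contains the perturbed weights \<open>exp (- \<kappa> p \<bullet> X p)\<close> with
  small \<open>X\<close> and the remainder of their expansion.
\<close>

definition tame :: "real \<Rightarrow> (real^3 \<Rightarrow> real) \<Rightarrow> bool" where
  "tame \<kappa> f \<longleftrightarrow> (\<exists>C \<delta>. \<delta> < \<kappa> \<and> (\<forall>p. \<bar>f p\<bar> \<le> C * exp (\<delta> * (norm p)\<^sup>2)))"

lemma tameI: "(\<And>p. \<bar>f p\<bar> \<le> C * exp (\<delta> * (norm p)\<^sup>2)) \<Longrightarrow> \<delta> < \<kappa> \<Longrightarrow> tame \<kappa> f"
  by (auto simp: tame_def)

lemma gsum_summable:
  assumes \<Lambda>: "gauss_summable \<Lambda>" and f: "tame \<kappa> f"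
  shows "(\<lambda>p. exp (- \<kappa> * (norm p)\<^sup>2) * f p) summable_on \<Lambda>"
proof -
  obtain C \<delta> where \<delta>: "\<delta> < \<kappa>" and C: "\<And>p. \<bar>f p\<bar> \<le> C * exp (\<delta> * (norm p)\<^sup>2)"
    using f by (auto simp: tame_def)
  have "(\<lambda>p. exp (- (\<kappa> - \<delta>) * (norm p)\<^sup>2)) summable_on \<Lambda>"
    using \<Lambda> \<delta> unfolding gauss_summable_def by (metis diff_gt_0_iff_gt)
  then have "(\<lambda>p. norm (C * exp (- (\<kappa> - \<delta>) * (norm p)\<^sup>2))) summable_on \<Lambda>"
    unfolding norm_mult by (intro summable_on_cmult_right) simp
  then have "(\<lambda>p. norm (exp (- \<kappa> * (norm p)\<^sup>2) * f p)) summable_on \<Lambda>"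
  proof (rule summable_on_comparison_test)
    fix p
    have "norm (exp (- \<kappa> * (norm p)\<^sup>2) * f p) \<le> exp (- \<kappa> * (norm p)\<^sup>2) * (C * exp (\<delta> * (norm p)\<^sup>2))"
      using C[of p] by (simp add: abs_mult)
    also have "\<dots> = C * exp (- (\<kappa> - \<delta>) * (norm p)\<^sup>2)"
      by (simp add: mult_exp_exp algebra_simps)
    finally show "norm (exp (- \<kappa> * (norm p)\<^sup>2) * f p) \<le> norm (C * exp (- (\<kappa> - \<delta>) * (norm p)\<^sup>2))"
      by simp
  qed auto
  then show ?thesis by (rule abs_summable_summable)
qed

lemma tame_add: "tame \<kappa> f \<Longrightarrow> tame \<kappa> g \<Longrightarrow> tame \<kappa> (\<lambda>p. f p + g p)"
proof -
  assume "tame \<kappa> f" "tame \<kappa> g"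
  then obtain C \<delta> D \<epsilon> where *: "\<delta> < \<kappa>" "\<And>p. \<bar>f p\<bar> \<le> C * exp (\<delta> * (norm p)\<^sup>2)"
    "\<epsilon> < \<kappa>" "\<And>p. \<bar>g p\<bar> \<le> D * exp (\<epsilon> * (norm p)\<^sup>2)"
    by (auto simp: tame_def)
  have mono: "\<bar>h\<bar> \<le> \<bar>B\<bar> * exp (max \<delta> \<epsilon> * N)" if "\<bar>h\<bar> \<le> B * exp (\<gamma> * N)" "\<gamma> \<le> max \<delta> \<epsilon>" "N \<ge> 0" for h B \<gamma> N :: real
  proof -
    have "\<bar>h\<bar> \<le> \<bar>B\<bar> * exp (\<gamma> * N)"
      using that(1) by (rule order_trans) (intro mult_right_mono, auto)
    also have "\<dots> \<le> \<bar>B\<bar> * exp (max \<delta> \<epsilon> * N)"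
      using that by (intro mult_left_mono) (auto intro!: mult_right_mono simp del: max_less_iff_conj)
    finally show ?thesis .
  qed
  show ?thesis
  proof (rule tameI)
    show "\<bar>f p + g p\<bar> \<le> (\<bar>C\<bar> + \<bar>D\<bar>) * exp (max \<delta> \<epsilon> * (norm p)\<^sup>2)" for p
      using mono[OF *(2)[of p]] mono[OF *(4)[of p]] abs_triangle_ineq[of "f p" "g p"]
      unfolding distrib_right by simp
  qed (use * in auto)
qed

lemma tame_cmult: "tame \<kappa> f \<Longrightarrow> tame \<kappa> (\<lambda>p. c * f p)"
proof -
  assume "tame \<kappa> f"
  then obtain C \<delta> where *: "\<delta> < \<kappa>" "\<And>p. \<bar>f p\<bar> \<le> C * exp (\<delta> * (norm p)\<^sup>2)"
    by (auto simp: tame_def)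
  show ?thesis
    by (rule tameI[where C = "\<bar>c\<bar> * C", OF _ *(1)]) (use *(2) in \<open>simp add: abs_mult mult.assoc mult_left_mono\<close>)
qed

lemma tame_diff: "tame \<kappa> f \<Longrightarrow> tame \<kappa> g \<Longrightarrow> tame \<kappa> (\<lambda>p. f p - g p)"
  using tame_add[of \<kappa> f "\<lambda>p. -1 * g p"] tame_cmult[of \<kappa> g "-1"] by simp

lemma power_le_exp:
  fixes x \<delta> :: real assumes "x \<ge> 0" "\<delta> > 0"
  shows "x ^ n \<le> (fact n / \<delta> ^ n) * exp (\<delta> * x)"
proof -
  have "(\<delta> * x) ^ n / fact n \<le> exp (\<delta> * x)"
  proof -
    have "(\<delta> * x) ^ n / fact n = (\<Sum>k\<in>{n}. (\<delta> * x) ^ k /\<^sub>R fact k)" by (simp add: divide_inverse)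
    also have "\<dots> \<le> (\<Sum>k. (\<delta> * x) ^ k /\<^sub>R fact k)"
      using assms by (intro sum_le_suminf summable_exp_generic) auto
    finally show ?thesis by (simp add: exp_def)
  qed
  then show ?thesis using assms by (simp add: power_mult_distrib field_simps)
qed

lemma tame_poly:
  assumes "\<kappa> > 0" "\<And>p. \<bar>f p\<bar> \<le> B * (norm p) ^ (2 * n)" "B \<ge> 0"
  shows "tame \<kappa> f"
proof (rule tameI)
  fix p :: "real^3"
  have "\<bar>f p\<bar> \<le> B * ((norm p)\<^sup>2) ^ n" using assms(2)[of p] by (simp add: power_mult)
  also have "\<dots> \<le> B * ((fact n / (\<kappa> / 2) ^ n) * exp (\<kappa> / 2 * (norm p)\<^sup>2))"
    using assms by (intro mult_left_mono power_le_exp) auto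
  finally show "\<bar>f p\<bar> \<le> B * (fact n / (\<kappa> / 2) ^ n) * exp (\<kappa> / 2 * (norm p)\<^sup>2)"
    by (simp only: mult.assoc)
qed (use assms in auto)

lemma gsum_add:
  assumes "gauss_summable \<Lambda>" "tame \<kappa> f" "tame \<kappa> g"
  shows "gsum \<kappa> \<Lambda> (\<lambda>p. f p + g p) = gsum \<kappa> \<Lambda> f + gsum \<kappa> \<Lambda> g"
  unfolding gsum_def distrib_left using assms by (intro infsum_add gsum_summable)

lemma gsum_cmult: "gsum \<kappa> \<Lambda> (\<lambda>p. c * f p) = c * gsum \<kappa> \<Lambda> f"
  unfolding gsum_def by (subst infsum_cmult_right'[symmetric]) (simp add: mult.left_commute)

lemma gsum_diff:
  assumes "gauss_summable \<Lambda>" "tame \<kappa> f" "tame \<kappa> g"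
  shows "gsum \<kappa> \<Lambda> (\<lambda>p. f p - g p) = gsum \<kappa> \<Lambda> f - gsum \<kappa> \<Lambda> g"
  using gsum_add[OF assms(1,2) tame_cmult[OF assms(3), of "-1"]] gsum_cmult[of \<kappa> \<Lambda> "-1" g] by simp

lemma gsum_mono:
  assumes "gauss_summable \<Lambda>" "tame \<kappa> f" "tame \<kappa> g" "\<And>p. p \<in> \<Lambda> \<Longrightarrow> f p \<le> g p"
  shows "gsum \<kappa> \<Lambda> f \<le> gsum \<kappa> \<Lambda> g"
  unfolding gsum_def using assms by (intro infsum_mono gsum_summable) auto

lemma norm3: "(norm (p :: real^3))\<^sup>2 = (p $ 1)\<^sup>2 + (p $ 2)\<^sup>2 + (p $ 3)\<^sup>2"
  unfolding power2_norm_eq_inner by (simp add: inner_vec_def sum_3 power2_eq_square)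

lemma flip_nth [simp]: "flip i p $ j = (if j = i then - p $ j else p $ j)"
  by (simp add: flip_def)

lemma cyc_nth [simp]: "cyc p $ 1 = p $ 2" "cyc p $ 2 = p $ 3" "cyc p $ 3 = p $ 1"
  by (simp_all add: cyc_def)

lemma norm_flip [simp]: "norm (flip i p) = norm p"
  unfolding norm_vec_def L2_set_def by (intro arg_cong[where f = sqrt] sum.cong) auto

lemma norm_cyc [simp]: "norm (cyc p) = norm p"
  by (rule power2_eq_imp_eq) (simp_all only: norm3 cyc_nth norm_ge_zero)

lemma gsum_reindex:
  assumes "bij_betw h \<Lambda> \<Lambda>" "\<And>p. norm (h p) = norm p"
  shows "gsum \<kappa> \<Lambda> (\<lambda>p. f (h p)) = gsum \<kappa> \<Lambda> f"
  using infsum_reindex_bij_betw[OF assms(1), of "\<lambda>p. exp (- \<kappa> * (norm p)\<^sup>2) * f p"]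
  by (simp add: gsum_def assms(2))

lemma gsum_flip:
  assumes "cubic \<Lambda>" shows "gsum \<kappa> \<Lambda> (\<lambda>p. f (flip i p)) = gsum \<kappa> \<Lambda> f"
proof (rule gsum_reindex)
  have "flip i (flip i p) = p" for p by (simp add: vec_eq_iff)
  then show "bij_betw (flip i) \<Lambda> \<Lambda>"
    using assms by (intro bij_betw_byWitness[of _ "flip i"]) (auto simp: cubic_def)
qed simp

lemma gsum_cyc:
  assumes "cubic \<Lambda>" shows "gsum \<kappa> \<Lambda> (\<lambda>p. f (cyc p)) = gsum \<kappa> \<Lambda> f"
proof (rule gsum_reindex)
  have "cyc (cyc (cyc p)) = p" for p by (simp add: vec_eq_iff forall_3)
  then show "bij_betw cyc \<Lambda> \<Lambda>"
    using assms by (intro bij_betw_byWitness[of _ "\<lambda>p. cyc (cyc p)"]) (auto simp: cubic_def)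
qed simp

text \<open>
  The identity and the three flips act on the mixed products \<open>xy\<close>, \<open>xz\<close>, \<open>yz\<close> by pairwise orthogonal sign patterns,
  all orthogonal to the trivial one. So these four maps suffice to remove from a quadratic form and from its
  square all terms that are odd in some coordinate, although they do not form a group.
\<close>

definition sign_avg :: "(real^3 \<Rightarrow> real) \<Rightarrow> real^3 \<Rightarrow> real" where
  "sign_avg f p = (f p + f (flip 1 p) + f (flip 2 p) + f (flip 3 p)) / 4"

definition cyc_avg :: "(real^3 \<Rightarrow> real) \<Rightarrow> real^3 \<Rightarrow> real" where
  "cyc_avg f p = (f p + f (cyc p) + f (cyc (cyc p))) / 3"

lemma tame_flip: "tame \<kappa> f \<Longrightarrow> tame \<kappa> (\<lambda>p. f (flip i p))"
  unfolding tame_def by (metis norm_flip)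

lemma tame_cyc: "tame \<kappa> f \<Longrightarrow> tame \<kappa> (\<lambda>p. f (cyc p))"
  unfolding tame_def by (metis norm_cyc)

lemma tame_sign_avg: "tame \<kappa> f \<Longrightarrow> tame \<kappa> (sign_avg f)"
  unfolding sign_avg_def divide_inverse mult.commute[of _ "inverse _"]
  by (intro tame_cmult tame_add tame_flip)

lemma tame_cyc_avg: "tame \<kappa> f \<Longrightarrow> tame \<kappa> (cyc_avg f)"
  unfolding cyc_avg_def divide_inverse mult.commute[of _ "inverse _"]
  by (intro tame_cmult tame_add tame_cyc tame_cyc[of _ "\<lambda>p. f (cyc p)"])

lemma gsum_avg:
  assumes \<Lambda>: "cubic \<Lambda>" "gauss_summable \<Lambda>" and f: "tame \<kappa> f"
  shows "gsum \<kappa> \<Lambda> (cyc_avg (sign_avg f)) = gsum \<kappa> \<Lambda> f"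
proof -
  have 1: "gsum \<kappa> \<Lambda> (sign_avg g) = gsum \<kappa> \<Lambda> g" if "tame \<kappa> g" for g
    unfolding sign_avg_def divide_inverse mult.commute[of _ "inverse _"] gsum_cmult
    using \<Lambda> that by (simp add: gsum_add tame_add tame_flip gsum_flip)
  have 2: "gsum \<kappa> \<Lambda> (cyc_avg g) = gsum \<kappa> \<Lambda> g" if "tame \<kappa> g" for g
    unfolding cyc_avg_def divide_inverse mult.commute[of _ "inverse _"] gsum_cmult
    using \<Lambda> that gsum_cyc[of \<Lambda> \<kappa> "\<lambda>p. g (cyc p)"] tame_cyc[of \<kappa> "\<lambda>p. g (cyc p)"]
    by (simp add: gsum_add tame_add tame_cyc gsum_cyc)
  show ?thesis using 1 2 f tame_sign_avg by metis
qed

section \<open>The second variation\<close>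

definition quad :: "real^3^3 \<Rightarrow> real^3 \<Rightarrow> real" where
  "quad X p = p \<bullet> (X *v p)"

definition diag_sq :: "real^3^3 \<Rightarrow> real" where
  "diag_sq X = (X $ 1 $ 1)\<^sup>2 + (X $ 2 $ 2)\<^sup>2 + (X $ 3 $ 3)\<^sup>2"

definition off_sq :: "real^3^3 \<Rightarrow> real" where
  "off_sq X = (X $ 1 $ 2)\<^sup>2 + (X $ 1 $ 3)\<^sup>2 + (X $ 2 $ 3)\<^sup>2"

definition e22 :: "real^3 \<Rightarrow> real" where
  "e22 p = (p $ 1)\<^sup>2 * (p $ 2)\<^sup>2 + (p $ 2)\<^sup>2 * (p $ 3)\<^sup>2 + (p $ 3)\<^sup>2 * (p $ 1)\<^sup>2"

definition diag_poly :: "real \<Rightarrow> real^3 \<Rightarrow> real" where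
  "diag_poly \<kappa> p = \<kappa> * (((p $ 1)\<^sup>2 - (p $ 2)\<^sup>2)\<^sup>2 + ((p $ 2)\<^sup>2 - (p $ 3)\<^sup>2)\<^sup>2 + ((p $ 3)\<^sup>2 - (p $ 1)\<^sup>2)\<^sup>2) / 2 - (norm p)\<^sup>2"

definition off_poly :: "real \<Rightarrow> real^3 \<Rightarrow> real" where
  "off_poly \<kappa> p = 2 * \<kappa> * e22 p - (norm p)\<^sup>2"

lemma norm_matrix_sq:
  assumes "transpose X = X"
  shows "(norm (X :: real^3^3))\<^sup>2 = diag_sq X + 2 * off_sq X"
proof -
  have "X $ j $ i = X $ i $ j" for i j
    using arg_cong[OF assms, of "\<lambda>Y. Y $ i $ j"] by (simp add: transpose_def)
  from this[of 1 2] this[of 1 3] this[of 2 3] show ?thesis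
    unfolding power2_norm_eq_inner by (simp add: inner_vec_def sum_3 diag_sq_def off_sq_def power2_eq_square)
qed

lemma abs_quad_le: "\<bar>quad X p\<bar> \<le> norm X * (norm p)\<^sup>2"
proof -
  have "(norm (X *v p))\<^sup>2 \<le> (norm X * norm p)\<^sup>2"
  proof -
    have "(norm (X *v p))\<^sup>2 = (\<Sum>i\<in>UNIV. (X $ i \<bullet> p)\<^sup>2)"
      unfolding power2_norm_eq_inner inner_vec_def[of "X *v p"]
      by (simp add: matrix_vector_mul_component power2_eq_square)
    also have "\<dots> \<le> (\<Sum>i\<in>UNIV. (norm (X $ i))\<^sup>2 * (norm p)\<^sup>2)"
    proof (rule sum_mono)
      fix i
      have "\<bar>X $ i \<bullet> p\<bar>\<^sup>2 \<le> (norm (X $ i) * norm p)\<^sup>2"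
        by (intro power_mono Cauchy_Schwarz_ineq2) auto
      then show "(X $ i \<bullet> p)\<^sup>2 \<le> (norm (X $ i))\<^sup>2 * (norm p)\<^sup>2"
        by (simp add: power_mult_distrib)
    qed
    also have "\<dots> = (norm X * norm p)\<^sup>2"
      unfolding power_mult_distrib sum_distrib_right[symmetric]
      by (simp add: norm_vec_def L2_set_def sum_nonneg)
    finally show ?thesis .
  qed
  then have "norm (X *v p) \<le> norm X * norm p" by (rule power2_le_imp_le) simp
  then have "norm p * norm (X *v p) \<le> norm p * (norm X * norm p)" by (intro mult_left_mono) auto
  then show ?thesis
    unfolding quad_def using Cauchy_Schwarz_ineq2[of p "X *v p"]
    by (simp add: power2_eq_square mult.left_commute mult.commute)
qed

text \<open>
  Only the order of the remainder matters below, hence the crude constant.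
\<close>

lemma exp_taylor2:
  fixes x :: real
  shows "\<bar>exp (- x) - (1 - x + x\<^sup>2 / 2)\<bar> \<le> \<bar>x\<bar> ^ 3 * exp \<bar>x\<bar>"
proof -
  obtain t where t: "\<bar>t\<bar> \<le> \<bar>- x\<bar>" "exp (- x) = (\<Sum>m<3. (- x) ^ m / fact m) + (exp t / fact 3) * (- x) ^ 3"
    using Maclaurin_exp_le[of "- x" 3] by blast
  then have "exp (- x) - (1 - x + x\<^sup>2 / 2) = (exp t / 6) * (- x) ^ 3"
    by (simp add: numeral_3_eq_3 lessThan_Suc power2_eq_square fact_numeral)
  then have "\<bar>exp (- x) - (1 - x + x\<^sup>2 / 2)\<bar> = \<bar>x\<bar> ^ 3 * (exp t / 6)"
    by (simp add: abs_mult power_abs[symmetric])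
  also have "\<dots> \<le> \<bar>x\<bar> ^ 3 * exp \<bar>x\<bar>"
  proof (rule mult_left_mono)
    have "exp t \<le> exp \<bar>x\<bar>" using t(1) by simp
    then show "exp t / 6 \<le> exp \<bar>x\<bar>" using exp_gt_zero[of t] by linarith
  qed auto
  finally show ?thesis .
qed


lemma quad_symm:
  assumes "transpose X = X"
  shows "quad X p = X $ 1 $ 1 * (p $ 1)\<^sup>2 + X $ 2 $ 2 * (p $ 2)\<^sup>2 + X $ 3 $ 3 * (p $ 3)\<^sup>2
    + 2 * X $ 1 $ 2 * (p $ 1 * p $ 2) + 2 * X $ 1 $ 3 * (p $ 1 * p $ 3) + 2 * X $ 2 $ 3 * (p $ 2 * p $ 3)"
proof -
  have "X $ j $ i = X $ i $ j" for i j
    using arg_cong[OF assms, of "\<lambda>Y. Y $ i $ j"] by (simp add: transpose_def)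
  from this[of 1 2] this[of 1 3] this[of 2 3] show ?thesis
    by (simp add: quad_def inner_vec_def sum_3 matrix_vector_mult_def power2_eq_square algebra_simps)
qed

lemma sign_avg_quad:
  assumes "transpose X = X"
  shows "sign_avg (quad X) p = X $ 1 $ 1 * (p $ 1)\<^sup>2 + X $ 2 $ 2 * (p $ 2)\<^sup>2 + X $ 3 $ 3 * (p $ 3)\<^sup>2"
  unfolding sign_avg_def quad_symm[OF assms] by simp

lemma sign_avg_quad_sq:
  assumes "transpose X = X"
  shows "sign_avg (\<lambda>p. (quad X p)\<^sup>2) p =
    (X $ 1 $ 1 * (p $ 1)\<^sup>2 + X $ 2 $ 2 * (p $ 2)\<^sup>2 + X $ 3 $ 3 * (p $ 3)\<^sup>2)\<^sup>2
    + 4 * ((X $ 1 $ 2)\<^sup>2 * (p $ 1 * p $ 2)\<^sup>2 + (X $ 1 $ 3)\<^sup>2 * (p $ 1 * p $ 3)\<^sup>2 + (X $ 2 $ 3)\<^sup>2 * (p $ 2 * p $ 3)\<^sup>2)"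
proof -
  have "((D + a + b + c)\<^sup>2 + (D - a - b + c)\<^sup>2 + (D - a + b - c)\<^sup>2 + (D + a - b - c)\<^sup>2) / 4
      = D\<^sup>2 + a\<^sup>2 + b\<^sup>2 + c\<^sup>2" for D a b c :: real
    by (simp add: power2_eq_square algebra_simps)
  from this[of "X $ 1 $ 1 * (p $ 1)\<^sup>2 + X $ 2 $ 2 * (p $ 2)\<^sup>2 + X $ 3 $ 3 * (p $ 3)\<^sup>2"
      "2 * X $ 1 $ 2 * (p $ 1 * p $ 2)" "2 * X $ 1 $ 3 * (p $ 1 * p $ 3)" "2 * X $ 2 $ 3 * (p $ 2 * p $ 3)"]
  show ?thesis
    unfolding sign_avg_def quad_symm[OF assms] by (simp add: power_mult_distrib)
qed

lemma avg_quad: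
  assumes "transpose X = X"
  shows "cyc_avg (sign_avg (quad X)) p = trace X * (norm p)\<^sup>2 / 3"
  unfolding cyc_avg_def sign_avg_quad[OF assms] norm3 trace_def
  by (simp add: sum_3 algebra_simps)

lemma avg_quad_sq:
  assumes "transpose X = X"
  shows "cyc_avg (sign_avg (\<lambda>p. (quad X p)\<^sup>2)) p =
    (diag_sq X * ((p $ 1) ^ 4 + (p $ 2) ^ 4 + (p $ 3) ^ 4 - e22 p) + (trace X)\<^sup>2 * e22 p + 4 * off_sq X * e22 p) / 3"
  unfolding cyc_avg_def sign_avg_quad_sq[OF assms] trace_def diag_sq_def off_sq_def e22_def
  by (simp add: sum_3 power4_eq_xxxx power2_eq_square algebra_simps)

lemma diag_poly_eq:
  "diag_poly \<kappa> p = \<kappa> * ((p $ 1) ^ 4 + (p $ 2) ^ 4 + (p $ 3) ^ 4 - e22 p) - (norm p)\<^sup>2"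
  unfolding diag_poly_def e22_def by (simp add: power4_eq_xxxx power2_eq_square field_simps)

text \<open>
  The determinant of \<open>1 + X\<close> is \<open>1\<close> plus the trace of \<open>X\<close>, its second elementary symmetric function and its determinant.
  Setting it to \<open>1\<close> trades the linear term for quadratic ones, and these join the averaged squares to form
  \<open>diag_poly\<close> and \<open>off_poly\<close>.
\<close>

lemma avg_taylor:
  assumes X: "transpose X = X" and det: "det (mat 1 + X) = 1"
  shows "cyc_avg (sign_avg (\<lambda>p. 1 - \<kappa> * quad X p + (\<kappa> * quad X p)\<^sup>2 / 2)) p =
    1 + \<kappa> / 6 * diag_sq X * diag_poly \<kappa> p + \<kappa> / 3 * off_sq X * off_poly \<kappa> p
    + \<kappa> / 3 * ((trace X)\<^sup>2 / 2 + det X) * (norm p)\<^sup>2 + \<kappa>\<^sup>2 / 6 * (trace X)\<^sup>2 * e22 p"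
proof -
  have sym: "X $ j $ i = X $ i $ j" for i j
    using arg_cong[OF X, of "\<lambda>Y. Y $ i $ j"] by (simp add: transpose_def)
  have tr: "trace X = diag_sq X / 2 + off_sq X - (trace X)\<^sup>2 / 2 - det X"
    using det sym[of 1 2] sym[of 1 3] sym[of 2 3] unfolding det_3 trace_def diag_sq_def off_sq_def sum_3
    by (simp add: mat_def power2_eq_square field_simps)
  have lin: "cyc_avg (sign_avg (\<lambda>p. 1 - \<kappa> * f p + (\<kappa> * f p)\<^sup>2 / 2)) p =
    1 - \<kappa> * cyc_avg (sign_avg f) p + \<kappa>\<^sup>2 / 2 * cyc_avg (sign_avg (\<lambda>p. (f p)\<^sup>2)) p" for f
    by (simp add: cyc_avg_def sign_avg_def power_mult_distrib field_simps)
  have "- \<kappa> * (trace X * (norm p)\<^sup>2 / 3) = - \<kappa> * ((diag_sq X / 2 + off_sq X - (trace X)\<^sup>2 / 2 - det X) * (norm p)\<^sup>2 / 3)"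
    using tr by simp
  then show ?thesis
    unfolding lin avg_quad[OF X] avg_quad_sq[OF X] diag_poly_eq off_poly_def
    by (simp add: power2_eq_square field_simps)
qed

lemma abs_avg_le:
  assumes "\<And>q. norm q = norm p \<Longrightarrow> \<bar>f q - g q\<bar> \<le> B"
  shows "\<bar>cyc_avg (sign_avg f) p - cyc_avg (sign_avg g) p\<bar> \<le> B"
proof -
  have 1: "\<bar>sign_avg f q - sign_avg g q\<bar> \<le> B" if "norm q = norm p" for q
    using assms[of q] assms[of "flip 1 q"] assms[of "flip 2 q"] assms[of "flip 3 q"] that
    unfolding sign_avg_def by (auto simp: abs_le_iff field_simps)
  show ?thesis
    using 1[of p] 1[of "cyc p"] 1[of "cyc (cyc p)"]
    unfolding cyc_avg_def by (auto simp: abs_le_iff field_simps)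
qed

lemma e22_le: "0 \<le> e22 p" "e22 p \<le> ((norm p)\<^sup>2)\<^sup>2"
proof -
  have "0 \<le> a * b + b * c + c * a \<and> a * b + b * c + c * a \<le> (a + b + c)\<^sup>2" if "a \<ge> 0" "b \<ge> 0" "c \<ge> 0" for a b c :: real
  proof -
    have "a * b \<ge> 0" "b * c \<ge> 0" "a * c \<ge> 0" "a * a \<ge> 0" "b * b \<ge> 0" "c * c \<ge> 0" using that by auto
    then show ?thesis by (simp add: power2_eq_square algebra_simps)
  qed
  from this[of "(p $ 1)\<^sup>2" "(p $ 2)\<^sup>2" "(p $ 3)\<^sup>2"] show "0 \<le> e22 p" "e22 p \<le> ((norm p)\<^sup>2)\<^sup>2"
    by (auto simp: e22_def norm3)
qed

lemma abs_det3_le: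
  fixes X :: "real^3^3"
  assumes "\<And>i j. \<bar>X $ i $ j\<bar> \<le> r"
  shows "\<bar>det X\<bar> \<le> 6 * r ^ 3"
proof -
  have *: "\<bar>X $ a $ b * X $ c $ d * X $ e $ f\<bar> \<le> r ^ 3" for a b c d e f
  proof -
    have "0 \<le> r" using assms[of 1 1] by linarith
    then have "\<bar>X $ a $ b\<bar> * \<bar>X $ c $ d\<bar> * \<bar>X $ e $ f\<bar> \<le> r * r * r"
      using assms by (intro mult_mono) auto
    then show ?thesis by (simp add: abs_mult power3_eq_cube)
  qed
  show ?thesis
    unfolding det_3 using *[of 1 1 2 2 3 3] *[of 1 2 2 3 3 1] *[of 1 3 2 1 3 2] *[of 1 1 2 3 3 2] *[of 1 2 2 1 3 3]
      *[of 1 3 2 2 3 1] by (simp add: abs_le_iff)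
qed

text \<open>
  After averaging, the error consists of the cubic Taylor remainder and of the two terms of the previous
  identity that involve the determinant and the squared trace; the constraint makes the trace quadratic in \<open>X\<close>, so that
  all of them are of third order. Powers of the norm of \<open>p\<close> are absorbed in half of the Gaussian. The three
  constants are \<open>384\<close>, \<open>16\<close> and \<open>48\<close>, rounded up to \<open>1000\<close>.
\<close>

lemma avg_exp_expansion:
  assumes X: "transpose X = X" and det: "det (mat 1 + X) = 1" and \<kappa>: "\<kappa> > 0" and r: "norm X \<le> 1 / 4"
  shows "\<bar>cyc_avg (sign_avg (\<lambda>p. exp (- \<kappa> * quad X p))) p -
    (1 + \<kappa> / 6 * diag_sq X * diag_poly \<kappa> p + \<kappa> / 3 * off_sq X * off_poly \<kappa> p)\<bar>
    \<le> 1000 * norm X ^ 3 * exp (\<kappa> / 2 * (norm p)\<^sup>2)"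
proof -
  define r where "r = norm X"
  define N where "N = (norm p)\<^sup>2"
  have r0: "0 \<le> r" "r \<le> 1 / 4" and N0: "N \<ge> 0" using r by (auto simp: r_def N_def)
  have entry: "\<bar>X $ i $ j\<bar> \<le> r" for i j
    using Finite_Cartesian_Product.norm_nth_le[of "X $ i" j] Finite_Cartesian_Product.norm_nth_le[of X i] by (simp add: r_def)
  have det3: "\<bar>det X\<bar> \<le> 6 * r ^ 3" by (rule abs_det3_le[OF entry])
  have r3: "r ^ 3 \<le> r\<^sup>2 / 4" using r0 mult_left_mono[OF r0(2), of "r\<^sup>2"]
    by (simp add: power2_eq_square power3_eq_cube)
  have tr: "\<bar>trace X\<bar> \<le> 12 * r\<^sup>2"
  proof -
    have *: "\<bar>X $ a $ b * X $ c $ d\<bar> \<le> r\<^sup>2" for a b c d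
      using mult_mono[OF entry entry, of a b c d] r0 by (simp add: abs_mult power2_eq_square mult.commute)
    have "trace X = - (X $ 1 $ 1 * X $ 2 $ 2 + X $ 1 $ 1 * X $ 3 $ 3 + X $ 2 $ 2 * X $ 3 $ 3
        - X $ 1 $ 2 * X $ 2 $ 1 - X $ 1 $ 3 * X $ 3 $ 1 - X $ 2 $ 3 * X $ 3 $ 2) - det X"
      using det unfolding det_3 trace_def sum_3 by (simp add: mat_def algebra_simps)
    then show ?thesis
      using *[of 1 1 2 2] *[of 1 1 3 3] *[of 2 2 3 3] *[of 1 2 2 1] *[of 1 3 3 1] *[of 2 3 3 2] det3 r3
      by (simp only: abs_le_iff) linarith
  qed
  have tr2: "(trace X)\<^sup>2 \<le> 36 * r ^ 3"
  proof -
    have "(trace X)\<^sup>2 \<le> (12 * r\<^sup>2)\<^sup>2" using tr by (metis abs_ge_zero power2_abs power_mono)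
    also have "\<dots> = 144 * (r ^ 3 * r)" by (simp add: power2_eq_square power3_eq_cube)
    also have "\<dots> \<le> 144 * (r ^ 3 * (1 / 4))" using r0 by (intro mult_left_mono) auto
    finally show ?thesis by simp
  qed
  define E where "E = exp (\<kappa> / 2 * N)"
  have N1: "\<kappa> * N \<le> 2 * E"
    using power_le_exp[of N "\<kappa> / 2" 1] \<kappa> N0 by (simp add: E_def field_simps)
  have N2: "\<kappa>\<^sup>2 * N\<^sup>2 \<le> 8 * E"
    using power_le_exp[of N "\<kappa> / 2" 2] \<kappa> N0 by (simp add: E_def field_simps fact_numeral)
  have 1: "\<bar>exp (- \<kappa> * quad X q) - (1 - \<kappa> * quad X q + (\<kappa> * quad X q)\<^sup>2 / 2)\<bar> \<le> 384 * r ^ 3 * E"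
    if "norm q = norm p" for q
  proof -
    have q: "\<bar>\<kappa> * quad X q\<bar> \<le> \<kappa> * (r * N)"
      using abs_quad_le[of X q] \<kappa> that by (simp add: abs_mult r_def N_def)
    have "\<bar>exp (- (\<kappa> * quad X q)) - (1 - \<kappa> * quad X q + (\<kappa> * quad X q)\<^sup>2 / 2)\<bar>
        \<le> \<bar>\<kappa> * quad X q\<bar> ^ 3 * exp \<bar>\<kappa> * quad X q\<bar>"
      by (rule exp_taylor2)
    also have "\<dots> \<le> (\<kappa> * (r * N)) ^ 3 * exp (\<kappa> * ((1 / 4) * N))"
      using q \<kappa> r0 N0 order_trans[OF q mult_left_mono[OF mult_right_mono[OF r0(2) N0], of \<kappa>]]
      by (intro mult_mono power_mono) auto
    also have "\<dots> = (\<kappa> * r) ^ 3 * N ^ 3 * exp (\<kappa> / 4 * N)"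
      by (simp add: power_mult_distrib)
    also have "\<dots> \<le> (\<kappa> * r) ^ 3 * (fact 3 / (\<kappa> / 4) ^ 3 * exp (\<kappa> / 4 * N)) * exp (\<kappa> / 4 * N)"
      using \<kappa> N0 r0 by (intro mult_right_mono mult_left_mono power_le_exp) auto
    also have "\<dots> = 384 * r ^ 3 * (exp (\<kappa> / 4 * N) * exp (\<kappa> / 4 * N))"
      using \<kappa> by (simp add: power_mult_distrib power_divide fact_numeral)
    also have "exp (\<kappa> / 4 * N) * exp (\<kappa> / 4 * N) = E"
      by (simp add: E_def mult_exp_exp)
    finally show ?thesis by simp
  qed
  have "\<bar>cyc_avg (sign_avg (\<lambda>p. exp (- \<kappa> * quad X p))) p
     - cyc_avg (sign_avg (\<lambda>p. 1 - \<kappa> * quad X p + (\<kappa> * quad X p)\<^sup>2 / 2)) p\<bar> \<le> 384 * r ^ 3 * E"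
    by (rule abs_avg_le[OF 1])
  moreover have "\<bar>\<kappa> / 3 * ((trace X)\<^sup>2 / 2 + det X) * N\<bar> \<le> 16 * r ^ 3 * E"
  proof -
    have "\<bar>\<kappa> / 3 * ((trace X)\<^sup>2 / 2 + det X) * N\<bar> = \<bar>(trace X)\<^sup>2 / 2 + det X\<bar> / 3 * (\<kappa> * N)"
      using \<kappa> N0 by (simp add: abs_mult)
    also have "\<dots> \<le> (24 * r ^ 3) / 3 * (2 * E)"
    proof (rule mult_mono[OF _ N1])
      show "\<bar>(trace X)\<^sup>2 / 2 + det X\<bar> / 3 \<le> 24 * r ^ 3 / 3"
        using tr2 det3 abs_triangle_ineq[of "(trace X)\<^sup>2 / 2" "det X"] by simp
    qed (use r0 \<kappa> N0 in auto)
    finally show ?thesis by simp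
  qed
  moreover have "\<bar>\<kappa>\<^sup>2 / 6 * (trace X)\<^sup>2 * e22 p\<bar> \<le> 48 * r ^ 3 * E"
  proof -
    have "\<bar>\<kappa>\<^sup>2 / 6 * (trace X)\<^sup>2 * e22 p\<bar> = (trace X)\<^sup>2 / 6 * (\<kappa>\<^sup>2 * e22 p)"
      using e22_le(1)[of p] by (simp add: abs_mult)
    also have "\<dots> \<le> (36 * r ^ 3) / 6 * (\<kappa>\<^sup>2 * N\<^sup>2)"
      using tr2 e22_le[of p] r0 by (intro mult_mono divide_right_mono) (auto simp: N_def)
    also have "\<dots> \<le> (36 * r ^ 3) / 6 * (8 * E)"
      using N2 r0 by (intro mult_left_mono) auto
    finally show ?thesis by simp
  qed
  moreover have "0 \<le> r ^ 3 * E" using r0 by (simp add: E_def)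
  ultimately show ?thesis
    unfolding avg_taylor[OF X det] r_def[symmetric] N_def[symmetric] E_def[symmetric]
    by (simp only: abs_le_iff) linarith
qed

section \<open>Stability under volume-preserving deformations\<close>

definition strain :: "real^3^3 \<Rightarrow> real^3^3" where
  "strain S = transpose S ** S - mat 1"

lemma transpose_strain [simp]: "transpose (strain S) = strain S"
  by (simp add: strain_def vec_eq_iff transpose_def matrix_matrix_mult_def mat_def mult.commute)

lemma theta_image:
  assumes "det S \<noteq> 0"
  shows "theta ((*v) S ` \<Lambda>) \<alpha> = gsum (pi * \<alpha>) \<Lambda> (\<lambda>p. exp (- (pi * \<alpha>) * quad (strain S) p))"
proof -
  have "inj ((*v) S)" using assms by (simp add: inj_matrix_vector_mult invertible_det_nz)
  then have "theta ((*v) S ` \<Lambda>) \<alpha> = (\<Sum>\<^sub>\<infinity>p\<in>\<Lambda>. exp (- pi * \<alpha> * (norm (S *v p))\<^sup>2))"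
    unfolding theta_def by (subst infsum_reindex) (auto simp: o_def intro: inj_on_subset)
  moreover have "(norm (S *v p))\<^sup>2 = (norm p)\<^sup>2 + quad (strain S) p" for p
    unfolding quad_def strain_def
    by (simp add: power2_norm_eq_inner matrix_vector_mul_assoc[symmetric] dot_lmul_matrix[symmetric]
       inner_commute transpose_matrix_vector inner_diff_right matrix_vector_mult_diff_rdistrib)
  ultimately show ?thesis
    by (simp add: gsum_def mult_exp_exp algebra_simps)
qed

lemma theta_eq_gsum: "theta \<Lambda> \<alpha> = gsum (pi * \<alpha>) \<Lambda> (\<lambda>p. 1)"
  by (simp add: theta_def gsum_def)

lemma tame_diag_poly: "\<kappa> > 0 \<Longrightarrow> tame \<kappa> (diag_poly \<kappa>)"
proof -
  assume \<kappa>: "\<kappa> > 0"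
  have "\<bar>(p $ 1) ^ 4 + (p $ 2) ^ 4 + (p $ 3) ^ 4 - e22 p\<bar> \<le> 1 * norm p ^ (2 * 2)" for p :: "real^3"
  proof -
    have "norm p ^ (2 * 2) = ((norm p)\<^sup>2)\<^sup>2" by (simp add: power_mult[symmetric])
    also have "\<dots> = (p $ 1) ^ 4 + (p $ 2) ^ 4 + (p $ 3) ^ 4 + 2 * e22 p"
      unfolding norm3 e22_def by (simp add: power4_eq_xxxx power2_eq_square algebra_simps)
    finally show ?thesis
      using e22_le[of p] zero_le_even_power[of 4 "p $ 1"] zero_le_even_power[of 4 "p $ 2"] zero_le_even_power[of 4 "p $ 3"]
      by (auto simp: abs_le_iff)
  qed
  then show ?thesis
    unfolding diag_poly_eq[abs_def] using \<kappa>
    by (intro tame_diff[OF tame_cmult[OF tame_poly[where B = 1 and n = 2]] tame_poly[where B = 1 and n = 1]]) auto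
qed

lemma tame_off_poly: "\<kappa> > 0 \<Longrightarrow> tame \<kappa> (off_poly \<kappa>)"
proof -
  assume \<kappa>: "\<kappa> > 0"
  have "\<bar>e22 p\<bar> \<le> 1 * norm p ^ (2 * 2)" for p :: "real^3"
    using e22_le[of p] by (simp add: power_mult[symmetric])
  then show ?thesis
    unfolding off_poly_def[abs_def] using \<kappa>
    by (intro tame_diff[OF tame_cmult[OF tame_poly[where B = 1 and n = 2]] tame_poly[where B = 1 and n = 1]]) auto
qed

lemma tame_const: "\<kappa> > 0 \<Longrightarrow> tame \<kappa> (\<lambda>p. c)"
  by (rule tameI[where C = "\<bar>c\<bar>" and \<delta> = 0]) auto

definition diag_coeff :: "real \<Rightarrow> (real^3) set \<Rightarrow> real" where
  "diag_coeff \<alpha> \<Lambda> = gsum (pi * \<alpha>) \<Lambda> (diag_poly (pi * \<alpha>))"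

definition off_coeff :: "real \<Rightarrow> (real^3) set \<Rightarrow> real" where
  "off_coeff \<alpha> \<Lambda> = gsum (pi * \<alpha>) \<Lambda> (off_poly (pi * \<alpha>))"

text \<open>
  Summation of the pointwise expansion against the Gaussian weight.
\<close>

theorem second_variation:
  assumes \<Lambda>: "cubic \<Lambda>" "gauss_summable \<Lambda>" and \<alpha>: "\<alpha> > 0" and S: "det S = 1" and r: "norm (strain S) \<le> 1 / 4"
  defines "\<kappa> \<equiv> pi * \<alpha>"
  shows "\<bar>theta ((*v) S ` \<Lambda>) \<alpha> - theta \<Lambda> \<alpha>
      - (\<kappa> / 6 * diag_sq (strain S) * diag_coeff \<alpha> \<Lambda> + \<kappa> / 3 * off_sq (strain S) * off_coeff \<alpha> \<Lambda>)\<bar>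
    \<le> 1000 * gsum \<kappa> \<Lambda> (\<lambda>p. exp (\<kappa> / 2 * (norm p)\<^sup>2)) * norm (strain S) ^ 3"
proof -
  define X where "X = strain S"
  have \<kappa>: "\<kappa> > 0" using \<alpha> by (simp add: \<kappa>_def)
  have X: "transpose X = X" and det: "det (mat 1 + X) = 1" and rX: "norm X \<le> 1 / 4"
    using r S by (auto simp: X_def) (simp add: strain_def det_mul)
  define F where "F = (\<lambda>p. exp (- \<kappa> * quad X p))"
  define A where "A = cyc_avg (sign_avg F)"
  define m where "m = \<kappa> / 6 * diag_sq X"
  define n where "n = \<kappa> / 3 * off_sq X"
  define R where "R = (\<lambda>p. exp (\<kappa> / 2 * (norm (p :: real^3))\<^sup>2))"
  have F: "tame \<kappa> F"
  proof (rule tameI)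
    fix p
    have "- quad X p \<le> (1 / 4) * (norm p)\<^sup>2"
      using abs_quad_le[of X p] mult_right_mono[OF rX, of "(norm p)\<^sup>2"] by simp
    then have "\<kappa> * (- quad X p) \<le> \<kappa> * ((1 / 4) * (norm p)\<^sup>2)" using \<kappa> by (intro mult_left_mono) auto
    then show "\<bar>F p\<bar> \<le> 1 * exp (\<kappa> / 4 * (norm p)\<^sup>2)" by (simp add: F_def)
  qed (use \<kappa> in auto)
  have A: "tame \<kappa> A" unfolding A_def by (intro tame_cyc_avg tame_sign_avg F)
  have R: "tame \<kappa> R" unfolding R_def by (rule tameI[where C = 1 and \<delta> = "\<kappa> / 2"]) (use \<kappa> in auto)
  define B where "B = (\<lambda>p. 1 + m * diag_poly \<kappa> p + n * off_poly \<kappa> p)"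
  note tames = tame_add tame_diff tame_cmult tame_const tame_diag_poly tame_off_poly
  have B: "tame \<kappa> B" unfolding B_def by (intro tames \<kappa>)
  define c where "c = 1000 * norm X ^ 3"
  have exp: "\<bar>A p - B p\<bar> \<le> c * R p" for p
    using avg_exp_expansion[OF X det \<kappa> rX, of p] by (simp add: A_def B_def F_def R_def m_def n_def c_def)
  have "gsum \<kappa> \<Lambda> A \<le> gsum \<kappa> \<Lambda> (\<lambda>p. B p + c * R p)"
    by (rule gsum_mono) (use exp[unfolded abs_le_iff] \<Lambda> in \<open>auto intro!: tames A B R simp: algebra_simps\<close>)
  moreover have "gsum \<kappa> \<Lambda> (\<lambda>p. B p - c * R p) \<le> gsum \<kappa> \<Lambda> A"
    by (rule gsum_mono) (use exp[unfolded abs_le_iff] \<Lambda> in \<open>auto intro!: tames A B R simp: algebra_simps\<close>)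
  moreover have "gsum \<kappa> \<Lambda> (\<lambda>p. B p + c * R p) = gsum \<kappa> \<Lambda> B + c * gsum \<kappa> \<Lambda> R"
    using \<Lambda> by (simp add: gsum_add gsum_cmult tames B R)
  moreover have "gsum \<kappa> \<Lambda> (\<lambda>p. B p - c * R p) = gsum \<kappa> \<Lambda> B - c * gsum \<kappa> \<Lambda> R"
    using \<Lambda> by (simp add: gsum_diff gsum_cmult tames B R)
  moreover have "gsum \<kappa> \<Lambda> A = theta ((*v) S ` \<Lambda>) \<alpha>"
    using S by (simp add: A_def gsum_avg[OF \<Lambda> F] theta_image) (simp add: F_def X_def \<kappa>_def)
  moreover have "gsum \<kappa> \<Lambda> B = theta \<Lambda> \<alpha> + m * gsum \<kappa> \<Lambda> (diag_poly \<kappa>) + n * gsum \<kappa> \<Lambda> (off_poly \<kappa>)"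
    unfolding B_def theta_eq_gsum \<kappa>_def[symmetric] using \<Lambda> \<kappa> by (simp add: gsum_add gsum_cmult tames)
  ultimately have "\<bar>theta ((*v) S ` \<Lambda>) \<alpha> - theta \<Lambda> \<alpha> - (m * gsum \<kappa> \<Lambda> (diag_poly \<kappa>) + n * gsum \<kappa> \<Lambda> (off_poly \<kappa>))\<bar>
     \<le> c * gsum \<kappa> \<Lambda> R"
    by (simp only: abs_le_iff) linarith
  then show ?thesis
    by (simp add: diag_coeff_def off_coeff_def m_def n_def c_def R_def X_def \<kappa>_def mult.assoc mult.commute mult.left_commute)
qed

definition stable :: "real \<Rightarrow> (real^3) set \<Rightarrow> bool" where
  "stable \<alpha> \<Lambda> \<longleftrightarrow> (\<exists>\<epsilon>>0. \<forall>S. det S = 1 \<and> norm (S - mat 1) < \<epsilon> \<longrightarrow> theta \<Lambda> \<alpha> \<le> theta ((*v) S ` \<Lambda>) \<alpha>)"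

lemma strain_small:
  assumes "\<delta> > 0"
  obtains \<epsilon> where "\<epsilon> > 0" "\<And>S. norm (S - mat 1) < \<epsilon> \<Longrightarrow> norm (strain S) < \<delta>"
proof -
  have "continuous_on UNIV strain"
    unfolding strain_def matrix_matrix_mult_def transpose_def by (intro continuous_intros)
  then have "isCont strain (mat 1)" by (simp add: continuous_on_eq_continuous_at)
  moreover have "strain (mat 1) = 0" by (simp add: strain_def transpose_mat)
  ultimately show ?thesis
    using that assms unfolding continuous_at_eps_delta by (auto simp: dist_norm)
qed

lemma gsum_nonneg: "(\<And>p. p \<in> \<Lambda> \<Longrightarrow> f p \<ge> 0) \<Longrightarrow> gsum \<kappa> \<Lambda> f \<ge> 0"
  unfolding gsum_def by (intro infsum_nonneg) auto

lemma diag_sq_nonneg: "diag_sq X \<ge> 0" and off_sq_nonneg: "off_sq X \<ge> 0"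
  by (auto simp: diag_sq_def off_sq_def)

text \<open>
  The Frobenius norm satisfies \<open>\<bar>X\<bar>\<^sup>2 = s + 2 o\<close>, so that the quadratic part is at least a positive multiple of \<open>\<bar>X\<bar>\<^sup>2\<close>.
\<close>

lemma stableI:
  assumes \<Lambda>: "cubic \<Lambda>" "gauss_summable \<Lambda>" and \<alpha>: "\<alpha> > 0"
    and D: "diag_coeff \<alpha> \<Lambda> > 0" and O: "off_coeff \<alpha> \<Lambda> > 0"
  shows "stable \<alpha> \<Lambda>"
proof -
  define \<kappa> where "\<kappa> = pi * \<alpha>"
  define d where "d = diag_coeff \<alpha> \<Lambda>"
  define f where "f = off_coeff \<alpha> \<Lambda>"
  define K where "K = 1000 * gsum \<kappa> \<Lambda> (\<lambda>p. exp (\<kappa> / 2 * (norm p)\<^sup>2))"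
  define m where "m = \<kappa> / 6 * min d f"
  have \<kappa>: "\<kappa> > 0" and K: "K \<ge> 0" using \<alpha> by (auto simp: \<kappa>_def K_def gsum_nonneg)
  have m: "m > 0" using D O \<kappa> by (simp add: m_def d_def f_def \<kappa>_def)
  define \<delta> where "\<delta> = min (1 / 4) (m / (K + 1))"
  have "\<delta> > 0" using m K by (simp add: \<delta>_def)
  then obtain \<epsilon> where \<epsilon>: "\<epsilon> > 0" "\<And>S. norm (S - mat 1) < \<epsilon> \<Longrightarrow> norm (strain S) < \<delta>"
    using strain_small by blast
  show ?thesis unfolding stable_def
  proof (intro exI[of _ \<epsilon>] conjI allI impI \<epsilon>(1))
    fix S :: "real^3^3" assume S: "det S = 1 \<and> norm (S - mat 1) < \<epsilon>"
    define X where "X = strain S"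
    define r where "r = norm X"
    have r: "0 \<le> r" "r < \<delta>" using \<epsilon>(2) S by (auto simp: X_def r_def)
    have sv: "\<bar>theta ((*v) S ` \<Lambda>) \<alpha> - theta \<Lambda> \<alpha> - (\<kappa> / 6 * diag_sq X * d + \<kappa> / 3 * off_sq X * f)\<bar> \<le> K * r ^ 3"
      using second_variation[OF \<Lambda> \<alpha>, of S] S r(2) by (simp add: \<kappa>_def d_def f_def K_def X_def r_def \<delta>_def)
    have "m * r\<^sup>2 = \<kappa> / 6 * (diag_sq X * min d f) + \<kappa> / 3 * (off_sq X * min d f)"
      using norm_matrix_sq[of X] by (simp add: m_def r_def X_def algebra_simps)
    also have "\<dots> \<le> \<kappa> / 6 * (diag_sq X * d) + \<kappa> / 3 * (off_sq X * f)"
      using \<kappa> diag_sq_nonneg[of X] off_sq_nonneg[of X] by (intro add_mono mult_left_mono) auto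
    finally have 1: "m * r\<^sup>2 \<le> \<kappa> / 6 * diag_sq X * d + \<kappa> / 3 * off_sq X * f" by (simp add: mult.assoc)
    have "(K + 1) * r \<le> m" using r K unfolding \<delta>_def by (simp add: field_simps)
    then have "K * r \<le> m" using r by (simp add: distrib_right)
    then have "(K * r) * r\<^sup>2 \<le> m * r\<^sup>2" by (intro mult_right_mono) auto
    then have "K * r ^ 3 \<le> m * r\<^sup>2" by (simp add: power2_eq_square power3_eq_cube)
    then show "theta \<Lambda> \<alpha> \<le> theta ((*v) S ` \<Lambda>) \<alpha>"
      using sv 1 by (simp only: abs_le_iff) linarith
  qed
qed

lemma theta_less_diagonal:
  assumes \<Lambda>: "cubic \<Lambda>" "gauss_summable \<Lambda>" and \<alpha>: "\<alpha> > 0"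
    and D: "diag_coeff \<alpha> \<Lambda> < 0"
  obtains \<epsilon> where "\<epsilon> > 0" "\<And>S. det S = 1 \<Longrightarrow> norm (S - mat 1) < \<epsilon> \<Longrightarrow> off_sq (strain S) = 0 \<Longrightarrow> strain S \<noteq> 0 \<Longrightarrow>
      theta ((*v) S ` \<Lambda>) \<alpha> < theta \<Lambda> \<alpha>"
proof -
  define \<kappa> where "\<kappa> = pi * \<alpha>"
  define d where "d = diag_coeff \<alpha> \<Lambda>"
  define K where "K = 1000 * gsum \<kappa> \<Lambda> (\<lambda>p. exp (\<kappa> / 2 * (norm p)\<^sup>2))"
  have \<kappa>: "\<kappa> > 0" and K: "K \<ge> 0" using \<alpha> by (auto simp: \<kappa>_def K_def gsum_nonneg)
  define m where "m = \<kappa> / 6 * (- d)"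
  have m: "m > 0" using D \<kappa> by (auto simp: m_def d_def \<kappa>_def mult_neg_pos mult_pos_neg)
  define \<delta> where "\<delta> = min (1 / 4) (m / (K + 1))"
  have "\<delta> > 0" using m K by (simp add: \<delta>_def)
  then obtain \<epsilon> where \<epsilon>: "\<epsilon> > 0" "\<And>S. norm (S - mat 1) < \<epsilon> \<Longrightarrow> norm (strain S) < \<delta>"
    using strain_small by blast
  show ?thesis
  proof (rule that[OF \<epsilon>(1)])
    fix S :: "real^3^3" assume S: "det S = 1" "norm (S - mat 1) < \<epsilon>" and off: "off_sq (strain S) = 0" and X0: "strain S \<noteq> 0"
    define r where "r = norm (strain S)"
    have r: "0 < r" "r < \<delta>" using \<epsilon>(2) S X0 by (auto simp: r_def)
    have "r\<^sup>2 = diag_sq (strain S)" using norm_matrix_sq[of "strain S"] off by (simp add: r_def)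
    then have sv: "\<bar>theta ((*v) S ` \<Lambda>) \<alpha> - theta \<Lambda> \<alpha> + m * r\<^sup>2\<bar> \<le> K * r ^ 3"
      using second_variation[OF \<Lambda> \<alpha>, of S] S r(2) off
      by (simp add: \<kappa>_def d_def m_def K_def r_def \<delta>_def algebra_simps)
    have "(K + 1) * r < m" using r K unfolding \<delta>_def by (simp add: field_simps)
    then have "K * r < m" using r by (simp add: distrib_right)
    then have "(K * r) * r\<^sup>2 < m * r\<^sup>2" using r by (intro mult_strict_right_mono) auto
    then have "K * r ^ 3 < m * r\<^sup>2" by (simp add: power2_eq_square power3_eq_cube)
    then show "theta ((*v) S ` \<Lambda>) \<alpha> < theta \<Lambda> \<alpha>"
      using sv by (simp only: abs_le_iff) linarith
  qed
qed

definition shear :: "3 \<Rightarrow> 3 \<Rightarrow> real \<Rightarrow> real^3^3" where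
  "shear i j t = mat 1 + t *\<^sub>R (\<chi> k l. if k = i \<and> l = j then 1 else 0)"

lemma shear_nth: "shear i j t $ k $ l = (if k = l then 1 else 0) + (if k = i \<and> l = j then t else 0)"
  by (simp add: shear_def mat_def)

lemma det_shear: "i \<noteq> j \<Longrightarrow> det (shear i j t) = 1"
  using exhaust_3[of i] exhaust_3[of j] by (auto simp: det_3 shear_nth)

lemma strain_shear:
  assumes "i \<noteq> j"
  shows "diag_sq (strain (shear i j t)) = t ^ 4" "off_sq (strain (shear i j t)) = t\<^sup>2"
  using assms exhaust_3[of i] exhaust_3[of j]
  by (auto simp: diag_sq_def off_sq_def strain_def matrix_matrix_mult_def transpose_def sum_3 shear_nth mat_def
      power4_eq_xxxx power2_eq_square)

text \<open>
  The strain of a shear has its squared off-diagonal entry of order \<open>t\<^sup>2\<close> and its diagonal square only of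
  order \<open>t\<^sup>4\<close>, so the off-diagonal coefficient decides.
\<close>

lemma theta_le_shear:
  assumes \<Lambda>: "cubic \<Lambda>" "gauss_summable \<Lambda>" and \<alpha>: "\<alpha> > 0"
    and O: "off_coeff \<alpha> \<Lambda> > 0" and ij: "i \<noteq> j"
  shows "\<forall>\<^sub>F t in nhds 0. theta \<Lambda> \<alpha> \<le> theta ((*v) (shear i j t) ` \<Lambda>) \<alpha>"
proof -
  define \<kappa> where "\<kappa> = pi * \<alpha>"
  define d where "d = diag_coeff \<alpha> \<Lambda>"
  define f where "f = off_coeff \<alpha> \<Lambda>"
  define K where "K = 1000 * gsum \<kappa> \<Lambda> (\<lambda>p. exp (\<kappa> / 2 * (norm p)\<^sup>2))"
  have \<kappa>: "\<kappa> > 0" and K: "K \<ge> 0" using \<alpha> by (auto simp: \<kappa>_def K_def gsum_nonneg)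
  have f: "f > 0" using O by (simp add: f_def \<kappa>_def)
  \<comment> \<open>The shear strain has norm at most \<open>2 \<bar>t\<bar>\<close>, whence the factor \<open>8\<close> in front of the cubic error.\<close>
  define L where "L = \<kappa> / 6 * \<bar>d\<bar> + 8 * K + 1"
  have L: "L > 0" using \<kappa> K by (auto simp: L_def intro!: add_nonneg_pos add_nonneg_nonneg)
  define \<delta> where "\<delta> = min (1 / 8) (\<kappa> / 3 * f / L)"
  have \<delta>: "\<delta> > 0" using \<kappa> f L by (simp add: \<delta>_def)
  have "theta \<Lambda> \<alpha> \<le> theta ((*v) (shear i j t) ` \<Lambda>) \<alpha>" if t: "\<bar>t\<bar> < \<delta>" for t
  proof -
    define S where "S = shear i j t"
    define s where "s = \<bar>t\<bar>"
    define r where "r = norm (strain S)"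
    have s: "0 \<le> s" "s \<le> 1 / 8" "s \<le> \<kappa> / 3 * f / L" using t by (auto simp: s_def \<delta>_def)
    have st: "t\<^sup>2 = s\<^sup>2" "t ^ 4 = s ^ 4" by (auto simp: s_def)
    have "s\<^sup>2 \<le> 1" using s by (simp add: power_le_one)
    then have s4: "s ^ 4 \<le> s\<^sup>2" using mult_left_mono[of "s\<^sup>2" 1 "s\<^sup>2"] by (simp add: power2_eq_square power4_eq_xxxx)
    have s43: "s ^ 4 \<le> s ^ 3" using mult_left_mono[of "s" 1 "s ^ 3"] s by (simp add: power3_eq_cube power4_eq_xxxx)
    have "r\<^sup>2 = s ^ 4 + 2 * s\<^sup>2"
      using norm_matrix_sq[of "strain S"] ij by (simp add: r_def S_def strain_shear st)
    also have "\<dots> \<le> 4 * s\<^sup>2" using s4 zero_le_power2[of s] by linarith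
    also have "\<dots> = (2 * s)\<^sup>2" by (simp add: power_mult_distrib)
    finally have r: "r \<le> 2 * s" using s by (intro power2_le_imp_le[of r "2 * s"]) auto
    have r0: "0 \<le> r" by (simp add: r_def)
    have sv: "\<bar>theta ((*v) S ` \<Lambda>) \<alpha> - theta \<Lambda> \<alpha> - (\<kappa> / 6 * s ^ 4 * d + \<kappa> / 3 * s\<^sup>2 * f)\<bar> \<le> K * r ^ 3"
      using second_variation[OF \<Lambda> \<alpha>, of S] r s ij
      by (simp add: \<kappa>_def d_def f_def K_def r_def S_def det_shear strain_shear st)
    have "K * r ^ 3 \<le> K * (2 * s) ^ 3" using r r0 K by (intro mult_left_mono power_mono) auto
    also have "\<dots> = 8 * K * s ^ 3" by (simp add: power_mult_distrib)
    finally have 1: "K * r ^ 3 \<le> 8 * K * s ^ 3" .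
    have "\<kappa> / 6 * s ^ 4 * (- d) \<le> \<kappa> / 6 * s ^ 4 * \<bar>d\<bar>"
      using \<kappa> s by (intro mult_left_mono) auto
    also have "\<dots> \<le> \<kappa> / 6 * s ^ 3 * \<bar>d\<bar>"
      using s43 \<kappa> by (intro mult_right_mono mult_left_mono) auto
    finally have "\<kappa> / 6 * s ^ 4 * (- d) \<le> \<kappa> / 6 * s ^ 3 * \<bar>d\<bar>" .
    then have 2: "- (\<kappa> / 6 * \<bar>d\<bar> * s ^ 3) \<le> \<kappa> / 6 * s ^ 4 * d" by (simp add: algebra_simps)
    have "L * s \<le> \<kappa> / 3 * f" using s(3) L by (simp add: field_simps)
    then have "(L * s) * s\<^sup>2 \<le> (\<kappa> / 3 * f) * s\<^sup>2" by (intro mult_right_mono) auto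
    then have "\<kappa> / 6 * \<bar>d\<bar> * s ^ 3 + 8 * K * s ^ 3 + s ^ 3 \<le> \<kappa> / 3 * s\<^sup>2 * f"
      by (simp add: L_def power2_eq_square power3_eq_cube algebra_simps)
    moreover have "s ^ 3 \<ge> 0" using s by simp
    ultimately show ?thesis
      using sv 1 2 unfolding S_def[symmetric] by (simp only: abs_le_iff) linarith
  qed
  then show ?thesis
    unfolding eventually_nhds_metric using \<delta> by (intro exI[of _ \<delta>]) (auto simp: dist_norm)
qed

section \<open>Integer grids\<close>

definition grid :: "real \<Rightarrow> (int \<times> int \<times> int) set \<Rightarrow> (real^3) set" where
  "grid c P = (\<lambda>n. c *\<^sub>R vec3 n) ` P"

definition sqn :: "int \<times> int \<times> int \<Rightarrow> real" where
  "sqn = (\<lambda>(i, j, k). (of_int i)\<^sup>2 + (of_int j)\<^sup>2 + (of_int k)\<^sup>2)"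

lemma norm_grid: "(norm (c *\<^sub>R vec3 n))\<^sup>2 = c\<^sup>2 * sqn n"
  by (cases n) (simp add: norm3 vec3_def sqn_def power_mult_distrib algebra_simps)

lemma inj_grid: "c \<noteq> 0 \<Longrightarrow> inj (\<lambda>n. c *\<^sub>R vec3 n)"
  by (auto simp: inj_def vec3_def vec_eq_iff forall_3)

lemma sqn_summable: "\<kappa> > 0 \<Longrightarrow> (\<lambda>n. exp (- \<kappa> * sqn n)) summable_on P"
  using summable_on_int_triple[of \<kappa>]
  by (intro summable_on_subset_banach[of _ UNIV P]) (auto simp: sqn_def case_prod_unfold)

lemma gauss_summable_grid:
  assumes "c \<noteq> 0" shows "gauss_summable (grid c P)"
  unfolding gauss_summable_def grid_def
proof (intro allI impI)
  fix \<beta> :: real assume "\<beta> > 0"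
  then have "(\<lambda>n. exp (- (\<beta> * c\<^sup>2) * sqn n)) summable_on P"
    using assms by (intro sqn_summable) auto
  then show "(\<lambda>p. exp (- \<beta> * (norm p)\<^sup>2)) summable_on (\<lambda>n. c *\<^sub>R vec3 n) ` P"
    using inj_on_subset[OF inj_grid[OF assms], of P]
    by (subst summable_on_reindex) (auto simp: o_def norm_grid mult.assoc simp del: norm_scaleR)
qed

lemma cubic_grid:
  assumes "\<And>i j k. (i, j, k) \<in> P \<Longrightarrow> (- i, j, k) \<in> P \<and> (i, - j, k) \<in> P \<and> (i, j, - k) \<in> P \<and> (j, k, i) \<in> P"
  shows "cubic (grid c P)"
  unfolding cubic_def
proof (intro conjI allI ballI)
  fix p assume "p \<in> grid c P"
  then obtain i j k where n: "(i, j, k) \<in> P" and p: "p = c *\<^sub>R vec3 (i, j, k)" by (auto simp: grid_def)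
  have "cyc p = c *\<^sub>R vec3 (j, k, i)" by (simp add: p vec3_def vec_eq_iff forall_3)
  then show "cyc p \<in> grid c P" using assms[OF n] by (auto simp: grid_def)
  fix l :: 3
  have "flip 1 p = c *\<^sub>R vec3 (- i, j, k)" "flip 2 p = c *\<^sub>R vec3 (i, - j, k)" "flip 3 p = c *\<^sub>R vec3 (i, j, - k)"
    by (simp_all add: p vec3_def vec_eq_iff forall_3)
  then show "flip l p \<in> grid c P" using assms[OF n] exhaust_3[of l] by (auto simp: grid_def)
qed

definition dsq :: "int \<times> int \<times> int \<Rightarrow> int" where
  "dsq = (\<lambda>(i, j, k). (i\<^sup>2 - j\<^sup>2)\<^sup>2 + (j\<^sup>2 - k\<^sup>2)\<^sup>2 + (k\<^sup>2 - i\<^sup>2)\<^sup>2)"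

definition esq :: "int \<times> int \<times> int \<Rightarrow> int" where
  "esq = (\<lambda>(i, j, k). i\<^sup>2 * j\<^sup>2 + j\<^sup>2 * k\<^sup>2 + k\<^sup>2 * i\<^sup>2)"

definition diag_term :: "real \<Rightarrow> int \<times> int \<times> int \<Rightarrow> real" where
  "diag_term K n = exp (- K * sqn n) * (K * of_int (dsq n) / 2 - sqn n)"

definition off_term :: "real \<Rightarrow> int \<times> int \<times> int \<Rightarrow> real" where
  "off_term K n = exp (- K * sqn n) * (2 * K * of_int (esq n) - sqn n)"

lemma diag_poly_grid: "diag_poly \<kappa> (c *\<^sub>R vec3 n) = c\<^sup>2 * (\<kappa> * c\<^sup>2 * of_int (dsq n) / 2 - sqn n)"
  unfolding diag_poly_def norm_grid
  by (cases n) (simp add: dsq_def sqn_def vec3_def power2_eq_square field_simps)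

lemma off_poly_grid: "off_poly \<kappa> (c *\<^sub>R vec3 n) = c\<^sup>2 * (2 * (\<kappa> * c\<^sup>2) * of_int (esq n) - sqn n)"
  unfolding off_poly_def norm_grid e22_def
  by (cases n) (simp add: esq_def sqn_def vec3_def power2_eq_square algebra_simps)

lemma gsum_grid:
  assumes "c \<noteq> 0"
  shows "gsum \<kappa> (grid c P) f = (\<Sum>\<^sub>\<infinity>n\<in>P. exp (- (\<kappa> * c\<^sup>2) * sqn n) * f (c *\<^sub>R vec3 n))"
  unfolding gsum_def grid_def
  using inj_on_subset[OF inj_grid[OF assms], of P]
  by (subst infsum_reindex) (auto simp: o_def norm_grid mult.assoc simp del: norm_scaleR)

lemma gsum_diag_grid:
  assumes "c \<noteq> 0"
  shows "gsum \<kappa> (grid c P) (diag_poly \<kappa>) = c\<^sup>2 * infsum (diag_term (\<kappa> * c\<^sup>2)) P"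
  unfolding gsum_grid[OF assms] diag_poly_grid diag_term_def
  by (subst infsum_cmult_right'[symmetric]) (simp add: mult.left_commute)

lemma gsum_off_grid:
  assumes "c \<noteq> 0"
  shows "gsum \<kappa> (grid c P) (off_poly \<kappa>) = c\<^sup>2 * infsum (off_term (\<kappa> * c\<^sup>2)) P"
  unfolding gsum_grid[OF assms] off_poly_grid off_term_def
  by (subst infsum_cmult_right'[symmetric]) (simp add: mult.left_commute)

lemma tame_summable_grid:
  assumes c: "c \<noteq> 0" and f: "tame \<kappa> f"
  shows "(\<lambda>n. exp (- (\<kappa> * c\<^sup>2) * sqn n) * f (c *\<^sub>R vec3 n)) summable_on P"
  using gsum_summable[OF gauss_summable_grid[OF c, of P] f] inj_on_subset[OF inj_grid[OF c], of P]
  unfolding grid_def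
  by (subst (asm) summable_on_reindex) (auto simp: o_def norm_grid mult.assoc simp del: norm_scaleR)

lemma diag_term_summable: "K > 0 \<Longrightarrow> diag_term K summable_on P"
  using tame_summable_grid[of 1 K "diag_poly K" P, OF _ tame_diag_poly] diag_poly_grid[of K 1]
  by (simp add: diag_term_def[abs_def])

lemma off_term_summable: "K > 0 \<Longrightarrow> off_term K summable_on P"
  using tame_summable_grid[of 1 K "off_poly K" P, OF _ tame_off_poly] off_poly_grid[of K 1]
  by (simp add: off_term_def[abs_def])

lemma infsum_nonneg_pairing:
  fixes g :: "'a \<Rightarrow> real"
  assumes g: "g summable_on A" and D: "D \<subseteq> A" and \<psi>: "inj_on \<psi> D" "\<psi> ` D \<subseteq> A - D"
    and pos: "\<And>x. x \<in> A - D \<Longrightarrow> g x \<ge> 0" and pair: "\<And>x. x \<in> D \<Longrightarrow> g (\<psi> x) + g x \<ge> 0"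
  shows "infsum g A \<ge> 0"
proof -
  have sub: "g summable_on B" if "B \<subseteq> A" for B
    using g that by (rule summable_on_subset_banach)
  let ?R = "A - D - \<psi> ` D"
  have A: "A = ?R \<union> (\<psi> ` D \<union> D)" using D \<psi> by blast
  have "infsum g A = infsum g ?R + infsum g (\<psi> ` D \<union> D)"
    by (subst A, rule infsum_Un_disjoint) (use D \<psi> in \<open>auto intro!: sub\<close>)
  also have "infsum g (\<psi> ` D \<union> D) = infsum g (\<psi> ` D) + infsum g D"
    by (rule infsum_Un_disjoint) (use D \<psi> in \<open>auto intro!: sub\<close>)
  also have "infsum g (\<psi> ` D) = infsum (\<lambda>x. g (\<psi> x)) D"
    using infsum_reindex[OF \<psi>(1), of g] by (simp add: o_def)
  also have "infsum (\<lambda>x. g (\<psi> x)) D + infsum g D = infsum (\<lambda>x. g (\<psi> x) + g x) D"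
    using summable_on_reindex[OF \<psi>(1), of g] D \<psi>(2)
    by (intro infsum_add[symmetric] sub) (auto simp: o_def intro!: sub)
  also have "infsum g ?R + \<dots> \<ge> 0"
    using pos pair by (intro add_nonneg_nonneg[OF infsum_nonneg infsum_nonneg]) auto
  finally show ?thesis .
qed

lemma infsum_finite_part:
  fixes g :: "'a \<Rightarrow> real"
  assumes "g summable_on A" "finite F" "F \<subseteq> A"
  shows "infsum g A = sum g F + infsum g (A - F)"
proof -
  have "infsum g (F \<union> (A - F)) = infsum g F + infsum g (A - F)"
    using assms by (intro infsum_Un_disjoint) (auto intro: summable_on_subset_banach)
  then show ?thesis using assms by (simp add: Un_absorb1)
qed

section \<open>The signs for FCC\<close>

definition fcc_set :: "(int \<times> int \<times> int) set" where
  "fcc_set = {(i, j, k). even (i + j + k)}"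

definition bcc_set :: "(int \<times> int \<times> int) set" where
  "bcc_set = {(i, j, k). (even i \<longleftrightarrow> even j) \<and> (even j \<longleftrightarrow> even k)}"

text \<open>
  Since \<open>z \<le> x - 1\<close>, the difference \<open>x\<^sup>2 - z\<^sup>2\<close> is at least \<open>2 x - 1\<close>, whose square is large enough compared with
  \<open>x\<^sup>2\<close> as soon as \<open>x \<ge> 2\<close>.
\<close>

lemma sorted_sq_diffs:
  fixes x y z :: int
  assumes xyz: "x \<ge> y" "y \<ge> z" "z \<ge> 0" and ne: "\<not> (x = y \<and> y = z)" and two: "x \<ge> 2 \<or> y \<ge> 2 \<or> z \<ge> 2"
  shows "15 * ((x\<^sup>2 - y\<^sup>2)\<^sup>2 + (y\<^sup>2 - z\<^sup>2)\<^sup>2 + (z\<^sup>2 - x\<^sup>2)\<^sup>2) \<ge> 16 * (x\<^sup>2 + y\<^sup>2 + z\<^sup>2)"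
proof -
  have "x > z" "x \<ge> 2" using xyz ne two by auto
  note assms = xyz this
  have y: "y\<^sup>2 \<le> x\<^sup>2" "z\<^sup>2 \<le> x\<^sup>2" using assms by (auto intro!: power_mono)
  have "z\<^sup>2 \<le> (x - 1)\<^sup>2" using assms by (intro power_mono) auto
  then have "2 * x - 1 \<le> x\<^sup>2 - z\<^sup>2" by (simp add: power2_eq_square algebra_simps)
  then have "(2 * x - 1)\<^sup>2 \<le> (x\<^sup>2 - z\<^sup>2)\<^sup>2" using assms by (intro power_mono) auto
  moreover have "(x\<^sup>2 - z\<^sup>2)\<^sup>2 \<le> 2 * (x\<^sup>2 - y\<^sup>2)\<^sup>2 + 2 * (y\<^sup>2 - z\<^sup>2)\<^sup>2"
    using zero_le_power2[of "(x\<^sup>2 - y\<^sup>2) - (y\<^sup>2 - z\<^sup>2)"] by (simp add: power2_eq_square algebra_simps)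
  moreover have "(z\<^sup>2 - x\<^sup>2)\<^sup>2 = (x\<^sup>2 - z\<^sup>2)\<^sup>2" by (simp add: power2_commute)
  moreover have "32 * x\<^sup>2 \<le> 15 * (2 * x - 1)\<^sup>2"
  proof -
    have "0 \<le> (x - 2)\<^sup>2" by simp
    then show ?thesis using assms by (simp add: power2_eq_square algebra_simps)
  qed
  moreover have "16 * (X + Y + Z) \<le> 15 * (A + B + C')"
    if "P \<le> C" "C \<le> 2 * A + 2 * B" "C' = C" "32 * X \<le> 15 * P" "Y \<le> X" "Z \<le> X" for X Y Z A B C C' P :: int
  proof -
    have "96 * X \<le> 45 * C" using that by linarith
    moreover have "15 * C \<le> 30 * A + 30 * B" using that by simp
    ultimately have "96 * X \<le> 30 * A + 30 * B + 30 * C" by simp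
    moreover have "16 * (X + Y + Z) \<le> 48 * X" using that by simp
    ultimately have "2 * (16 * (X + Y + Z)) \<le> 2 * (15 * (A + B + C'))" using that(3) by simp
    then show ?thesis by simp
  qed
  ultimately show ?thesis using y by blast
qed

text \<open>
  Outside the coordinate diagonals \<open>\<bar>i\<bar> = \<bar>j\<bar> = \<bar>k\<bar>\<close> and the shortest shell every term of the diagonal sum is nonnegative for
  \<open>K \<ge> 15 / 8\<close>.
\<close>

lemma dsq_ge:
  assumes n: "(i, j, k) \<in> fcc_set" and ne: "\<not> (\<bar>i\<bar> = \<bar>j\<bar> \<and> \<bar>j\<bar> = \<bar>k\<bar>)" and N: "sqn (i, j, k) \<noteq> 2"
  shows "15 * of_int (dsq (i, j, k)) / 16 \<ge> sqn (i, j, k)"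
proof -
  have sq: "x * x = 1" if "\<bar>x\<bar> = 1" for x :: int using that by (auto simp: abs_if split: if_splits)
  define x y z where "x = \<bar>i\<bar>" and "y = \<bar>j\<bar>" and "z = \<bar>k\<bar>"
  have nn: "x \<ge> 0" "y \<ge> 0" "z \<ge> 0" by (auto simp: x_def y_def z_def)
  have s: "i\<^sup>2 = x\<^sup>2" "j\<^sup>2 = y\<^sup>2" "k\<^sup>2 = z\<^sup>2" by (auto simp: x_def y_def z_def)
  have ev: "even (x + y + z)" using n by (simp add: fcc_set_def x_def y_def z_def)
  have N': "x\<^sup>2 + y\<^sup>2 + z\<^sup>2 \<noteq> 2"
  proof
    assume "x\<^sup>2 + y\<^sup>2 + z\<^sup>2 = 2"
    then have "real_of_int (i\<^sup>2 + j\<^sup>2 + k\<^sup>2) = 2" unfolding s by simp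
    then show False using N by (simp add: sqn_def)
  qed
  have two: "x \<ge> 2 \<or> y \<ge> 2 \<or> z \<ge> 2"
  proof (rule ccontr)
    assume "\<not> ?thesis"
    then have "x = 0 \<or> x = 1" "y = 0 \<or> y = 1" "z = 0 \<or> z = 1" using nn by auto
    then show False using ev N' ne by (auto simp: x_def[symmetric] y_def[symmetric] z_def[symmetric])
  qed
  have ne': "\<not> (x = y \<and> y = z)" using ne by (simp add: x_def y_def z_def)
  have "15 * ((x\<^sup>2 - y\<^sup>2)\<^sup>2 + (y\<^sup>2 - z\<^sup>2)\<^sup>2 + (z\<^sup>2 - x\<^sup>2)\<^sup>2) \<ge> 16 * (x\<^sup>2 + y\<^sup>2 + z\<^sup>2)"
  proof -
    have c: "(a - b)\<^sup>2 = (b - a)\<^sup>2" for a b :: int by (rule power2_commute)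
    consider "x \<ge> y" "y \<ge> z" | "x \<ge> z" "z \<ge> y" | "y \<ge> x" "x \<ge> z" | "y \<ge> z" "z \<ge> x" | "z \<ge> x" "x \<ge> y" | "z \<ge> y" "y \<ge> x"
      by linarith
    then show ?thesis
    proof cases
      case 1
      then have "16 * (x\<^sup>2 + y\<^sup>2 + z\<^sup>2) \<le> 15 * ((x\<^sup>2 - y\<^sup>2)\<^sup>2 + (y\<^sup>2 - z\<^sup>2)\<^sup>2 + (z\<^sup>2 - x\<^sup>2)\<^sup>2)"
        using nn two ne' by (intro sorted_sq_diffs) auto
      then show ?thesis by (simp only: c add_ac)
    next
      case 2
      then have "16 * (x\<^sup>2 + z\<^sup>2 + y\<^sup>2) \<le> 15 * ((x\<^sup>2 - z\<^sup>2)\<^sup>2 + (z\<^sup>2 - y\<^sup>2)\<^sup>2 + (y\<^sup>2 - x\<^sup>2)\<^sup>2)"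
        using nn two ne' by (intro sorted_sq_diffs) auto
      then show ?thesis by (simp only: c add_ac)
    next
      case 3
      then have "16 * (y\<^sup>2 + x\<^sup>2 + z\<^sup>2) \<le> 15 * ((y\<^sup>2 - x\<^sup>2)\<^sup>2 + (x\<^sup>2 - z\<^sup>2)\<^sup>2 + (z\<^sup>2 - y\<^sup>2)\<^sup>2)"
        using nn two ne' by (intro sorted_sq_diffs) auto
      then show ?thesis by (simp only: c add_ac)
    next
      case 4
      then have "16 * (y\<^sup>2 + z\<^sup>2 + x\<^sup>2) \<le> 15 * ((y\<^sup>2 - z\<^sup>2)\<^sup>2 + (z\<^sup>2 - x\<^sup>2)\<^sup>2 + (x\<^sup>2 - y\<^sup>2)\<^sup>2)"
        using nn two ne' by (intro sorted_sq_diffs) auto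
      then show ?thesis by (simp only: c add_ac)
    next
      case 5
      then have "16 * (z\<^sup>2 + x\<^sup>2 + y\<^sup>2) \<le> 15 * ((z\<^sup>2 - x\<^sup>2)\<^sup>2 + (x\<^sup>2 - y\<^sup>2)\<^sup>2 + (y\<^sup>2 - z\<^sup>2)\<^sup>2)"
        using nn two ne' by (intro sorted_sq_diffs) auto
      then show ?thesis by (simp only: c add_ac)
    next
      case 6
      then have "16 * (z\<^sup>2 + y\<^sup>2 + x\<^sup>2) \<le> 15 * ((z\<^sup>2 - y\<^sup>2)\<^sup>2 + (y\<^sup>2 - x\<^sup>2)\<^sup>2 + (x\<^sup>2 - z\<^sup>2)\<^sup>2)"
        using nn two ne' by (intro sorted_sq_diffs) auto
      then show ?thesis by (simp only: c add_ac)
    qed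
  qed
  then have "16 * (i\<^sup>2 + j\<^sup>2 + k\<^sup>2) \<le> 15 * dsq (i, j, k)" by (simp add: dsq_def s)
  then have "real_of_int (16 * (i\<^sup>2 + j\<^sup>2 + k\<^sup>2)) \<le> real_of_int (15 * dsq (i, j, k))" by (simp only: of_int_le_iff)
  then show ?thesis by (simp add: sqn_def)
qed


text \<open>
  The negative terms are those of the diagonal points \<open>(\<plusminus>n, \<plusminus>n, \<plusminus>n)\<close> with \<open>n\<close> even and, if \<open>K < 2\<close>, those of the
  shortest shell \<open>F1\<close>. A diagonal point is paired with one of the closer points of the form \<open>(\<plusminus>n, \<plusminus>n, 0)\<close> or \<open>(\<plusminus>n, 0, \<plusminus>n)\<close>; the
  shell \<open>F1\<close> is compensated by the second shell \<open>F2\<close>.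
\<close>

lemma fcc_diag_pos:
  assumes K: "K \<ge> 15 / 8"
  shows "infsum (diag_term K) fcc_set > 0"
proof -
  define F1 :: "(int \<times> int \<times> int) set" where "F1 = {(1,1,0), (1,-1,0), (-1,1,0), (-1,-1,0), (1,0,1), (1,0,-1), (-1,0,1), (-1,0,-1),
     (0,1,1), (0,1,-1), (0,-1,1), (0,-1,-1)}"
  define F2 :: "(int \<times> int \<times> int) set" where "F2 = {(2,0,0), (-2,0,0), (0,2,0), (0,-2,0), (0,0,2), (0,0,-2)}"
  define D where "D = {(i, j, k). (j = i \<or> j = - i) \<and> (k = i \<or> k = - i) \<and> even i \<and> i \<noteq> (0::int)}"
  define \<psi> :: "int \<times> int \<times> int \<Rightarrow> int \<times> int \<times> int" where "\<psi> = (\<lambda>(i, j, k). if k > 0 then (i, j, 0) else (i, 0, j))"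
  have F: "finite (F1 \<union> F2)" "F1 \<union> F2 \<subseteq> fcc_set" "F1 \<inter> F2 = {}" "finite F1" "finite F2"
    by (auto simp: F1_def F2_def fcc_set_def)
  have s: "diag_term K summable_on P" for P using K by (intro diag_term_summable) auto
  have "infsum (diag_term K) (fcc_set - (F1 \<union> F2)) \<ge> 0"
  proof (rule infsum_nonneg_pairing[where D = D and \<psi> = \<psi>])
    show "D \<subseteq> fcc_set - (F1 \<union> F2)"
      by (auto simp: D_def fcc_set_def F1_def F2_def)
    show "inj_on \<psi> D"
      by (auto simp: inj_on_def D_def \<psi>_def split: if_splits)
    have "\<psi> n \<in> fcc_set - (F1 \<union> F2) - D" if "n \<in> D" for n
    proof -
      obtain i j k where n: "n = (i, j, k)" by (cases n)
      then have *: "j = i \<or> j = - i" "k = i \<or> k = - i" "even i" "i \<noteq> 0" using that by (auto simp: D_def)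
      have "i \<noteq> 1" "i \<noteq> -1" using *(3) by auto
      then show ?thesis using * unfolding n
        by (cases "k > 0") (auto simp: D_def fcc_set_def F1_def F2_def \<psi>_def)
    qed
    then show "\<psi> ` D \<subseteq> fcc_set - (F1 \<union> F2) - D" by blast
    show "diag_term K n \<ge> 0" if n: "n \<in> fcc_set - (F1 \<union> F2) - D" for n
    proof (cases n)
      case (fields i j k)
      show ?thesis
      proof (cases "\<bar>i\<bar> = \<bar>j\<bar> \<and> \<bar>j\<bar> = \<bar>k\<bar>")
        case True
        then have jk: "j = i \<or> j = - i" "k = i \<or> k = - i" by (auto simp: abs_eq_iff)
        have "even i" using n jk fields by (auto simp: fcc_set_def)
        then have "i = 0" using n jk fields by (auto simp: D_def)
        then show ?thesis using jk fields by (auto simp: diag_term_def sqn_def dsq_def)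
      next
        case False
        have "sqn (i, j, k) \<noteq> 2"
        proof
          assume "sqn (i, j, k) = 2"
          then have "real_of_int (i\<^sup>2 + j\<^sup>2 + k\<^sup>2) = real_of_int 2" by (simp add: sqn_def)
          then have 2: "i\<^sup>2 + j\<^sup>2 + k\<^sup>2 = 2" by (simp only: of_int_eq_iff)
          have bd: "\<bar>x\<bar> \<le> 1" if "x\<^sup>2 \<le> 2" for x :: int
          proof (rule ccontr)
            assume "\<not> ?thesis"
            then have "2\<^sup>2 \<le> \<bar>x\<bar>\<^sup>2" by (intro power_mono) auto
            then show False using that by simp
          qed
          have "i\<^sup>2 \<le> 2" "j\<^sup>2 \<le> 2" "k\<^sup>2 \<le> 2"
            using 2 zero_le_power2[of i] zero_le_power2[of j] zero_le_power2[of k] by linarith+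
          then have "\<bar>i\<bar> \<le> 1" "\<bar>j\<bar> \<le> 1" "\<bar>k\<bar> \<le> 1" by (intro bd; simp)+
          then have "i = -1 \<or> i = 0 \<or> i = 1" "j = -1 \<or> j = 0 \<or> j = 1" "k = -1 \<or> k = 0 \<or> k = 1" by auto
          then have "(i, j, k) \<in> F1" using 2 by (elim disjE) (simp_all add: F1_def)
          then show False using n fields by simp
        qed
        then have "sqn n \<le> 15 / 8 * of_int (dsq n) / 2"
          using dsq_ge[of i j k] n False fields by auto
        also have "\<dots> \<le> K * of_int (dsq n) / 2"
          using K by (intro divide_right_mono mult_right_mono) (auto simp: dsq_def split: prod.splits)
        finally show ?thesis by (simp add: diag_term_def)
      qed
    qed
    show "diag_term K (\<psi> n) + diag_term K n \<ge> 0" if n: "n \<in> D" for n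
    proof -
      obtain i j k where n': "n = (i, j, k)" by (cases n)
      define m :: real where "m = (of_int i)\<^sup>2"
      have j: "j\<^sup>2 = i\<^sup>2" "k\<^sup>2 = i\<^sup>2" using n by (auto simp: n' D_def)
      then have rj: "(real_of_int j)\<^sup>2 = m" "(real_of_int k)\<^sup>2 = m" by (metis m_def of_int_power)+
      have m: "m \<ge> 4"
      proof -
        obtain t where t: "i = 2 * t" "t \<noteq> 0" using n by (auto simp: n' D_def elim!: evenE)
        then have "t\<^sup>2 \<ge> 1" by (metis int_one_le_iff_zero_less zero_less_power2)
        then have "(real_of_int t)\<^sup>2 \<ge> 1" by (metis of_int_1_le_iff of_int_power)
        then show ?thesis by (simp add: m_def t power_mult_distrib)
      qed
      have sn: "sqn n = 3 * m" "dsq n = 0" using j rj by (auto simp: n' sqn_def dsq_def m_def)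
      have p: "sqn (\<psi> n) = 2 * m" "real_of_int (dsq (\<psi> n)) = 2 * m\<^sup>2"
        using j rj by (auto simp: n' sqn_def dsq_def m_def \<psi>_def power2_eq_square)
      have "15 / 8 * 4 \<le> K * m" using K m by (intro mult_mono) auto
      then have "5 * m \<le> (K * m - 2) * m" using m by (intro mult_right_mono) auto
      then have Km: "3 * m \<le> K * (2 * m\<^sup>2) / 2 - 2 * m" using m by (simp add: power2_eq_square algebra_simps)
      have "exp (- K * (3 * m)) * (3 * m) \<le> exp (- K * (2 * m)) * (K * (2 * m\<^sup>2) / 2 - 2 * m)"
        using K m by (intro mult_mono[OF _ Km]) auto
      then show ?thesis by (simp add: diag_term_def sn p)
    qed
  qed (rule s)
  moreover have "sum (diag_term K) (F1 \<union> F2) > 0"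
  proof -
    define q where "q = exp (- 2 * K)"
    have q: "q > 0" by (simp add: q_def)
    have q4: "exp (- (K * 4)) = q * q" by (simp add: q_def mult_exp_exp)
    have q2: "exp (- (K * 2)) = q" by (simp add: q_def mult.commute)
    have t1: "diag_term K n = q * (K - 2)" if "n \<in> F1" for n
      using that unfolding F1_def by (elim insertE emptyE) (simp_all add: diag_term_def sqn_def dsq_def q2)
    have t2: "diag_term K n = q * q * (16 * K - 4)" if "n \<in> F2" for n
      using that unfolding F2_def by (elim insertE emptyE) (simp_all add: diag_term_def sqn_def dsq_def q4)
    have "card F1 = 12" "card F2 = 6" by (simp_all add: F1_def F2_def)
    then have "sum (diag_term K) F1 = 12 * (q * (K - 2))" "sum (diag_term K) F2 = 6 * (q * q * (16 * K - 4))"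
      using t1 t2 by simp_all
    then have sum: "sum (diag_term K) (F1 \<union> F2) = 12 * (q * (K - 2)) + 6 * (q * q * (16 * K - 4))"
      using F by (simp only: sum.union_disjoint)
    have "6 * (q * (16 * K - 4)) > 12 * (2 - K)"
    proof (cases "K \<ge> 2")
      case True
      then have "12 * (2 - K) \<le> 0" by simp
      also have "0 < 6 * (q * (16 * K - 4))" using True q by simp
      finally show ?thesis .
    next
      case False
      have "exp (1::real) ^ 4 \<le> 3 ^ 4" by (intro power_mono exp_le) auto
      then have "exp (4::real) \<le> 81" by (simp add: exp_of_nat_mult[symmetric])
      then have "1 / 81 \<le> exp (- 4 :: real)" by (simp add: exp_minus field_simps)
      also have "exp (- 4) \<le> q" using False by (simp add: q_def)
      finally have "1 / 81 * 26 \<le> q * (16 * K - 4)" using K by (intro mult_mono) auto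
      then show ?thesis using K by simp
    qed
    then have "0 < q * (6 * (q * (16 * K - 4)) - 12 * (2 - K))" using q by simp
    then show ?thesis unfolding sum by (simp add: algebra_simps)
  qed
  ultimately show ?thesis
    using infsum_finite_part[OF s F(1,2)] by simp
qed

text \<open>
  Only the points on the coordinate axes have negative terms; \<open>(2 t, 0, 0)\<close> is paired with the closer point
  \<open>(t, t, 0)\<close>, and cyclically. The point \<open>(1, -1, 0)\<close> is never used and makes the sum positive.
\<close>

lemma fcc_off_pos:
  assumes K: "K \<ge> 15 / 8"
  shows "infsum (off_term K) fcc_set > 0"
proof -
  define F :: "(int \<times> int \<times> int) set" where "F = {(1,-1,0)}"
  define D :: "(int \<times> int \<times> int) set" where "D = {(i, j, k). even i \<and> even j \<and> even k \<and> ((j = 0 \<and> k = 0 \<and> i \<noteq> 0) \<or> (i = 0 \<and> k = 0 \<and> j \<noteq> 0) \<or> (i = 0 \<and> j = 0 \<and> k \<noteq> 0))}"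
  define \<psi> :: "int \<times> int \<times> int \<Rightarrow> int \<times> int \<times> int" where "\<psi> = (\<lambda>(i, j, k). ((i + k) div 2, (i + j) div 2, (j + k) div 2))"
  have F: "finite F" "F \<subseteq> fcc_set" by (auto simp: F_def fcc_set_def)
  have s: "off_term K summable_on P" for P using K by (intro off_term_summable) auto
  have "infsum (off_term K) (fcc_set - F) \<ge> 0"
  proof (rule infsum_nonneg_pairing[where D = D and \<psi> = \<psi>])
    show "D \<subseteq> fcc_set - F"
      by (auto simp: D_def fcc_set_def F_def)
    show "inj_on \<psi> D"
      by (auto simp: inj_on_def D_def \<psi>_def elim!: evenE)
    show "\<psi> ` D \<subseteq> fcc_set - F - D"
      by (auto simp: D_def fcc_set_def F_def \<psi>_def elim!: evenE)
    show "off_term K n \<ge> 0" if n: "n \<in> fcc_set - F - D" for n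
    proof (cases n)
      case (fields i j k)
      have *: "a + b \<le> 2 * (a * b)" if "a \<ge> 1" "b \<ge> 1" for a b :: int
      proof -
        have "0 \<le> (a - 1) * b + (b - 1) * a" using that by (intro add_nonneg_nonneg mult_nonneg_nonneg) auto
        then show ?thesis by (simp add: algebra_simps)
      qed
      have pos: "x\<^sup>2 = 0 \<or> x\<^sup>2 \<ge> 1" for x :: int
        by (metis int_one_le_iff_zero_less zero_less_power2 zero_eq_power2)
      have two: "(i = 0 \<and> j = 0 \<and> k = 0) \<or> (i \<noteq> 0 \<and> j \<noteq> 0) \<or> (j \<noteq> 0 \<and> k \<noteq> 0) \<or> (i \<noteq> 0 \<and> k \<noteq> 0)"
        using n fields by (auto simp: D_def fcc_set_def)
      have "i\<^sup>2 + j\<^sup>2 + k\<^sup>2 \<le> 2 * esq n"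
      proof -
        define a b c where "a = i\<^sup>2" and "b = j\<^sup>2" and "c = k\<^sup>2"
        have abc: "a = 0 \<or> a \<ge> 1" "b = 0 \<or> b \<ge> 1" "c = 0 \<or> c \<ge> 1" using pos by (auto simp: a_def b_def c_def)
        have t: "(a = 0 \<and> b = 0 \<and> c = 0) \<or> (a \<noteq> 0 \<and> b \<noteq> 0) \<or> (b \<noteq> 0 \<and> c \<noteq> 0) \<or> (a \<noteq> 0 \<and> c \<noteq> 0)"
          using two by (auto simp: a_def b_def c_def)
        have "a + b + c \<le> 2 * (a * b + b * c + c * a)"
          using abc t *[of a b] *[of b c] *[of c a] by auto
        then show ?thesis by (simp add: esq_def fields a_def b_def c_def)
      qed
      then have "real_of_int (i\<^sup>2 + j\<^sup>2 + k\<^sup>2) \<le> real_of_int (2 * esq n)" by (simp only: of_int_le_iff)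
      then have "sqn n \<le> 2 * of_int (esq n)" by (simp add: sqn_def fields)
      also have "\<dots> \<le> 2 * K * of_int (esq n)"
        using K by (intro mult_right_mono) (auto simp: esq_def split: prod.splits)
      finally show ?thesis by (simp add: off_term_def)
    qed
    show "off_term K (\<psi> n) + off_term K n \<ge> 0" if n: "n \<in> D" for n
    proof -
      obtain t :: int where t: "t \<noteq> 0" "n = (2 * t, 0, 0) \<or> n = (0, 2 * t, 0) \<or> n = (0, 0, 2 * t)"
        using n by (auto simp: D_def elim!: evenE)
      define m :: real where "m = (of_int t)\<^sup>2"
      have "t\<^sup>2 \<ge> 1" using t(1) by (metis int_one_le_iff_zero_less zero_less_power2)
      then have m: "m \<ge> 1" unfolding m_def by (metis of_int_1_le_iff of_int_power)
      have sn: "sqn n = 4 * m" "esq n = 0" using t by (auto simp: sqn_def esq_def m_def power_mult_distrib)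
      have p: "sqn (\<psi> n) = 2 * m" "real_of_int (esq (\<psi> n)) = m\<^sup>2"
        using t by (auto simp: sqn_def esq_def m_def \<psi>_def power2_eq_square)
      have "15 / 8 * 1 \<le> K * m" using K m by (intro mult_mono) auto
      then have "7 / 4 * m \<le> (2 * (K * m) - 2) * m" using m by (intro mult_right_mono) auto
      then have Km: "m \<le> 2 * K * m\<^sup>2 - 2 * m" using m by (simp add: power2_eq_square algebra_simps)
      have "exp (- K * (2 * m)) * 4 \<le> 1"
      proof -
        have "4 \<le> 1 + K * (2 * m)" using \<open>15 / 8 * 1 \<le> K * m\<close> by simp
        also have "\<dots> \<le> exp (K * (2 * m))" by (rule exp_ge_add_one_self)
        finally show ?thesis by (simp add: exp_minus field_simps)
      qed
      then have "exp (- K * (2 * m)) * 4 * m \<le> 1 * m" using m by (intro mult_right_mono) auto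
      then have "exp (- K * (2 * m)) * (exp (- K * (2 * m)) * 4 * m) \<le> exp (- K * (2 * m)) * (2 * K * m\<^sup>2 - 2 * m)"
        using Km by (intro mult_left_mono) auto
      moreover have "exp (- K * (2 * m)) * exp (- K * (2 * m)) = exp (- K * (4 * m))" by (simp add: mult_exp_exp)
      ultimately have "exp (- K * (4 * m)) * (4 * m) \<le> exp (- K * (2 * m)) * (2 * K * m\<^sup>2 - 2 * m)"
        by (simp only: mult.assoc[symmetric])
      then show ?thesis by (simp add: off_term_def sn p)
    qed
  qed (rule s)
  moreover have "sum (off_term K) F > 0"
    using K by (simp add: F_def off_term_def sqn_def esq_def)
  ultimately show ?thesis
    using infsum_finite_part[OF s F] by simp
qed

section \<open>The signs for BCC\<close>

lemma sqn_poly_summable: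
  "(\<lambda>n. exp (- sqn n) * sqn n ^ m) summable_on P"
proof -
  have "tame 1 (\<lambda>p :: real^3. ((norm p)\<^sup>2) ^ m)"
    by (rule tame_poly[where B = 1 and n = m]) (auto simp: power_mult)
  from tame_summable_grid[OF _ this, of 1 P] show ?thesis
    by (simp only: norm_grid) simp
qed

lemma bcc_shell:
  assumes n: "n \<in> bcc_set"
  shows "(even (fst n) \<and> (n = (0, 0, 0) \<or> sqn n \<ge> 4)) \<or> (odd (fst n) \<and> of_int (esq n) \<ge> sqn n \<and> (dsq n = 0 \<or> sqn n \<ge> 4))"
proof -
  obtain i j k where ijk: "n = (i, j, k)" by (cases n)
  have sq: "sqn n = real_of_int (i\<^sup>2 + j\<^sup>2 + k\<^sup>2)" by (simp add: sqn_def ijk)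
  have big: "\<bar>x\<bar> \<ge> 2 \<Longrightarrow> x\<^sup>2 \<ge> 4" for x :: int
    using power_mono[of 2 "\<bar>x\<bar>" 2] by simp
  have nn: "i\<^sup>2 \<ge> 0" "j\<^sup>2 \<ge> 0" "k\<^sup>2 \<ge> 0" by auto
  have large: "sqn n \<ge> 4" if "\<bar>i\<bar> \<ge> 2 \<or> \<bar>j\<bar> \<ge> 2 \<or> \<bar>k\<bar> \<ge> 2"
  proof -
    have "i\<^sup>2 \<ge> 4 \<or> j\<^sup>2 \<ge> 4 \<or> k\<^sup>2 \<ge> 4" using that big by blast
    then have "i\<^sup>2 + j\<^sup>2 + k\<^sup>2 \<ge> 4" using nn by linarith
    then show ?thesis unfolding sq by linarith
  qed
  show ?thesis
  proof (cases "even i")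
    case True
    then have ev: "even i" "even j" "even k" using n by (auto simp: bcc_set_def ijk)
    have "x = 0 \<or> \<bar>x\<bar> \<ge> 2" if "even x" for x :: int using that by (auto elim!: evenE)
    then have "n = (0, 0, 0) \<or> sqn n \<ge> 4" using ev large by (auto simp: ijk)
    then show ?thesis using True by (simp add: ijk)
  next
    case False
    then have od: "odd i" "odd j" "odd k" using n by (auto simp: bcc_set_def ijk)
    have ge1: "x\<^sup>2 \<ge> 1" if "odd x" for x :: int
      using that by (metis even_zero int_one_le_iff_zero_less zero_less_power2)
    have "i\<^sup>2 * 1 \<le> i\<^sup>2 * j\<^sup>2" "j\<^sup>2 * 1 \<le> j\<^sup>2 * k\<^sup>2" "k\<^sup>2 * 1 \<le> k\<^sup>2 * i\<^sup>2"
      using ge1 od by (intro mult_left_mono; simp)+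
    then have "i\<^sup>2 + j\<^sup>2 + k\<^sup>2 \<le> esq n" by (simp add: esq_def ijk)
    then have 1: "sqn n \<le> of_int (esq n)" unfolding sq by (simp only: of_int_le_iff)
    have "\<bar>x\<bar> = 1 \<or> \<bar>x\<bar> \<ge> 2" if "odd x" for x :: int
    proof -
      have "x \<noteq> 0" using that by auto
      then show ?thesis by linarith
    qed
    then have "(\<bar>i\<bar> = 1 \<and> \<bar>j\<bar> = 1 \<and> \<bar>k\<bar> = 1) \<or> sqn n \<ge> 4" using od large by blast
    moreover have "dsq n = 0" if "\<bar>i\<bar> = 1 \<and> \<bar>j\<bar> = 1 \<and> \<bar>k\<bar> = 1"
    proof -
      have "x\<^sup>2 = 1" if "\<bar>x\<bar> = 1" for x :: int using that by (metis power2_abs one_power2)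
      then show ?thesis using that by (simp add: dsq_def ijk)
    qed
    ultimately show ?thesis using 1 False by (auto simp: ijk)
  qed
qed

lemma exp_tail:
  assumes "N \<ge> 4" "K \<ge> (1::real)"
  shows "exp (- K * N) \<le> exp (- 4 * (K - 1)) * exp (- N)"
proof -
  have "(K - 1) * 4 \<le> (K - 1) * N" using assms by (intro mult_left_mono) auto
  then have "- K * N \<le> - 4 * (K - 1) + - N" by (simp add: algebra_simps)
  then show ?thesis unfolding exp_add[symmetric] by simp
qed

text \<open>
  The point \<open>(1, 1, 1)\<close> contributes \<open>-3 exp (- 3 K)\<close> to the first sum and \<open>(6 K - 3) exp (- 3 K)\<close> to the second. All terms of the
  wrong sign have squared norm at least \<open>4\<close>, hence are of order \<open>K exp (- 4 K)\<close> in total.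
\<close>

lemma bcc_signs:
  obtains K0 where "K0 > 0" "\<And>K. K \<ge> K0 \<Longrightarrow> infsum (diag_term K) bcc_set < 0 \<and> infsum (off_term K) bcc_set > 0"
proof -
  define F :: "(int \<times> int \<times> int) set" where "F = {(1, 1, 1)}"
  define R where "R = bcc_set - F"
  have F: "finite F" "F \<subseteq> bcc_set" by (auto simp: F_def bcc_set_def)
  define C2 where "C2 = infsum (\<lambda>n. exp (- sqn n) * sqn n ^ 2) R"
  define C1 where "C1 = infsum (\<lambda>n. exp (- sqn n) * sqn n ^ 1) R"
  have sqn0: "sqn n \<ge> 0" for n by (auto simp: sqn_def split: prod.splits)
  have C0: "C1 \<ge> 0" "C2 \<ge> 0" unfolding C1_def C2_def using sqn0 by (auto intro!: infsum_nonneg)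
  have dsq_le: "of_int (dsq n) / 2 \<le> (sqn n)\<^sup>2" for n
  proof (cases n)
    case (fields i j k)
    define a b c where "a = (real_of_int i)\<^sup>2" and "b = (real_of_int j)\<^sup>2" and "c = (real_of_int k)\<^sup>2"
    have "a \<ge> 0" "b \<ge> 0" "c \<ge> 0" by (auto simp: a_def b_def c_def)
    then have "0 \<le> a * b" "0 \<le> b * c" "0 \<le> a * c" by auto
    then have "((a - b)\<^sup>2 + (b - c)\<^sup>2 + (c - a)\<^sup>2) / 2 \<le> (a + b + c)\<^sup>2"
      by (simp add: power2_eq_square algebra_simps)
    then show ?thesis by (simp add: fields dsq_def sqn_def a_def b_def c_def)
  qed
  have d0: "dsq n \<ge> 0" "esq n \<ge> 0" for n by (auto simp: dsq_def esq_def split: prod.splits)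
  \<comment> \<open>Chosen such that \<open>K\<close> dominates both tail constants, while \<open>K\<^sup>2 exp (- K) \<le> 2\<close> and \<open>K exp (- K) \<le> 1\<close>.\<close>
  define K0 where "K0 = 1 + exp 4 * C2 + exp 4 * C1"
  show ?thesis
  proof
    show "K0 > 0" using C0 by (auto simp: K0_def intro!: add_pos_nonneg)
    fix K assume K: "K \<ge> K0"
    have K1: "K \<ge> 1" "K \<ge> exp 4 * C2" "K \<ge> exp 4 * C1" "K > 0"
      using K mult_nonneg_nonneg[OF exp_ge_zero C0(1), of 4] mult_nonneg_nonneg[OF exp_ge_zero C0(2), of 4]
      unfolding K0_def by linarith+
    define q where "q = exp (- K)"
    have q: "q > 0" by (simp add: q_def)
    have e3: "exp (- (K * 3)) = q ^ 3" by (simp add: q_def exp_of_nat_mult[symmetric] mult.commute)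
    have e4: "exp (- 4 * (K - 1)) = q ^ 3 * (exp 4 * q)"
      by (simp add: q_def exp_of_nat_mult[symmetric] mult_exp_exp algebra_simps)
    have Kq: "K * (K * q) \<le> 2"
      using power_le_exp[of K 1 2] K1 by (simp add: q_def exp_minus field_simps power2_eq_square)
    have Kq1: "K * q \<le> 1"
      using power_le_exp[of K 1 1] K1 by (simp add: q_def exp_minus field_simps)
    have "diag_term K n \<le> (K * exp (- 4 * (K - 1))) * (exp (- sqn n) * sqn n ^ 2)" if n: "n \<in> R" for n
    proof (cases "dsq n = 0")
      case True
      have "diag_term K n \<le> 0" using True sqn0[of n] by (simp add: diag_term_def mult_nonneg_nonpos)
      also have "0 \<le> (K * exp (- 4 * (K - 1))) * (exp (- sqn n) * sqn n ^ 2)" using K1 by simp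
      finally show ?thesis .
    next
      case False
      then have N: "sqn n \<ge> 4" using bcc_shell[of n] n by (auto simp: R_def dsq_def)
      have "diag_term K n \<le> exp (- K * sqn n) * (K * (sqn n)\<^sup>2)"
      proof -
        have "K * (of_int (dsq n) / 2) \<le> K * (sqn n)\<^sup>2" using K1 by (intro mult_left_mono dsq_le) auto
        then have "K * of_int (dsq n) / 2 - sqn n \<le> K * (sqn n)\<^sup>2" using sqn0[of n] by simp
        then show ?thesis unfolding diag_term_def by (intro mult_left_mono) auto
      qed
      also have "\<dots> \<le> (exp (- 4 * (K - 1)) * exp (- sqn n)) * (K * (sqn n)\<^sup>2)"
        using K1 by (intro mult_right_mono exp_tail N) auto
      finally show ?thesis by (simp only: mult_ac)
    qed
    then have "infsum (diag_term K) R \<le> infsum (\<lambda>n. (K * exp (- 4 * (K - 1))) * (exp (- sqn n) * sqn n ^ 2)) R"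
      using K1 by (intro infsum_mono diag_term_summable summable_on_cmult_right sqn_poly_summable) auto
    also have "\<dots> = K * exp (- 4 * (K - 1)) * C2" unfolding C2_def by (rule infsum_cmult_right')
    also have "\<dots> = q ^ 3 * (K * q * (exp 4 * C2))" unfolding e4 by (simp only: mult_ac)
    also have "\<dots> \<le> q ^ 3 * (K * q * K)"
      using K1 q by (intro mult_left_mono) auto
    also have "\<dots> \<le> q ^ 3 * 2" using Kq q by (intro mult_left_mono) (auto simp: mult_ac)
    finally have "infsum (diag_term K) bcc_set \<le> sum (diag_term K) F + q ^ 3 * 2"
      using infsum_finite_part[OF diag_term_summable F, of K] K1 by (simp add: R_def)
    also have "sum (diag_term K) F = - 3 * q ^ 3"
      by (simp add: F_def diag_term_def sqn_def dsq_def e3)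
    also have "- 3 * q ^ 3 + q ^ 3 * 2 < 0" using q by simp
    finally have 1: "infsum (diag_term K) bcc_set < 0" .
    have "off_term K n \<ge> (- exp (- 4 * (K - 1))) * (exp (- sqn n) * sqn n ^ 1)" if n: "n \<in> R" for n
    proof (cases "sqn n \<le> of_int (esq n)")
      case True
      have "1 * real_of_int (esq n) \<le> 2 * K * of_int (esq n)" using K1 d0 by (intro mult_right_mono) auto
      then have "0 \<le> off_term K n" using True by (simp add: off_term_def)
      moreover have "(- exp (- 4 * (K - 1))) * (exp (- sqn n) * sqn n ^ 1) \<le> 0" using sqn0 by simp
      ultimately show ?thesis by linarith
    next
      case False
      then have N: "sqn n \<ge> 4" using bcc_shell[of n] n by (auto simp: R_def sqn_def esq_def)
      have "(exp (- K * sqn n)) * sqn n \<le> (exp (- 4 * (K - 1)) * exp (- sqn n)) * sqn n"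
        using K1 sqn0 by (intro mult_right_mono exp_tail N) auto
      moreover have "off_term K n \<ge> exp (- K * sqn n) * (- sqn n)"
        unfolding off_term_def using K1 d0[of n] by (intro mult_left_mono) auto
      ultimately show ?thesis by (simp add: mult_ac)
    qed
    then have "infsum (\<lambda>n. (- exp (- 4 * (K - 1))) * (exp (- sqn n) * sqn n ^ 1)) R \<le> infsum (off_term K) R"
      using K1 by (intro infsum_mono off_term_summable summable_on_cmult_right sqn_poly_summable) auto
    also have "infsum (\<lambda>n. (- exp (- 4 * (K - 1))) * (exp (- sqn n) * sqn n ^ 1)) R = - exp (- 4 * (K - 1)) * C1"
      unfolding C1_def by (rule infsum_cmult_right')
    also have "\<dots> = - (q ^ 3 * (q * (exp 4 * C1)))" unfolding e4 by (simp only: mult_ac mult_minus_left mult_minus_right)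
    finally have a: "- (q ^ 3 * (q * (exp 4 * C1))) \<le> infsum (off_term K) R" .
    have "q ^ 3 * (q * (exp 4 * C1)) \<le> q ^ 3 * (q * K)" using K1 q by (intro mult_left_mono) auto
    also have "\<dots> \<le> q ^ 3 * 1" using Kq1 q by (intro mult_left_mono) (auto simp: mult_ac)
    finally have b: "q ^ 3 * (q * (exp 4 * C1)) \<le> q ^ 3" by simp
    have "infsum (off_term K) bcc_set = sum (off_term K) F + infsum (off_term K) R"
      using infsum_finite_part[OF off_term_summable F, of K] K1 by (simp add: R_def)
    moreover have "sum (off_term K) F = q ^ 3 * (6 * K - 3)"
      by (simp add: F_def off_term_def sqn_def esq_def e3)
    moreover have "q ^ 3 * (6 * K - 3) \<ge> q ^ 3 * 3" using K1 q by (intro mult_left_mono) auto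
    moreover have "q ^ 3 > 0" using q by simp
    ultimately have 2: "infsum (off_term K) bcc_set > 0" using a b by linarith
    show "infsum (diag_term K) bcc_set < 0 \<and> infsum (off_term K) bcc_set > 0" using 1 2 by blast
  qed
qed

section \<open>FCC and BCC as dual lattices\<close>

lemma scaled_shift_grid:
  fixes a b d :: int
  shows "(*\<^sub>R) c ` (+) (vector [of_int a / 2, of_int b / 2, of_int d / 2]) ` Z3 =
    grid (c / 2) (range (\<lambda>(i, j, k). (2 * i + a, 2 * j + b, 2 * k + d)))"
proof -
  have "c *\<^sub>R (vector [of_int a / 2, of_int b / 2, of_int d / 2] + vec3 (i, j, k)) =
     (c / 2) *\<^sub>R vec3 (2 * i + a, 2 * j + b, 2 * k + d)" for i j k
    by (simp add: vec3_def vec_eq_iff forall_3 field_simps)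
  then have "c *\<^sub>R (vector [of_int a / 2, of_int b / 2, of_int d / 2] + vec3 n) =
     (c / 2) *\<^sub>R vec3 (case n of (i, j, k) \<Rightarrow> (2 * i + a, 2 * j + b, 2 * k + d))" for n
    by (cases n) (simp only: prod.case)
  then show ?thesis
    unfolding Z3_eq grid_def image_image by simp
qed

lemma grid_Un: "grid c (P \<union> Q) = grid c P \<union> grid c Q"
  by (auto simp: grid_def)

lemma in_parity_class:
  "(x, y, z) \<in> range (\<lambda>(i, j, k). (2 * i + a, 2 * j + b, 2 * k + d)) \<longleftrightarrow> even (x - a) \<and> even (y - b) \<and> even (z - d)"
  for x y z a b d :: int
proof
  assume "even (x - a) \<and> even (y - b) \<and> even (z - d)"
  then obtain i j k where "x - a = 2 * i" "y - b = 2 * j" "z - d = 2 * k" by (meson evenE)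
  then have "(x, y, z) = (\<lambda>(i, j, k). (2 * i + a, 2 * j + b, 2 * k + d)) (i, j, k)" by auto
  then show "(x, y, z) \<in> range (\<lambda>(i, j, k). (2 * i + a, 2 * j + b, 2 * k + d))" by (rule range_eqI)
qed auto

lemma FCC_grid: "FCC = grid (root 3 4 / 2) fcc_set"
proof -
  define Q where "Q a b d = range (\<lambda>(i, j, k). (2 * i + a, 2 * j + b, 2 * k + d))" for a b d :: int
  have P: "fcc_set = Q 0 0 0 \<union> (Q 1 1 0 \<union> (Q 1 0 1 \<union> Q 0 1 1))"
  proof (intro set_eqI)
    fix n :: "int \<times> int \<times> int"
    obtain x y z where n: "n = (x, y, z)" by (cases n)
    show "n \<in> fcc_set \<longleftrightarrow> n \<in> Q 0 0 0 \<union> (Q 1 1 0 \<union> (Q 1 0 1 \<union> Q 0 1 1))"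
      unfolding Un_iff Q_def n in_parity_class by (auto simp: fcc_set_def)
  qed
  show ?thesis
    unfolding P grid_Un using scaled_shift_grid[of "root 3 4" 0 0 0] scaled_shift_grid[of "root 3 4" 1 1 0]
      scaled_shift_grid[of "root 3 4" 1 0 1] scaled_shift_grid[of "root 3 4" 0 1 1]
    by (simp add: FCC_def Q_def image_Un)
qed

lemma BCC_grid: "BCC = grid (root 3 2 / 2) bcc_set"
proof -
  define Q where "Q a b d = range (\<lambda>(i, j, k). (2 * i + a, 2 * j + b, 2 * k + d))" for a b d :: int
  have P: "bcc_set = Q 0 0 0 \<union> Q 1 1 1"
  proof (intro set_eqI)
    fix n :: "int \<times> int \<times> int"
    obtain x y z where n: "n = (x, y, z)" by (cases n)
    show "n \<in> bcc_set \<longleftrightarrow> n \<in> Q 0 0 0 \<union> Q 1 1 1"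
      unfolding Un_iff Q_def n in_parity_class by (auto simp: bcc_set_def)
  qed
  have Z: "(+) (vector [0, 0, 0]) ` Z3 = Z3"
  proof -
    have "vector [0, 0, 0] = (0 :: real^3)" by (simp add: vec_eq_iff forall_3)
    then show ?thesis by simp
  qed
  show ?thesis
    unfolding P grid_Un using scaled_shift_grid[of "root 3 2" 0 0 0] scaled_shift_grid[of "root 3 2" 1 1 1] Z
    by (simp add: BCC_def Q_def image_Un)
qed

definition bcc_matrix :: "real^3^3" where
  "bcc_matrix = (root 3 2 / 2) *\<^sub>R vector [vector [-1, 1, 1], vector [1, -1, 1], vector [1, 1, -1]]"

definition fcc_matrix :: "real^3^3" where
  "fcc_matrix = (root 3 4 / 2) *\<^sub>R vector [vector [0, 1, 1], vector [1, 0, 1], vector [1, 1, 0]]"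

lemma root_facts: "root 3 2 * root 3 4 = 2" "root 3 2 ^ 3 = 2" "root 3 4 ^ 3 = 4"
proof -
  have "root 3 (8 :: real) = 2" using real_root_power_cancel[of 3 2] by simp
  then show "root 3 2 * root 3 4 = 2" by (simp add: real_root_mult[symmetric])
qed (simp_all add: real_root_pow_pos2)

lemma det_bcc: "det bcc_matrix = 1"
  using root_facts by (simp add: bcc_matrix_def det_3 power3_eq_cube)

lemma fcc_bcc_dual: "transpose bcc_matrix ** fcc_matrix = mat 1"
  using root_facts
  by (simp add: bcc_matrix_def fcc_matrix_def vec_eq_iff forall_3 matrix_matrix_mult_def transpose_def sum_3 mat_def)

lemma FCC_lattice: "FCC = lattice_of fcc_matrix"
proof -
  define g :: "int \<times> int \<times> int \<Rightarrow> int \<times> int \<times> int" where "g = (\<lambda>(i, j, k). (j + k, i + k, i + j))"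
  have mv: "fcc_matrix *v vec3 n = (root 3 4 / 2) *\<^sub>R vec3 (g n)" for n
    by (cases n) (simp add: g_def fcc_matrix_def vec3_def vec_eq_iff forall_3 matrix_vector_mult_def sum_3 algebra_simps)
  have "n \<in> range g" if "n \<in> fcc_set" for n
  proof -
    obtain i j k where "n = (i, j, k)" "even (i + j + k)" using \<open>n \<in> fcc_set\<close> by (auto simp: fcc_set_def)
    moreover from this obtain s where "i + j + k = 2 * s" by blast
    ultimately have "n = g (s - i, s - j, s - k)" by (auto simp: g_def)
    then show ?thesis by blast
  qed
  moreover have "g n \<in> fcc_set" for n by (auto simp: g_def fcc_set_def split: prod.splits)
  ultimately have P: "fcc_set = range g" by blast
  show ?thesis
    unfolding FCC_grid grid_def P lattice_of_def Z3_eq by (simp add: image_image mv)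
qed

lemma BCC_lattice: "BCC = lattice_of bcc_matrix"
proof -
  define g :: "int \<times> int \<times> int \<Rightarrow> int \<times> int \<times> int" where "g = (\<lambda>(i, j, k). (- i + j + k, i - j + k, i + j - k))"
  have mv: "bcc_matrix *v vec3 n = (root 3 2 / 2) *\<^sub>R vec3 (g n)" for n
    by (cases n) (simp add: g_def bcc_matrix_def vec3_def vec_eq_iff forall_3 matrix_vector_mult_def sum_3 algebra_simps)
  have "n \<in> range g" if "n \<in> bcc_set" for n
  proof -
    obtain i j k where n: "n = (i, j, k)" "even (i + j)" "even (j + k)" "even (i + k)"
      using \<open>n \<in> bcc_set\<close> by (auto simp: bcc_set_def)
    then obtain r s t where "i + j = 2 * r" "j + k = 2 * s" "i + k = 2 * t" by blast
    then have "n = g (s, t, r)" using n(1) by (auto simp: g_def)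
    then show ?thesis by blast
  qed
  moreover have "g n \<in> bcc_set" for n by (auto simp: g_def bcc_set_def split: prod.splits)
  ultimately have P: "bcc_set = range g" by blast
  show ?thesis
    unfolding BCC_grid grid_def P lattice_of_def Z3_eq by (simp add: image_image mv)
qed

lemma cubic_fcc: "cubic FCC"
  unfolding FCC_grid by (rule cubic_grid) (auto simp: fcc_set_def)

lemma cubic_bcc: "cubic BCC"
  unfolding BCC_grid by (rule cubic_grid) (auto simp: bcc_set_def)

lemma gauss_summable_fcc: "gauss_summable FCC"
  unfolding FCC_grid by (rule gauss_summable_grid) auto

lemma gauss_summable_bcc: "gauss_summable BCC"
  unfolding BCC_grid by (rule gauss_summable_grid) auto

text \<open>
  The squared scale factor \<open>h\<close> is the real cube root of \<open>1 / 4\<close>, hence at least \<open>5 / 8\<close>, and \<open>3 (5 / 8) = 15 / 8\<close>.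
\<close>

lemma stable_FCC:
  assumes "\<alpha> \<ge> 1" shows "stable \<alpha> FCC"
proof -
  define h where "h = (root 3 4 / 2)\<^sup>2"
  have "root 3 4 ^ 6 = (root 3 4 ^ 3)\<^sup>2" by (simp only: power_mult[symmetric]) simp
  then have "root 3 4 ^ 6 = 16" by (simp only: root_facts) simp
  then have h3: "h ^ 3 = 1 / 4" by (simp add: h_def power_divide power_mult[symmetric])
  have h: "h \<ge> 5 / 8"
  proof (rule ccontr)
    assume "\<not> ?thesis"
    then have "h ^ 3 \<le> (5 / 8) ^ 3" by (intro power_mono) (auto simp: h_def)
    then show False using h3 by (simp add: power3_eq_cube)
  qed
  have "3 * 1 \<le> pi * \<alpha>" using assms pi_gt3 by (intro mult_mono) auto
  then have "3 * (5 / 8) \<le> pi * \<alpha> * h" using h by (intro mult_mono) auto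
  then have K: "15 / 8 \<le> pi * \<alpha> * h" by simp
  have c: "root 3 4 / 2 \<noteq> 0" "0 < (root 3 4 / 2)\<^sup>2" by auto
  show ?thesis
  proof (rule stableI[OF cubic_fcc gauss_summable_fcc])
    show "diag_coeff \<alpha> FCC > 0"
      unfolding diag_coeff_def FCC_grid gsum_diag_grid[OF c(1)] using fcc_diag_pos[OF K] c(2) by (simp add: h_def)
    show "off_coeff \<alpha> FCC > 0"
      unfolding off_coeff_def FCC_grid gsum_off_grid[OF c(1)] using fcc_off_pos[OF K] c(2) by (simp add: h_def)
  qed (use assms in auto)
qed

lemma bcc_second_variation_signs:
  obtains \<alpha>0 where "\<alpha>0 > 0" "\<And>\<alpha>. \<alpha> \<ge> \<alpha>0 \<Longrightarrow> diag_coeff \<alpha> BCC < 0"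
    "\<And>\<alpha>. \<alpha> \<ge> \<alpha>0 \<Longrightarrow> off_coeff \<alpha> BCC > 0"
proof -
  obtain K0 where K0: "K0 > 0" "\<And>K. K \<ge> K0 \<Longrightarrow> infsum (diag_term K) bcc_set < 0 \<and> infsum (off_term K) bcc_set > 0"
    using bcc_signs by blast
  define h where "h = (root 3 2 / 2)\<^sup>2"
  have h: "h > 0" and c: "root 3 2 / 2 \<noteq> 0" by (auto simp: h_def)
  have K: "K0 \<le> pi * \<alpha> * h" if "\<alpha> \<ge> K0 / (pi * h)" for \<alpha>
    using that h by (simp add: field_simps)
  show ?thesis
  proof (rule that[of "K0 / (pi * h)"])
    show "K0 / (pi * h) > 0" using K0 h by simp
    show "diag_coeff \<alpha> BCC < 0" if "\<alpha> \<ge> K0 / (pi * h)" for \<alpha>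
      unfolding diag_coeff_def BCC_grid gsum_diag_grid[OF c] using K0(2)[OF K[OF that]] h by (simp add: h_def mult_pos_neg)
    show "off_coeff \<alpha> BCC > 0" if "\<alpha> \<ge> K0 / (pi * h)" for \<alpha>
      unfolding off_coeff_def BCC_grid gsum_off_grid[OF c] using K0(2)[OF K[OF that]] h by (simp add: h_def)
  qed
qed

section \<open>Local minimizers in the space of lattices\<close>

lemma rotation_mat_1: "rotation_matrix (mat 1 :: real^3^3)"
  by (simp add: rotation_matrix_def orthogonal_matrix_id)

lemma matrix_image_image: "(*v) A ` ((*v) B ` \<Lambda>) = (*v) (A ** B) ` \<Lambda>" for A B :: "real^3^3"
  by (auto simp: image_image matrix_vector_mul_assoc)

lemma mem_rot_class: "\<Lambda> \<in> rot_class \<Lambda>"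
  unfolding rot_class_def using rotation_mat_1 by (force intro!: exI[of _ "mat 1"])

lemma rotation_matrix_mul: "rotation_matrix A \<Longrightarrow> rotation_matrix B \<Longrightarrow> rotation_matrix (A ** B)" for A B :: "real^3^3"
  by (simp add: rotation_matrix_def orthogonal_matrix_mul det_mul)

lemma rotation_matrix_transpose_self: "rotation_matrix A \<Longrightarrow> rotation_matrix (transpose A)" for A :: "real^3^3"
  by (simp add: rotation_matrix_def)

lemma rot_class_rotate:
  assumes R: "rotation_matrix R" shows "rot_class ((*v) R ` \<Lambda>) = rot_class \<Lambda>"
proof (intro subset_antisym subsetI)
  fix x assume "x \<in> rot_class ((*v) R ` \<Lambda>)"
  then show "x \<in> rot_class \<Lambda>" using R rotation_matrix_mul by (auto simp: rot_class_def matrix_image_image)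
next
  fix x assume "x \<in> rot_class \<Lambda>"
  then obtain Q where Q: "rotation_matrix Q" "x = (*v) Q ` \<Lambda>" by (auto simp: rot_class_def)
  have "transpose R ** R = mat 1" using R by (simp add: rotation_matrix_def orthogonal_matrix_def)
  then have "x = (*v) (Q ** transpose R) ` ((*v) R ` \<Lambda>)"
    by (simp add: Q(2) matrix_image_image matrix_mul_assoc[symmetric])
  then show "x \<in> rot_class ((*v) R ` \<Lambda>)"
    using rotation_matrix_mul[OF Q(1) rotation_matrix_transpose_self[OF R]] by (auto simp: rot_class_def)
qed

lemma theta_rotate:
  assumes "rotation_matrix R" shows "theta ((*v) R ` \<Lambda>) \<alpha> = theta \<Lambda> \<alpha>"
proof -
  have R: "transpose R ** R = mat 1" "det R = 1" using assms by (auto simp: rotation_matrix_def orthogonal_matrix_def)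
  have "strain R = 0" by (simp add: strain_def R)
  then show ?thesis using theta_image[of R \<Lambda> \<alpha>] R by (simp add: quad_def theta_eq_gsum)
qed

lemma lattice_of_mult: "lattice_of (A ** B) = (*v) A ` lattice_of B"
  by (simp add: lattice_of_def matrix_image_image)

text \<open>
  If \<open>M Z3\<close> is a rotation \<open>R\<close> of \<open>S M0 Z3\<close>, then any \<open>M'\<close> near \<open>M\<close> satisfies \<open>M' Z3 = R S' M0 Z3\<close> with
  \<open>S' = R\<^sup>T M' M\<^sup>-\<^sup>1 R S\<close>, which depends continuously on \<open>M'\<close>. So the classes of the lattices \<open>S M0 Z3\<close> with \<open>S\<close> close
  to the identity form an open set.
\<close>

theorem local_minimizer_iff_stable:
  assumes M0: "det M0 = 1"
  shows "local_minimizer \<alpha> (lattice_of M0) \<longleftrightarrow> stable \<alpha> (lattice_of M0)"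
proof
  assume "stable \<alpha> (lattice_of M0)"
  then obtain \<epsilon> where \<epsilon>: "\<epsilon> > 0" "\<And>S. det S = 1 \<Longrightarrow> norm (S - mat 1) < \<epsilon> \<Longrightarrow>
      theta (lattice_of M0) \<alpha> \<le> theta ((*v) S ` lattice_of M0) \<alpha>"
    unfolding stable_def by blast
  define U where "U = {rot_class (lattice_of (S ** M0)) | S. det S = 1 \<and> norm (S - mat 1) < \<epsilon>}"
  have "openin (top_of_set SL3) {M \<in> SL3. rot_class (lattice_of M) \<in> U}"
    unfolding openin_euclidean_subtopology_iff
  proof (intro conjI ballI)
    fix M assume "M \<in> {M \<in> SL3. rot_class (lattice_of M) \<in> U}"
    then obtain S where M: "det M = 1" and S: "det S = 1" "norm (S - mat 1) < \<epsilon>"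
      and eq: "rot_class (lattice_of M) = rot_class (lattice_of (S ** M0))"
      by (auto simp: U_def SL3_def)
    obtain R where R: "rotation_matrix R" and lat: "lattice_of M = (*v) R ` lattice_of (S ** M0)"
      using mem_rot_class[of "lattice_of M"] unfolding eq by (auto simp: rot_class_def)
    have RR: "transpose R ** R = mat 1" "R ** transpose R = mat 1" and dR: "det R = 1"
      using R by (auto simp: rotation_matrix_def orthogonal_matrix_def)
    have "invertible M" using M by (simp add: invertible_det_nz)
    then obtain N where N: "N ** M = mat 1" "M ** N = mat 1" unfolding invertible_def by blast
    have dN: "det N = 1" using arg_cong[OF N(1), of det] M by (simp add: det_mul)
    define \<phi> where "\<phi> M' = (transpose R ** M') ** (N ** R ** S)" for M'
    have "\<phi> M = transpose R ** (M ** N) ** R ** S" by (simp only: \<phi>_def matrix_mul_assoc)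
    then have \<phi>M: "\<phi> M = S" by (simp add: N RR)
    have "continuous_on UNIV \<phi>"
      unfolding \<phi>_def matrix_matrix_mult_def by (intro continuous_intros)
    then have "isCont \<phi> M" by (simp add: continuous_on_eq_continuous_at)
    moreover have "\<epsilon> - norm (S - mat 1) > 0" using S by simp
    ultimately obtain \<delta> where \<delta>: "\<delta> > 0" "\<And>M'. dist M' M < \<delta> \<Longrightarrow> dist (\<phi> M') S < \<epsilon> - norm (S - mat 1)"
      unfolding continuous_at_eps_delta \<phi>M by blast
    show "\<exists>e>0. \<forall>M'\<in>SL3. dist M' M < e \<longrightarrow> M' \<in> {M \<in> SL3. rot_class (lattice_of M) \<in> U}"
    proof (intro exI[of _ \<delta>] conjI ballI impI \<delta>(1))
      fix M' assume M': "M' \<in> SL3" "dist M' M < \<delta>"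
      have "norm (\<phi> M' - mat 1) \<le> dist (\<phi> M') S + norm (S - mat 1)"
        unfolding dist_norm by (metis diff_add_cancel add_diff_eq norm_triangle_ineq)
      then have 1: "norm (\<phi> M' - mat 1) < \<epsilon>" using \<delta>(2)[OF M'(2)] by simp
      have 2: "det (\<phi> M') = 1" using M' dR dN S by (simp add: \<phi>_def det_mul SL3_def)
      have "R ** \<phi> M' = (R ** transpose R) ** M' ** N ** R ** S" by (simp only: \<phi>_def matrix_mul_assoc)
      then have R\<phi>: "R ** \<phi> M' = M' ** N ** R ** S" by (simp add: RR)
      have "lattice_of M' = lattice_of ((M' ** N) ** M)" by (simp add: matrix_mul_assoc[symmetric] N)
      also have "\<dots> = lattice_of (R ** (\<phi> M' ** M0))"
        unfolding lattice_of_mult lat matrix_image_image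
        by (simp add: matrix_mul_assoc R\<phi>)
      finally have "rot_class (lattice_of M') = rot_class (lattice_of (\<phi> M' ** M0))"
        using rot_class_rotate[OF R] by (simp only: lattice_of_mult[of R])
      then show "M' \<in> {M \<in> SL3. rot_class (lattice_of M) \<in> U}"
        using M' 1 2 by (auto simp: U_def)
    qed
  qed auto
  moreover have "U \<subseteq> L3o"
    using M0 by (auto simp: U_def L3o_def SL3_def det_mul intro!: image_eqI)
  ultimately have "openin L3o_topology U" by (simp add: openin_L3o_topology)
  moreover have "rot_class (lattice_of M0) \<in> U"
    unfolding U_def using \<epsilon>(1) by (auto intro!: exI[of _ "mat 1"])
  moreover have "theta (lattice_of M0) \<alpha> \<le> theta \<Lambda> \<alpha>" if \<Lambda>: "rot_class \<Lambda> \<in> U" for \<Lambda>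
  proof -
    obtain S where S: "det S = 1" "norm (S - mat 1) < \<epsilon>" "rot_class \<Lambda> = rot_class (lattice_of (S ** M0))"
      using \<Lambda> by (auto simp: U_def)
    obtain R where "rotation_matrix R" "\<Lambda> = (*v) R ` lattice_of (S ** M0)"
      using mem_rot_class[of \<Lambda>] unfolding S(3) by (auto simp: rot_class_def)
    then have "theta \<Lambda> \<alpha> = theta ((*v) S ` lattice_of M0) \<alpha>"
      by (simp add: theta_rotate lattice_of_mult)
    then show ?thesis using \<epsilon>(2)[OF S(1,2)] by simp
  qed
  ultimately show "local_minimizer \<alpha> (lattice_of M0)"
    unfolding local_minimizer_def by blast
next
  assume "local_minimizer \<alpha> (lattice_of M0)"
  then obtain U where U: "openin L3o_topology U" "rot_class (lattice_of M0) \<in> U"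
    "\<And>\<Lambda>. rot_class \<Lambda> \<in> U \<Longrightarrow> theta (lattice_of M0) \<alpha> \<le> theta \<Lambda> \<alpha>"
    unfolding local_minimizer_def by blast
  let ?P = "{M \<in> SL3. rot_class (lattice_of M) \<in> U}"
  have "M0 \<in> ?P" using U(2) M0 by (simp add: SL3_def)
  moreover have "openin (top_of_set SL3) ?P" using U(1) by (simp add: openin_L3o_topology)
  ultimately obtain e where e: "e > 0" "\<And>M. M \<in> SL3 \<Longrightarrow> dist M M0 < e \<Longrightarrow> M \<in> ?P"
    unfolding openin_euclidean_subtopology_iff by meson
  have "continuous_on UNIV (\<lambda>S :: real^3^3. S ** M0)"
    unfolding matrix_matrix_mult_def by (intro continuous_intros)
  then have "isCont (\<lambda>S :: real^3^3. S ** M0) (mat 1)" by (simp add: continuous_on_eq_continuous_at)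
  then obtain \<delta> where \<delta>: "\<delta> > 0" "\<And>S :: real^3^3. dist S (mat 1) < \<delta> \<Longrightarrow> dist (S ** M0) M0 < e"
    unfolding continuous_at_eps_delta using e(1) by (auto simp: matrix_mul_lid)
  show "stable \<alpha> (lattice_of M0)"
    unfolding stable_def
  proof (intro exI[of _ \<delta>] conjI allI impI \<delta>(1))
    fix S :: "real^3^3" assume S: "det S = 1 \<and> norm (S - mat 1) < \<delta>"
    then have "S ** M0 \<in> ?P" using M0 \<delta>(2) by (intro e(2)) (auto simp: SL3_def det_mul dist_norm)
    then show "theta (lattice_of M0) \<alpha> \<le> theta ((*v) S ` lattice_of M0) \<alpha>"
      using U(3)[of "lattice_of (S ** M0)"] by (simp add: lattice_of_mult)
  qed
qed

text \<open>
  The indices are elements of the cyclic group of order three, so that the usual signs are built in. For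
  \<open>det S = 1\<close> this is the inverse transpose of \<open>S\<close>, written as a polynomial to make its continuity evident.
\<close>

definition cofactors :: "real^3^3 \<Rightarrow> real^3^3" where
  "cofactors S = (\<chi> i j. S $ (i + 1) $ (j + 1) * S $ (i + 2) $ (j + 2) - S $ (i + 1) $ (j + 2) * S $ (i + 2) $ (j + 1))"

lemma transpose_mul_cofactors:
  assumes "det S = 1" shows "transpose S ** cofactors S = mat 1"
proof -
  have 3: "(3::3) = 0" by simp
  have "(4::3) = 3 + 1" "(5::3) = 3 + 2" by simp_all
  then have cyc: "(4::3) = 1" "(5::3) = 2" by (simp_all only: 3 add_0)
  show ?thesis
    using assms
  by (simp add: cyc vec_eq_iff forall_3 cofactors_def matrix_matrix_mult_def transpose_def sum_3 det_3 mat_def algebra_simps)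
qed

lemma theta_dual_deformation:
  assumes M: "det M = 1" "transpose M ** N = mat 1" and S: "det S = 1" "transpose S ** S' = mat 1" and \<alpha>: "\<alpha> > 0"
  shows "theta ((*v) S ` lattice_of M) \<alpha> = theta ((*v) S' ` lattice_of N) (1 / \<alpha>) / sqrt (\<alpha> ^ 3)"
proof -
  have "transpose (S ** M) ** (S' ** N) = transpose M ** (transpose S ** S') ** N"
    by (simp add: matrix_transpose_mul matrix_mul_assoc)
  also have "\<dots> = mat 1" by (simp add: S M)
  finally show ?thesis
    using theta_duality[of "S ** M" "S' ** N" \<alpha>] M S \<alpha> by (simp add: det_mul lattice_of_mult)
qed

lemma det_dual:
  fixes M N :: "real^3^3"
  assumes "det M = 1" "transpose M ** N = mat 1" shows "det N = 1"
  using arg_cong[OF assms(2), of det] assms(1) by (simp add: det_mul)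

lemma dual_sym:
  fixes M N :: "real^3^3"
  assumes "transpose M ** N = mat 1" shows "transpose N ** M = mat 1"
  using arg_cong[OF assms, of transpose] by (simp add: matrix_transpose_mul)

text \<open>
  Duality with \<open>S\<close> and its inverse transpose, which is close to the identity if \<open>S\<close> is.
\<close>

lemma stable_dual:
  assumes M: "det M = 1" "transpose M ** N = mat 1" and \<alpha>: "\<alpha> > 0" and st: "stable (1 / \<alpha>) (lattice_of N)"
  shows "stable \<alpha> (lattice_of M)"
proof -
  obtain \<epsilon> where \<epsilon>: "\<epsilon> > 0" "\<And>S. det S = 1 \<Longrightarrow> norm (S - mat 1) < \<epsilon> \<Longrightarrow>
      theta (lattice_of N) (1 / \<alpha>) \<le> theta ((*v) S ` lattice_of N) (1 / \<alpha>)"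
    using st unfolding stable_def by blast
  have "continuous_on UNIV cofactors"
    unfolding cofactors_def by (intro continuous_intros)
  then have "isCont cofactors (mat 1)" by (simp add: continuous_on_eq_continuous_at)
  moreover have c1: "cofactors (mat 1) = mat 1"
    using transpose_mul_cofactors[of "mat 1"] by (simp add: transpose_mat)
  ultimately obtain \<delta> where \<delta>: "\<delta> > 0" "\<And>S. dist S (mat 1) < \<delta> \<Longrightarrow> dist (cofactors S) (mat 1) < \<epsilon>"
    unfolding continuous_at_eps_delta c1 using \<epsilon>(1) by blast
  show ?thesis unfolding stable_def
  proof (intro exI[of _ \<delta>] conjI allI impI \<delta>(1))
    fix S :: "real^3^3" assume S: "det S = 1 \<and> norm (S - mat 1) < \<delta>"
    have d: "transpose S ** cofactors S = mat 1" using S by (simp add: transpose_mul_cofactors)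
    have "theta (lattice_of N) (1 / \<alpha>) \<le> theta ((*v) (cofactors S) ` lattice_of N) (1 / \<alpha>)"
      using \<delta>(2)[of S] S det_dual[OF _ d] by (intro \<epsilon>(2)) (auto simp: dist_norm)
    then have "theta (lattice_of N) (1 / \<alpha>) / sqrt (\<alpha> ^ 3) \<le> theta ((*v) (cofactors S) ` lattice_of N) (1 / \<alpha>) / sqrt (\<alpha> ^ 3)"
      using \<alpha> by (intro divide_right_mono) auto
    then show "theta (lattice_of M) \<alpha> \<le> theta ((*v) S ` lattice_of M) \<alpha>"
      using theta_dual_deformation[OF M _ d \<alpha>] S theta_duality[OF M \<alpha>] by simp
  qed
qed

section \<open>Diagonal flows and shears\<close>

definition diag_mat :: "real^3 \<Rightarrow> real^3^3" where
  "diag_mat d = (\<chi> i j. if i = j then d $ i else 0)"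

definition diag_flow :: "real^3 \<Rightarrow> real \<Rightarrow> real^3^3" where
  "diag_flow d t = diag_mat (\<chi> i. exp (d $ i * t))"

lemma det_diag_flow: "d $ 1 + d $ 2 + d $ 3 = 0 \<Longrightarrow> det (diag_flow d t) = 1"
  by (simp add: det_3 diag_flow_def diag_mat_def mult_exp_exp distrib_right[symmetric])

lemma diag_flow_0: "diag_flow d 0 = mat 1"
  by (simp add: diag_flow_def diag_mat_def mat_def vec_eq_iff)

lemma diag_flow_dual: "transpose (diag_flow d t) ** diag_flow d (- t) = mat 1"
  by (simp add: vec_eq_iff forall_3 diag_flow_def diag_mat_def matrix_matrix_mult_def transpose_def sum_3 mat_def mult_exp_exp)

lemma strain_diag_flow: "strain (diag_flow d t) = diag_mat (\<chi> i. exp (2 * d $ i * t) - 1)"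
  by (simp add: vec_eq_iff forall_3 strain_def diag_flow_def diag_mat_def matrix_matrix_mult_def transpose_def sum_3 mat_def mult_exp_exp)

lemma off_sq_diag_mat: "off_sq (diag_mat d) = 0"
  by (simp add: off_sq_def diag_mat_def)

lemma continuous_diag_flow: "continuous_on UNIV (diag_flow d)"
proof -
  have "continuous_on UNIV (\<lambda>t. if i = j then exp (d $ i * t) else 0)" for i j :: 3
    by (cases "i = j") (auto intro!: continuous_intros)
  then have "continuous_on UNIV (\<lambda>t. diag_flow d t)"
    unfolding diag_flow_def diag_mat_def vec_lambda_beta by (intro continuous_on_vec_lambda)
  then show ?thesis by simp
qed

lemma eventually_diag_flow_near:
  assumes "\<epsilon> > 0" shows "\<forall>\<^sub>F t in nhds 0. norm (diag_flow d t - mat 1) < \<epsilon>"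
proof -
  have "isCont (diag_flow d) 0" using continuous_diag_flow by (simp add: continuous_on_eq_continuous_at)
  then obtain \<delta> where "\<delta> > 0" "\<And>t. dist t 0 < \<delta> \<Longrightarrow> dist (diag_flow d t) (mat 1) < \<epsilon>"
    unfolding continuous_at_eps_delta diag_flow_0 using assms by blast
  then show ?thesis unfolding eventually_nhds_metric by (auto simp: dist_norm)
qed

lemma has_vector_derivative_vec_lambda:
  fixes f :: "real \<Rightarrow> 'n::finite \<Rightarrow> 'b::euclidean_space"
  assumes "\<And>i. ((\<lambda>t. f t i) has_vector_derivative f' i) (at t)"
  shows "((\<lambda>t. \<chi> i. f t i) has_vector_derivative (\<chi> i. f' i)) (at t)"
proof -
  have "((\<lambda>t. \<Sum>i\<in>UNIV. axis i (f t i)) has_vector_derivative (\<Sum>i\<in>UNIV. axis i (f' i))) (at t)"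
  proof (rule has_vector_derivative_sum)
    fix i :: 'n
    have "bounded_linear (axis i :: 'b \<Rightarrow> 'b ^ 'n)"
      unfolding linear_conv_bounded_linear[symmetric] by (rule linearI) (auto simp: axis_def vec_eq_iff)
    then show "((\<lambda>t. axis i (f t i)) has_vector_derivative axis i (f' i)) (at t)"
      by (rule bounded_linear.has_vector_derivative) (rule assms)
  qed
  moreover have "(\<Sum>i\<in>UNIV. axis i (g i)) = (\<chi> i. g i)" for g :: "'n \<Rightarrow> 'b"
    by (simp add: vec_eq_iff axis_def sum.delta)
  ultimately show ?thesis by simp
qed

lemma deformation_diag_flow:
  assumes "d $ 1 + d $ 2 + d $ 3 = 0"
  shows "deformation_with_velocity (diag_flow d) (diag_mat d)"
proof -
  define D where "D n t = diag_mat (\<chi> i. (d $ i) ^ n * exp (d $ i * t))" for n t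
  have D: "(D n has_vector_derivative D (Suc n) t) (at t)" for n t
    unfolding D_def diag_mat_def
    by (intro has_vector_derivative_vec_lambda) (auto intro!: derivative_eq_intros simp flip: has_real_derivative_iff_has_vector_derivative)
  have D0: "D 0 t = diag_flow d t" for t by (simp add: D_def diag_flow_def)
  have "(diag_flow d has_vector_derivative D 1 0) (at 0)"
    using D[of 0 0] by (simp add: D0[abs_def] eta_contract_eq)
  then have "vector_derivative (diag_flow d) (at 0) = D 1 0" by (rule vector_derivative_at)
  also have "D 1 0 = diag_mat d" by (simp add: D_def)
  finally have v: "vector_derivative (diag_flow d) (at 0) - diag_mat d \<in> so3"
    by (simp add: so3_def transpose_def vec_eq_iff)
  show ?thesis
    unfolding deformation_with_velocity_def smooth_on_open_def
    using v assms D D0 by (auto intro!: exI[of _ UNIV] exI[of _ D] simp: diag_flow_0 SL3_def det_diag_flow)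
qed

definition unit_mat :: "3 \<Rightarrow> 3 \<Rightarrow> real^3^3" where
  "unit_mat i j = (\<chi> k l. if k = i \<and> l = j then 1 else 0)"

lemma shear_alt: "shear i j t = mat 1 + t *\<^sub>R unit_mat i j"
  by (simp add: shear_def unit_mat_def)

lemma shear_dual:
  assumes "i \<noteq> j" shows "transpose (shear i j t) ** shear j i (- t) = mat 1"
  using exhaust_3[of i] exhaust_3[of j] assms
  by (elim disjE) (simp_all add: vec_eq_iff forall_3 shear_nth matrix_matrix_mult_def transpose_def sum_3 mat_def)

lemma deformation_shear:
  assumes "i \<noteq> j" shows "deformation_with_velocity (shear i j) (unit_mat i j)"
proof -
  define D where "D n t = (if n = 0 then shear i j t else if n = 1 then unit_mat i j else 0)" for n :: nat and t :: real
  have 1: "(shear i j has_vector_derivative unit_mat i j) (at t)" for t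
    unfolding shear_alt[abs_def] by (auto intro!: derivative_eq_intros)
  have D012: "D 0 = shear i j" "D (Suc 0) = (\<lambda>t. unit_mat i j)" "D (Suc (Suc m)) = (\<lambda>t. 0)" for m
    by (auto simp: D_def)
  have D: "(D n has_vector_derivative D (Suc n) t) (at t)" for n t
  proof (cases n)
    case 0
    then show ?thesis using 1 by (simp add: D012)
  next
    case (Suc m)
    then show ?thesis by (cases m) (simp_all add: D012)
  qed
  have v: "vector_derivative (shear i j) (at 0) - unit_mat i j \<in> so3"
    using vector_derivative_at[OF 1[of 0]] by (simp add: so3_def transpose_def vec_eq_iff)
  have "shear i j 0 = mat 1" by (simp add: shear_alt)
  then show ?thesis
    unfolding deformation_with_velocity_def smooth_on_open_def
    using v assms D by (auto intro!: exI[of _ UNIV] exI[of _ D] simp: SL3_def det_shear D_def)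
qed

lemma independent_diag: "independent_directions 2 (\<lambda>i. if i = 0 then diag_mat (vector [1, -1, 0]) else diag_mat (vector [0, 1, -1]))"
  unfolding independent_directions_def
proof (intro conjI allI impI)
  fix c :: "nat \<Rightarrow> real" and i :: nat
  assume "(\<Sum>i<2. c i *\<^sub>R (if i = 0 then diag_mat (vector [1, -1, 0]) else diag_mat (vector [0, 1, -1]))) \<in> so3" and i: "i < 2"
  then have "(c 0 *\<^sub>R diag_mat (vector [1, -1, 0]) + c 1 *\<^sub>R diag_mat (vector [0, 1, -1])) \<in> so3"
    by (simp add: numeral_2_eq_2)
  then have "c 0 = 0 \<and> c 1 = 0"
    by (simp add: so3_def transpose_def vec_eq_iff forall_3 diag_mat_def)
  then show "c i = 0" using i by (cases "i = 0") (auto simp: less_2_cases_iff)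
qed (auto simp: sl3_def trace_def sum_3 diag_mat_def)

text \<open>
  A combination of strictly upper triangular unit matrices is antisymmetric only if it vanishes.
\<close>

lemma independent_shear: "independent_directions 3 (\<lambda>i. if i = 0 then unit_mat 1 2 else if i = 1 then unit_mat 1 3 else unit_mat 2 3)"
  unfolding independent_directions_def
proof (intro conjI allI impI)
  fix c :: "nat \<Rightarrow> real" and i :: nat
  assume "(\<Sum>i<3. c i *\<^sub>R (if i = 0 then unit_mat 1 2 else if i = 1 then unit_mat 1 3 else unit_mat 2 3)) \<in> so3" and i: "i < 3"
  then have "(c 0 *\<^sub>R unit_mat 1 2 + c 1 *\<^sub>R unit_mat 1 3 + c 2 *\<^sub>R unit_mat 2 3) \<in> so3"
    by (simp add: numeral_3_eq_3 numeral_2_eq_2)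
  then have "c 0 = 0 \<and> c 1 = 0 \<and> c 2 = 0"
    by (simp add: so3_def transpose_def vec_eq_iff forall_3 unit_mat_def)
  moreover have "i = 0 \<or> i = 1 \<or> i = 2" using i by auto
  ultimately show "c i = 0" by auto
qed (auto simp: sl3_def trace_def sum_3 unit_mat_def)

lemma eventually_minus_nhds_0:
  assumes "\<forall>\<^sub>F t in nhds (0 :: real). P t" shows "\<forall>\<^sub>F t in nhds 0. P (- t)"
proof -
  have "filterlim uminus (nhds (0::real)) (nhds 0)"
    using tendsto_uminus_nhds[of "0::real"] by simp
  then show ?thesis using assms by (simp add: filterlim_iff)
qed

lemma theta_diag_flow_le:
  assumes \<Lambda>: "cubic \<Lambda>" "gauss_summable \<Lambda>" and \<alpha>: "\<alpha> > 0" and d: "d $ 1 + d $ 2 + d $ 3 = 0"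
    and D: "diag_coeff \<alpha> \<Lambda> < 0"
  shows "\<forall>\<^sub>F t in nhds 0. theta ((*v) (diag_flow d t) ` \<Lambda>) \<alpha> \<le> theta \<Lambda> \<alpha>"
proof -
  obtain \<epsilon> where \<epsilon>: "\<epsilon> > 0" "\<And>S. det S = 1 \<Longrightarrow> norm (S - mat 1) < \<epsilon> \<Longrightarrow> off_sq (strain S) = 0 \<Longrightarrow> strain S \<noteq> 0 \<Longrightarrow>
      theta ((*v) S ` \<Lambda>) \<alpha> < theta \<Lambda> \<alpha>"
    using theta_less_diagonal[OF \<Lambda> \<alpha> D] by blast
  show ?thesis
    using eventually_diag_flow_near[OF \<epsilon>(1), of d]
  proof eventually_elim
    case (elim t)
    show ?case
    proof (cases "strain (diag_flow d t) = 0")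
      case True
      then show ?thesis using theta_image[of "diag_flow d t" \<Lambda> \<alpha>] d by (simp add: det_diag_flow quad_def theta_eq_gsum)
    next
      case False
      then show ?thesis
        using \<epsilon>(2)[of "diag_flow d t"] elim d by (simp add: det_diag_flow strain_diag_flow off_sq_diag_mat)
    qed
  qed
qed

lemma not_stable_diag:
  assumes \<Lambda>: "cubic \<Lambda>" "gauss_summable \<Lambda>" and \<alpha>: "\<alpha> > 0"
    and D: "diag_coeff \<alpha> \<Lambda> < 0"
  shows "\<not> stable \<alpha> \<Lambda>"
proof
  assume "stable \<alpha> \<Lambda>"
  then obtain \<eta> where \<eta>: "\<eta> > 0" "\<And>S. det S = 1 \<Longrightarrow> norm (S - mat 1) < \<eta> \<Longrightarrow> theta \<Lambda> \<alpha> \<le> theta ((*v) S ` \<Lambda>) \<alpha>"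
    unfolding stable_def by blast
  obtain \<epsilon> where \<epsilon>: "\<epsilon> > 0" "\<And>S. det S = 1 \<Longrightarrow> norm (S - mat 1) < \<epsilon> \<Longrightarrow> off_sq (strain S) = 0 \<Longrightarrow> strain S \<noteq> 0 \<Longrightarrow>
      theta ((*v) S ` \<Lambda>) \<alpha> < theta \<Lambda> \<alpha>"
    using theta_less_diagonal[OF \<Lambda> \<alpha> D] by blast
  define d :: "real^3" where "d = vector [1, -1, 0]"
  have d: "d $ 1 + d $ 2 + d $ 3 = 0" "d $ 1 = 1" by (simp_all add: d_def)
  obtain \<delta> where \<delta>: "\<delta> > 0" "\<And>t. dist t 0 < \<delta> \<Longrightarrow> norm (diag_flow d t - mat 1) < min \<eta> \<epsilon>"
    using eventually_diag_flow_near[of "min \<eta> \<epsilon>" d] \<eta>(1) \<epsilon>(1) unfolding eventually_nhds_metric by auto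
  define S where "S = diag_flow d (\<delta> / 2)"
  have S: "det S = 1" "norm (S - mat 1) < \<eta>" "norm (S - mat 1) < \<epsilon>" "off_sq (strain S) = 0"
    using \<delta>(2)[of "\<delta> / 2"] \<delta>(1) d(1) by (auto simp: S_def det_diag_flow strain_diag_flow off_sq_diag_mat)
  have "strain S $ 1 $ 1 \<noteq> 0" using \<delta>(1) d(2) by (simp add: S_def strain_diag_flow diag_mat_def)
  then have "strain S \<noteq> 0" by auto
  then show False using \<eta>(2)[OF S(1,2)] \<epsilon>(2)[OF S(1,3,4)] by simp
qed

lemma det_fcc: "det fcc_matrix = 1"
  by (rule det_dual[OF det_bcc fcc_bcc_dual])

lemma local_minimizer_BCC: "local_minimizer \<alpha> BCC \<longleftrightarrow> stable \<alpha> BCC"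
  unfolding BCC_lattice by (rule local_minimizer_iff_stable[OF det_bcc])

lemma local_minimizer_FCC: "local_minimizer \<alpha> FCC \<longleftrightarrow> stable \<alpha> FCC"
  unfolding FCC_lattice by (rule local_minimizer_iff_stable[OF det_fcc])

lemma theta_FCC_deformed:
  assumes "det S = 1" "transpose S ** S' = mat 1" "\<alpha> > 0"
  shows "theta ((*v) S ` FCC) \<alpha> = theta ((*v) S' ` BCC) (1 / \<alpha>) / sqrt (\<alpha> ^ 3)"
  unfolding FCC_lattice BCC_lattice
  by (rule theta_dual_deformation[OF det_fcc dual_sym[OF fcc_bcc_dual] assms])

lemma theta_FCC_dual: "\<alpha> > 0 \<Longrightarrow> theta FCC \<alpha> = theta BCC (1 / \<alpha>) / sqrt (\<alpha> ^ 3)"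
  unfolding FCC_lattice BCC_lattice
  by (rule theta_duality[OF det_fcc dual_sym[OF fcc_bcc_dual]])

lemma directions_BCC:
  assumes \<alpha>: "\<alpha> > 0" and D: "diag_coeff \<alpha> BCC < 0" and O: "off_coeff \<alpha> BCC > 0"
  shows "d $ 1 + d $ 2 + d $ 3 = 0 \<Longrightarrow> local_max_along \<alpha> BCC (diag_mat d)"
    and "i \<noteq> j \<Longrightarrow> local_min_along \<alpha> BCC (unit_mat i j)"
  using theta_diag_flow_le[OF cubic_bcc gauss_summable_bcc \<alpha> _ D, of d] deformation_diag_flow[of d]
    theta_le_shear[OF cubic_bcc gauss_summable_bcc \<alpha> O, of i j] deformation_shear[of i j]
  unfolding local_max_along_def local_min_along_def by blast+

text \<open>
  The inverse transposes of the diagonal flow and of the shear are again a diagonal flow and a shear, with reversed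
  time, so duality carries over the statements for BCC with the same or the transposed direction.
\<close>

lemma directions_FCC:
  assumes \<alpha>: "\<alpha> > 0" and D: "diag_coeff (1 / \<alpha>) BCC < 0"
    and O: "off_coeff (1 / \<alpha>) BCC > 0"
  shows "d $ 1 + d $ 2 + d $ 3 = 0 \<Longrightarrow> local_max_along \<alpha> FCC (diag_mat d)"
    and "i \<noteq> j \<Longrightarrow> local_min_along \<alpha> FCC (unit_mat i j)"
proof -
  have \<beta>: "1 / \<alpha> > 0" and sq: "sqrt (\<alpha> ^ 3) > 0" using \<alpha> by auto
  show "local_max_along \<alpha> FCC (diag_mat d)" if d: "d $ 1 + d $ 2 + d $ 3 = 0"
    unfolding local_max_along_def
  proof (intro exI[of _ "diag_flow d"] conjI)
    show "deformation_with_velocity (diag_flow d) (diag_mat d)" by (rule deformation_diag_flow[OF d])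
    have "\<forall>\<^sub>F t in nhds 0. theta ((*v) (diag_flow d (- t)) ` BCC) (1 / \<alpha>) \<le> theta BCC (1 / \<alpha>)"
      by (rule eventually_minus_nhds_0[OF theta_diag_flow_le[OF cubic_bcc gauss_summable_bcc \<beta> d D]])
    then show "\<forall>\<^sub>F t in nhds 0. theta ((*v) (diag_flow d t) ` FCC) \<alpha> \<le> theta FCC \<alpha>"
    proof eventually_elim
      case (elim t)
      then show ?case
        using theta_FCC_deformed[OF det_diag_flow[OF d] diag_flow_dual \<alpha>, of t] theta_FCC_dual[OF \<alpha>] sq
        by (simp add: divide_right_mono)
    qed
  qed
  show "local_min_along \<alpha> FCC (unit_mat i j)" if ij: "i \<noteq> j"
    unfolding local_min_along_def
  proof (intro exI[of _ "shear i j"] conjI)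
    show "deformation_with_velocity (shear i j) (unit_mat i j)" by (rule deformation_shear[OF ij])
    have "\<forall>\<^sub>F t in nhds 0. theta BCC (1 / \<alpha>) \<le> theta ((*v) (shear j i (- t)) ` BCC) (1 / \<alpha>)"
      by (rule eventually_minus_nhds_0[OF theta_le_shear[OF cubic_bcc gauss_summable_bcc \<beta> O not_sym[OF ij]]])
    then show "\<forall>\<^sub>F t in nhds 0. theta FCC \<alpha> \<le> theta ((*v) (shear i j t) ` FCC) \<alpha>"
    proof eventually_elim
      case (elim t)
      then show ?case
        using theta_FCC_deformed[OF det_shear[OF ij] shear_dual[OF ij] \<alpha>, of t] theta_FCC_dual[OF \<alpha>] sq
        by (simp add: divide_right_mono)
    qed
  qed
qed

definition saddle :: "real \<Rightarrow> (real^3) set \<Rightarrow> bool" where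
  "saddle \<alpha> \<Lambda> \<longleftrightarrow> (\<exists>v. independent_directions 2 v \<and> (\<forall>i<2. local_max_along \<alpha> \<Lambda> (v i))) \<and>
     (\<exists>w. independent_directions 3 w \<and> (\<forall>i<3. local_min_along \<alpha> \<Lambda> (w i)))"

text \<open>
  The two diagonal and three shear directions below span the five-dimensional tangent space.
\<close>

lemma saddleI:
  assumes "\<And>d. d $ 1 + d $ 2 + d $ 3 = 0 \<Longrightarrow> local_max_along \<alpha> \<Lambda> (diag_mat d)"
    and "\<And>i j. i \<noteq> j \<Longrightarrow> local_min_along \<alpha> \<Lambda> (unit_mat i j)"
  shows "saddle \<alpha> \<Lambda>"
  unfolding saddle_def
  using assms(1)[of "vector [1, -1, 0]"] assms(1)[of "vector [0, 1, -1]"] assms(2)[of 1 2] assms(2)[of 1 3] assms(2)[of 2 3]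
  by (intro conjI exI[of _ "\<lambda>i. if i = 0 then diag_mat (vector [1, -1, 0]) else diag_mat (vector [0, 1, -1])"]
      exI[of _ "\<lambda>i. if i = 0 then unit_mat 1 2 else if i = 1 then unit_mat 1 3 else unit_mat 2 3"])
    (auto intro: independent_diag independent_shear)

section \<open>The layered lattices\<close>

definition box_vec :: "real \<Rightarrow> int \<times> int \<times> int \<Rightarrow> real^3" where
  "box_vec y = (\<lambda>(a, b, k). vector [sqrt y / 2 * of_int a, of_int b / (2 * sqrt y), of_int k / 2])"

lemma L_y1_eq:
  assumes y: "y > 0" shows "L_y1 y = box_vec y ` bcc_set"
proof (intro subset_antisym subsetI)
  fix p assume "p \<in> L_y1 y"
  then obtain k m n :: int where p: "p = of_int m *\<^sub>R vector [sqrt y, 0, 0] + of_int n *\<^sub>R vector [0, 1 / sqrt y, 0]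
        + layer_shift y k + of_int k *\<^sub>R vector [0, 0, 1/2]"
    by (auto simp: L_y1_def)
  define e :: int where "e = (if odd k then 1 else 0)"
  have "p = box_vec y (2 * m + e, 2 * n + e, k)"
    using y by (auto simp: p box_vec_def layer_shift_def e_def vec_eq_iff forall_3 field_simps)
  moreover have "(2 * m + e, 2 * n + e, k) \<in> bcc_set" by (auto simp: bcc_set_def e_def)
  ultimately show "p \<in> box_vec y ` bcc_set" by blast
next
  fix p assume "p \<in> box_vec y ` bcc_set"
  then obtain a b k where p: "p = box_vec y (a, b, k)" and abk: "even a = even b" "even b = even k" by (auto simp: bcc_set_def)
  define e :: int where "e = (if odd k then 1 else 0)"
  have "even (a - e)" "even (b - e)" using abk by (auto simp: e_def)
  then obtain m n where "a - e = 2 * m" "b - e = 2 * n" by (meson evenE)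
  then have a: "a = 2 * m + e" "b = 2 * n + e" by auto
  have "p = of_int m *\<^sub>R vector [sqrt y, 0, 0] + of_int n *\<^sub>R vector [0, 1 / sqrt y, 0]
        + layer_shift y k + of_int k *\<^sub>R vector [0, 0, 1/2]"
    unfolding p a using y by (auto simp: box_vec_def layer_shift_def e_def vec_eq_iff forall_3 field_simps)
  then show "p \<in> L_y1 y" unfolding L_y1_def by blast
qed

lemma norm_box_vec:
  assumes "y > 0"
  shows "(norm (box_vec y (a, b, k)))\<^sup>2 = y / 4 * (of_int a)\<^sup>2 + (of_int b)\<^sup>2 / (4 * y) + (of_int k)\<^sup>2 / 4"
  using assms by (simp add: norm3 box_vec_def power_mult_distrib power_divide)

lemma gauss_summable_L_y1:
  assumes y: "y > 0" shows "gauss_summable (L_y1 y)"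
  unfolding gauss_summable_def L_y1_eq[OF y]
proof (intro allI impI)
  fix \<beta> :: real assume \<beta>: "\<beta> > 0"
  have inj: "inj (box_vec y)" using y by (auto simp: inj_def box_vec_def vec_eq_iff forall_3)
  define T :: "real \<times> real \<times> real \<Rightarrow> real^3" where "T = (\<lambda>(u, v, w). vector [sqrt y / 2 * u, v / (2 * sqrt y), w / 2])"
  have lin: "linear T"
    by (rule linearI) (auto simp: T_def vec_eq_iff forall_3 algebra_simps add_divide_distrib)
  have "inj T" unfolding linear_injective_0[OF lin]
    using y by (auto simp: T_def vec_eq_iff forall_3 zero_prod_def)
  then have "(\<lambda>n. exp (- \<beta> * (norm (T (triple n)))\<^sup>2)) summable_on UNIV"
    by (rule gauss_linear_summable[OF lin _ \<beta>])
  moreover have "T (triple n) = box_vec y n" for n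
    by (cases n) (simp add: T_def triple_def box_vec_def)
  ultimately have "(\<lambda>n. exp (- \<beta> * (norm (box_vec y n))\<^sup>2)) summable_on bcc_set"
    by (auto intro: summable_on_subset_banach)
  then show "(\<lambda>p. exp (- \<beta> * (norm p)\<^sup>2)) summable_on box_vec y ` bcc_set"
    using inj_on_subset[OF inj, of bcc_set] by (subst summable_on_reindex) (auto simp: o_def)
qed

lemma L_y1_five_quarters_norm:
  assumes "p \<in> L_y1 (5 / 4)" "p \<noteq> 0" shows "(norm p)\<^sup>2 \<ge> 61 / 80"
proof -
  obtain a b k where p: "p = box_vec (5 / 4) (a, b, k)" and n: "(a, b, k) \<in> bcc_set"
    using assms(1) by (auto simp: L_y1_eq)
  have N: "(norm p)\<^sup>2 = 5 / 16 * (of_int a)\<^sup>2 + (of_int b)\<^sup>2 / 5 + (of_int k)\<^sup>2 / 4"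
    unfolding p by (subst norm_box_vec) auto
  have sq: "(real_of_int x)\<^sup>2 \<ge> real_of_int (m\<^sup>2)" if "\<bar>x\<bar> \<ge> m" "m \<ge> 0" for x m :: int
  proof -
    have "m\<^sup>2 \<le> \<bar>x\<bar>\<^sup>2" using that by (intro power_mono) auto
    then have "real_of_int (m\<^sup>2) \<le> real_of_int (x\<^sup>2)" by (simp only: of_int_le_iff power2_abs)
    then show ?thesis by simp
  qed
  have nn: "(real_of_int a)\<^sup>2 \<ge> 0" "(real_of_int b)\<^sup>2 \<ge> 0" "(real_of_int k)\<^sup>2 \<ge> 0" by auto
  show ?thesis
  proof (cases "even k")
    case True
    then have ev: "even a" "even b" "even k" using n by (auto simp: bcc_set_def)
    have "a \<noteq> 0 \<or> b \<noteq> 0 \<or> k \<noteq> 0"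
    proof (rule ccontr)
      assume "\<not> ?thesis"
      then have "p = 0" by (simp add: p box_vec_def vec_eq_iff forall_3)
      then show False using assms(2) by simp
    qed
    moreover have "\<bar>x\<bar> \<ge> 2" if "even x" "x \<noteq> 0" for x :: int using that by (auto elim!: evenE)
    ultimately have "(real_of_int a)\<^sup>2 \<ge> 4 \<or> (real_of_int b)\<^sup>2 \<ge> 4 \<or> (real_of_int k)\<^sup>2 \<ge> 4"
      using ev sq[of 2 a] sq[of 2 b] sq[of 2 k] by auto
    then show ?thesis unfolding N using nn by linarith
  next
    case False
    then have "odd a" "odd b" "odd k" using n by (auto simp: bcc_set_def)
    then have "a \<noteq> 0" "b \<noteq> 0" "k \<noteq> 0" by auto
    then have "\<bar>a\<bar> \<ge> 1" "\<bar>b\<bar> \<ge> 1" "\<bar>k\<bar> \<ge> 1" by linarith+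
    then have "(real_of_int a)\<^sup>2 \<ge> 1" "(real_of_int b)\<^sup>2 \<ge> 1" "(real_of_int k)\<^sup>2 \<ge> 1"
      using sq[of 1 a] sq[of 1 b] sq[of 1 k] by auto
    then show ?thesis unfolding N by linarith
  qed
qed

lemma zero_in_L_y1:
  assumes y: "y > 0" shows "0 \<in> L_y1 y"
proof -
  have "0 = box_vec y (0, 0, 0)" by (simp add: box_vec_def vec_eq_iff forall_3)
  then show ?thesis unfolding L_y1_eq[OF y] by (auto simp: bcc_set_def intro: image_eqI)
qed

text \<open>
  Apart from that of the origin, every term of \<open>L_y1 (5 / 4)\<close> is at most \<open>exp (- \<pi> (\<alpha> - 1) q)\<close> times its value at
  \<open>\<alpha> = 1\<close>, with \<open>q = 61 / 80\<close>, whereas \<open>L_y1 1\<close> has a vector of squared length \<open>3 / 4 = q - 1 / 80\<close>.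
\<close>

lemma L_y1_not_minimal:
  obtains \<alpha>0 where "\<alpha>0 > 0" "\<And>\<alpha>. \<alpha> > \<alpha>0 \<Longrightarrow> theta (L_y1 (5 / 4)) \<alpha> < theta (L_y1 1) \<alpha>"
proof -
  define L where "L = L_y1 (5 / 4)"
  have sumL: "(\<lambda>p. exp (- pi * \<alpha> * (norm p)\<^sup>2)) summable_on P" if "\<alpha> > 0" "P \<subseteq> L" for \<alpha> P
  proof -
    have "(\<lambda>p. exp (- (pi * \<alpha>) * (norm p)\<^sup>2)) summable_on L"
      using gauss_summable_L_y1[of "5 / 4"] that unfolding gauss_summable_def L_def by auto
    then show ?thesis using that(2) by (auto intro: summable_on_subset_banach)
  qed
  define C where "C = (\<Sum>\<^sub>\<infinity>p\<in>L - {0}. exp (- pi * 1 * (norm p)\<^sup>2))"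
  have C: "C \<ge> 0" unfolding C_def by (intro infsum_nonneg) auto
  define q :: real where "q = 61 / 80"
  \<comment> \<open>Beyond this bound \<open>exp (\<pi> \<alpha> / 80) \<ge> 1 + \<pi> \<alpha> / 80\<close> exceeds \<open>C exp (\<pi> q)\<close>.\<close>
  define \<alpha>0 where "\<alpha>0 = 1 + C * exp (pi * q) * 80 / pi"
  have \<alpha>0: "\<alpha>0 > 0" using C by (auto simp: \<alpha>0_def intro!: add_pos_nonneg)
  have "theta L \<alpha> < theta (L_y1 1) \<alpha>" if \<alpha>: "\<alpha> > \<alpha>0" for \<alpha>
  proof -
    have \<alpha>1: "\<alpha> > 1" "\<alpha> > 0" "\<alpha> > C * exp (pi * q) * 80 / pi"
      using \<alpha> C by (auto simp: \<alpha>0_def intro: le_less_trans[rotated])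
    have "theta L \<alpha> = (\<Sum>p\<in>{0 :: real^3}. exp (- pi * \<alpha> * (norm p)\<^sup>2)) + (\<Sum>\<^sub>\<infinity>p\<in>L - {0}. exp (- pi * \<alpha> * (norm p)\<^sup>2))"
      unfolding theta_def
    proof (rule infsum_finite_part[of "\<lambda>p. exp (- pi * \<alpha> * (norm p)\<^sup>2)" L "{0}"])
      show "(\<lambda>p. exp (- pi * \<alpha> * (norm p)\<^sup>2)) summable_on L" using \<alpha>1 by (intro sumL) auto
    qed (use zero_in_L_y1[of "5 / 4"] in \<open>auto simp: L_def\<close>)
    also have "\<dots> = 1 + (\<Sum>\<^sub>\<infinity>p\<in>L - {0}. exp (- pi * \<alpha> * (norm p)\<^sup>2))" by simp
    also have "(\<Sum>\<^sub>\<infinity>p\<in>L - {0}. exp (- pi * \<alpha> * (norm p)\<^sup>2)) \<le>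
       (\<Sum>\<^sub>\<infinity>p\<in>L - {0}. exp (- pi * (\<alpha> - 1) * q) * exp (- pi * 1 * (norm p)\<^sup>2))"
    proof (intro infsum_mono sumL summable_on_cmult_right)
      fix p assume "p \<in> L - {0}"
      then have "q \<le> (norm p)\<^sup>2" using L_y1_five_quarters_norm by (auto simp: q_def L_def)
      then have "pi * (\<alpha> - 1) * q \<le> pi * (\<alpha> - 1) * (norm p)\<^sup>2" using \<alpha>1 by (intro mult_left_mono) auto
      then show "exp (- pi * \<alpha> * (norm p)\<^sup>2) \<le> exp (- pi * (\<alpha> - 1) * q) * exp (- pi * 1 * (norm p)\<^sup>2)"
        by (simp add: mult_exp_exp algebra_simps)
    qed (use \<alpha>1 in auto)
    also have "\<dots> = exp (- pi * (\<alpha> - 1) * q) * C" unfolding C_def by (rule infsum_cmult_right')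
    also have "\<dots> = exp (- pi * \<alpha> * q) * (exp (pi * q) * C)"
      by (simp add: mult_exp_exp mult.assoc[symmetric]) (simp add: algebra_simps)
    also have "\<dots> < exp (- pi * \<alpha> * q) * exp (pi * \<alpha> / 80)"
    proof (rule mult_strict_left_mono)
      have "exp (pi * q) * C < pi * \<alpha> / 80" using \<alpha>1(3) by (simp add: field_simps)
      also have "\<dots> \<le> exp (pi * \<alpha> / 80)" using exp_ge_add_one_self[of "pi * \<alpha> / 80"] by linarith
      finally show "exp (pi * q) * C < exp (pi * \<alpha> / 80)" .
    qed auto
    also have "\<dots> = exp (- pi * \<alpha> * (3 / 4))" by (simp add: mult_exp_exp q_def)
    finally have 1: "theta L \<alpha> < 1 + exp (- pi * \<alpha> * (3 / 4))" by simp
    define u where "u = box_vec 1 (1, 1, 1)"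
    have u: "u \<in> L_y1 1" "(norm u)\<^sup>2 = 3 / 4" by (auto simp: L_y1_eq u_def norm_box_vec bcc_set_def)
    then have u0: "u \<noteq> 0" by auto
    have "(\<Sum>p\<in>{0, u}. exp (- pi * \<alpha> * (norm p)\<^sup>2)) \<le> theta (L_y1 1) \<alpha>"
      unfolding theta_def
    proof (rule finite_sum_le_infsum)
      have "(\<lambda>p. exp (- (pi * \<alpha>) * (norm p)\<^sup>2)) summable_on L_y1 1"
        using gauss_summable_L_y1[of 1] \<alpha>1 unfolding gauss_summable_def by auto
      then show "(\<lambda>p. exp (- pi * \<alpha> * (norm p)\<^sup>2)) summable_on L_y1 1" by simp
    qed (use u zero_in_L_y1[of 1] in auto)
    then have "1 + exp (- pi * \<alpha> * (3 / 4)) \<le> theta (L_y1 1) \<alpha>" using u u0 by simp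
    then show ?thesis using 1 by linarith
  qed
  then show ?thesis using that \<alpha>0 unfolding L_def by blast
qed

section \<open>Local behaviour of BCC and FCC\<close>

theorem theorem1p8:
  shows "\<exists>\<alpha>\<^sub>1 > (0::real).
     (\<forall>\<alpha> > \<alpha>\<^sub>1.
        \<not> is_arg_min (\<lambda>y. theta (L_y1 y) \<alpha>) (\<lambda>y. y \<ge> 1) 1 \<and>
        \<not> local_minimizer \<alpha> BCC) \<and>
     (\<forall>\<alpha>. 0 < \<alpha> \<and> \<alpha> < 1 / \<alpha>\<^sub>1 \<longrightarrow> \<not> local_minimizer \<alpha> FCC) \<and>
     (\<forall>\<alpha>\<in>alphas. local_minimizer \<alpha> BCC) \<and>
     (\<forall>\<alpha> > \<alpha>\<^sub>1.
        (\<exists>v. independent_directions 2 v \<and> (\<forall>i<2. local_max_along \<alpha> BCC (v i))) \<and>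
        (\<exists>w. independent_directions 3 w \<and> (\<forall>i<3. local_min_along \<alpha> BCC (w i)))) \<and>
     (\<forall>\<alpha>\<in>inv_alphas. local_minimizer \<alpha> FCC) \<and>
     (\<forall>\<alpha>. 0 < \<alpha> \<and> \<alpha> < 1 / \<alpha>\<^sub>1 \<longrightarrow>
        (\<exists>v. independent_directions 2 v \<and> (\<forall>i<2. local_max_along \<alpha> FCC (v i))) \<and>
        (\<exists>w. independent_directions 3 w \<and> (\<forall>i<3. local_min_along \<alpha> FCC (w i))))"
proof -
  obtain \<alpha>0 where \<alpha>0: "\<alpha>0 > 0" "\<And>\<alpha>. \<alpha> \<ge> \<alpha>0 \<Longrightarrow> diag_coeff \<alpha> BCC < 0"
    "\<And>\<alpha>. \<alpha> \<ge> \<alpha>0 \<Longrightarrow> off_coeff \<alpha> BCC > 0"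
    using bcc_second_variation_signs by blast
  obtain \<alpha>2 where \<alpha>2: "\<alpha>2 > 0" "\<And>\<alpha>. \<alpha> > \<alpha>2 \<Longrightarrow> theta (L_y1 (5 / 4)) \<alpha> < theta (L_y1 1) \<alpha>"
    using L_y1_not_minimal by blast
  define \<alpha>1 where "\<alpha>1 = max \<alpha>0 \<alpha>2"
  have \<alpha>1: "\<alpha>1 > 0" "\<alpha>1 \<ge> \<alpha>0" "\<alpha>1 \<ge> \<alpha>2" using \<alpha>0 by (auto simp: \<alpha>1_def)
  have inv: "1 / \<alpha> > \<alpha>1" if "0 < \<alpha>" "\<alpha> < 1 / \<alpha>1" for \<alpha> using that \<alpha>1(1) by (simp add: field_simps)
  have nb: "\<not> stable \<alpha> BCC" if "\<alpha> > \<alpha>1" for \<alpha>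
    using that \<alpha>1 \<alpha>0(2)[of \<alpha>] by (intro not_stable_diag[OF cubic_bcc gauss_summable_bcc]) auto
  have nf: "\<not> stable \<alpha> FCC" if "0 < \<alpha>" "\<alpha> < 1 / \<alpha>1" for \<alpha>
    using nb[OF inv[OF that]] stable_dual[OF det_bcc fcc_bcc_dual, of "1 / \<alpha>"] that
    unfolding BCC_lattice FCC_lattice by auto
  have nL: "\<not> is_arg_min (\<lambda>y. theta (L_y1 y) \<alpha>) (\<lambda>y. y \<ge> 1) 1" if "\<alpha> > \<alpha>1" for \<alpha>
    using \<alpha>2(2)[of \<alpha>] that \<alpha>1 unfolding is_arg_min_def by (auto intro!: exI[of _ "5 / 4"])
  have sb: "stable \<alpha> BCC" if "\<alpha> \<in> alphas" for \<alpha>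
  proof -
    have "0 < \<alpha>" "\<alpha> \<le> 1" using that by (auto simp: alphas_def)
    then show ?thesis
      using stable_dual[OF det_bcc fcc_bcc_dual, of \<alpha>] stable_FCC[of "1 / \<alpha>"]
      unfolding BCC_lattice FCC_lattice by simp
  qed
  have sf: "stable \<alpha> FCC" if "\<alpha> \<in> inv_alphas" for \<alpha>
    using that by (intro stable_FCC) (auto simp: inv_alphas_def alphas_def)
  have db: "saddle \<alpha> BCC" if "\<alpha> > \<alpha>1" for \<alpha>
    using directions_BCC[of \<alpha>] \<alpha>0(2,3)[of \<alpha>] that \<alpha>1 by (intro saddleI) auto
  have df: "saddle \<alpha> FCC" if "0 < \<alpha>" "\<alpha> < 1 / \<alpha>1" for \<alpha>
    using directions_FCC[OF that(1)] \<alpha>0(2,3)[of "1 / \<alpha>"] inv[OF that] \<alpha>1 by (intro saddleI) auto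
  show ?thesis
    unfolding local_minimizer_BCC local_minimizer_FCC saddle_def[symmetric]
    by (rule exI[of _ \<alpha>1], intro conjI allI impI ballI)
      (use \<alpha>1(1) nb nf nL sb sf db df in auto)
qed

end
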